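(* Let $c_0=1/(102400\,\pi)\approx3.1\times10^{-6}$. Suppose $\Sigma=Q^{-1}=(1-\zeta)I_N+\zeta\,1_N1_N^\top\in\mathbb R^{N\times N}$ with $\zeta\in[0,1)$, let $N_1=\dots=N_d=s$ so that $N=sd$, and take $h_j=(1-\zeta)/\sqrt{10s}$ for every $j\in[d]$. Let $d\ge2$ and $D=\operatorname{diag}(Q_{1,1}^{-1},\dots,Q_{d,d}^{-1})$ (block diagonal). Then the largest eigenvalue of $I_N-DQ$ equals $$\psi_{\max}(I_N-DQ)=\frac{(N-s)\zeta}{1+(N-s-1)\zeta}.$$ It follows that the deterministic-scan component-wise MALA chain satisfies $$\|P_{\mathrm{DCW}}-\Pi\|\le 1-\frac{c_0^{3}(1-\zeta)}{2^9\,N\sqrt s\,(d+1)}\cdot\frac{\bigl(1+(N-s-1)\zeta\bigr)^2}{\bigl(1+(N-1)\zeta\bigr)^3}.$$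
   Context: Let $\Pi=\mathcal N(\mu,Q^{-1})$ on $\mathbb R^N$ with density $\pi$, where $Q$ is a symmetric positive definite precision matrix. Coordinates are split into $d$ consecutive blocks of sizes $N_1,\dots,N_d$ with $\sum_jN_j=N$; write $x=(x_1,\dots,x_d)$, $x_j\in\mathbb R^{N_j}$, $x_{-j}=(x_k)_{k\ne j}$, and $Q=(Q_{j,k})_{j,k\in[d]}$ with $Q_{j,k}\in\mathbb R^{N_j\times N_k}$, where $[d]=\{1,\dots,d\}$. $1_N$ is the all-ones column vector in $\mathbb R^N$. Block MALA update $K_j$ with step size $h_j>0$: from $x$, propose $y=(y_j,x_{-j})$ with $y_j\mid x\sim\mathcal N(x_j+h_j\nabla_j\log\pi(x),\,2h_jI_{N_j})$, where $\nabla_j$ is the gradient in $x_j$; accept $y$ with probability $\min\{1,\pi(y)r_j(y,x)/(\pi(x)r_j(x,y))\}$, where $r_j(x,y)$ is the proposal density of $y_j$ given $x$; otherwise stay at $x$. $K_j$ is the resulting Markov kernel on $\mathbb R^N$, acting on $L^2(\Pi)$ by $(K_jf)(x)=\int f(y)K_j(x,\mathrm dy)$. The deterministic-scan component-wise MALA kernel is $P_{\mathrm{DCW}}=K_d\cdots K_1$. $\Pi$ also denotes the operator on $L^2(\Pi)$ sending $f$ to the constant $\int f\,\mathrm d\Pi$, and $\|\cdot\|$ is the operator norm on $L^2(\Pi)$. *)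

theory Defs
  imports "HOL-Probability.Probability"
begin

text \<open>
  The state space \<open>\<real>\<^sup>N\<close> with \<open>N = s d\<close>, split into \<open>d\<close> blocks of equal size \<open>s\<close>, is
  \<open>real ^ ('d \<times> 's)\<close> with \<open>CARD('d) = d\<close> and \<open>CARD('s) = s\<close>: coordinate \<open>(j, a)\<close> is coordinate \<open>a\<close> of
  block \<open>j\<close>. Blocks are visited in the linear order of \<open>'d\<close>; no order inside a block is needed.
\<close>

definition block :: "real ^ ('d::finite \<times> 's::finite) \<Rightarrow> 'd \<Rightarrow> real ^ 's" where
  "block x j = (\<chi> a. x $ (j, a))"

text \<open>The point \<open>(z, x\<^sub>-\<^sub>j)\<close>.\<close>

definition block_upd ::
    "real ^ ('d::finite \<times> 's::finite) \<Rightarrow> 'd \<Rightarrow> real ^ 's \<Rightarrow> real ^ ('d \<times> 's)" where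
  "block_upd x j z = (\<chi> i. if fst i = j then z $ snd i else x $ i)"

definition submat ::
    "real ^ ('d::finite \<times> 's::finite) ^ ('d \<times> 's) \<Rightarrow> 'd \<Rightarrow> 'd \<Rightarrow> real ^ 's ^ 's" where
  "submat A j k = (\<chi> a b. A $ (j, a) $ (k, b))"

definition block_diag ::
    "('d::finite \<Rightarrow> real ^ 's::finite ^ 's) \<Rightarrow> real ^ ('d \<times> 's) ^ ('d \<times> 's)" where
  "block_diag B = (\<chi> i k. if fst i = fst k then B (fst i) $ snd i $ snd k else 0)"

definition sym_pos_def :: "real ^ 'n::finite ^ 'n \<Rightarrow> bool" where
  "sym_pos_def A \<longleftrightarrow> transpose A = A \<and> (\<forall>x. x \<noteq> 0 \<longrightarrow> x \<bullet> (A *v x) > 0)"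

text \<open>
  Only real eigenvalues are considered. This is the intended reading for \<open>I - DQ\<close> with \<open>D\<close>, \<open>Q\<close>
  symmetric positive definite, which is similar to a symmetric matrix.
\<close>

definition eigenvalues :: "real ^ 'n::finite ^ 'n \<Rightarrow> real set" where
  "eigenvalues A = {k. \<exists>v. v \<noteq> 0 \<and> A *v v = k *\<^sub>R v}"

definition max_eigenvalue :: "real ^ 'n::finite ^ 'n \<Rightarrow> real" where
  "max_eigenvalue A = Max (eigenvalues A)"

text \<open>The normal law with mean \<open>m\<close> and (invertible) covariance matrix \<open>S\<close>.\<close>

definition mvn_density :: "real ^ 'n::finite \<Rightarrow> real ^ 'n ^ 'n \<Rightarrow> real ^ 'n \<Rightarrow> real" where
  "mvn_density m S x =
     exp (- ((x - m) \<bullet> (matrix_inv S *v (x - m))) / 2) / sqrt ((2 * pi) ^ CARD('n) * det S)"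

definition mvn :: "real ^ 'n::finite \<Rightarrow> real ^ 'n ^ 'n \<Rightarrow> (real ^ 'n) measure" where
  "mvn m S = density lborel (\<lambda>x. ennreal (mvn_density m S x))"

definition gradient :: "('a::real_inner \<Rightarrow> real) \<Rightarrow> 'a \<Rightarrow> 'a" where
  "gradient f x = (THE g. GDERIV f x :> g)"

text \<open>
  Block MALA for a target density \<open>p\<close> on \<open>\<real>\<^sup>N\<close>; \<open>mat (2 * h)\<close> is the scalar matrix \<open>2h I\<close>.
\<close>

definition mala_mean ::
    "(real ^ ('d::finite \<times> 's::finite) \<Rightarrow> real) \<Rightarrow> 'd \<Rightarrow> real \<Rightarrow> real ^ ('d \<times> 's) \<Rightarrow> real ^ 's" where
  "mala_mean p j h x =
     block x j + h *\<^sub>R gradient (\<lambda>z. ln (p (block_upd x j z))) (block x j)"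

definition mala_proposal ::
    "(real ^ ('d::finite \<times> 's::finite) \<Rightarrow> real) \<Rightarrow> 'd \<Rightarrow> real \<Rightarrow> real ^ ('d \<times> 's)
      \<Rightarrow> (real ^ ('d \<times> 's)) measure" where
  "mala_proposal p j h x = distr (mvn (mala_mean p j h x) (mat (2 * h))) borel (block_upd x j)"

definition mala_prop_density ::
    "(real ^ ('d::finite \<times> 's::finite) \<Rightarrow> real) \<Rightarrow> 'd \<Rightarrow> real \<Rightarrow> real ^ ('d \<times> 's)
      \<Rightarrow> real ^ ('d \<times> 's) \<Rightarrow> real" where
  "mala_prop_density p j h x y = mvn_density (mala_mean p j h x) (mat (2 * h)) (block y j)"

definition mala_accept ::
    "(real ^ ('d::finite \<times> 's::finite) \<Rightarrow> real) \<Rightarrow> 'd \<Rightarrow> real \<Rightarrow> real ^ ('d \<times> 's)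
      \<Rightarrow> real ^ ('d \<times> 's) \<Rightarrow> real" where
  "mala_accept p j h x y =
     min 1 (p y * mala_prop_density p j h y x / (p x * mala_prop_density p j h x y))"

definition mala_kernel ::
    "(real ^ ('d::finite \<times> 's::finite) \<Rightarrow> real) \<Rightarrow> 'd \<Rightarrow> real \<Rightarrow> real ^ ('d \<times> 's)
      \<Rightarrow> (real ^ ('d \<times> 's)) measure" where
  "mala_kernel p j h x =
     mala_proposal p j h x \<bind> (\<lambda>y.
     measure_pmf (bernoulli_pmf (mala_accept p j h x y)) \<bind> (\<lambda>acc.
     return borel (if acc then y else x)))"

text \<open>The product \<open>K L\<close> of kernels: first move with \<open>K\<close>, then with \<open>L\<close>, so that as operators
  \<open>(K L) f = K (L f)\<close>.\<close>

definition kernel_comp :: "('a \<Rightarrow> 'a measure) \<Rightarrow> ('a \<Rightarrow> 'a measure) \<Rightarrow> 'a \<Rightarrow> 'a measure" where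
  "kernel_comp K L x = K x \<bind> L"

text \<open>\<open>kernel_scan K [1, \<dots>, d] = K\<^sub>d \<dots> K\<^sub>1\<close>.\<close>

primrec kernel_scan ::
    "('j \<Rightarrow> 'a \<Rightarrow> 'a::topological_space measure) \<Rightarrow> 'j list \<Rightarrow> 'a \<Rightarrow> 'a measure" where
  "kernel_scan K [] = return borel"
| "kernel_scan K (j # js) = kernel_comp (kernel_scan K js) (K j)"

definition dcw_mala_kernel ::
    "(real ^ ('d::{finite, linorder} \<times> 's::finite) \<Rightarrow> real) \<Rightarrow> ('d \<Rightarrow> real) \<Rightarrow> real ^ ('d \<times> 's)
      \<Rightarrow> (real ^ ('d \<times> 's)) measure" where
  "dcw_mala_kernel p h =
     kernel_scan (\<lambda>j. mala_kernel p j (h j)) (sorted_list_of_set (UNIV :: 'd set))"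

definition kernel_op :: "('a \<Rightarrow> 'a measure) \<Rightarrow> ('a \<Rightarrow> real) \<Rightarrow> 'a \<Rightarrow> real" where
  "kernel_op K f x = (\<integral>y. f y \<partial>K x)"

text \<open>
  Elements of \<open>L\<^sup>2(M)\<close> are represented by functions. The norm is infinite outside \<open>L\<^sup>2(M)\<close>, so a
  finite operator norm includes the claim that the operator maps \<open>L\<^sup>2(M)\<close> into itself.
\<close>

definition L2_norm :: "'a measure \<Rightarrow> ('a \<Rightarrow> real) \<Rightarrow> ereal" where
  "L2_norm M f =
     (if f \<in> borel_measurable M \<and> integrable M (\<lambda>x. (f x)\<^sup>2)
      then ereal (sqrt (\<integral>x. (f x)\<^sup>2 \<partial>M)) else \<infinity>)"

definition L2_opnorm :: "'a measure \<Rightarrow> (('a \<Rightarrow> real) \<Rightarrow> 'a \<Rightarrow> real) \<Rightarrow> ereal" where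
  "L2_opnorm M T = (SUP f \<in> {f. L2_norm M f \<le> 1}. L2_norm M (T f))"

end

theory Submission
  imports Defs
begin

text \<open>
  Every block update \<open>K\<^sub>j\<close> is reversible and positive: after diagonalising the conditional precision
  matrix, its moving part has, multiplied by the density of the fibre measure at \<open>u\<close>, the form
  \<open>G(u, v) min (w u) (w v)\<close> with \<open>G\<close> a Gaussian kernel, and both factors are positive definite. On a fibre the update is
  compared with a reversible autoregressive kernel \<open>M\<close> of the same drift: \<open>M \<le> c \<kappa> + M\<^sup>2 / (c \<kappa>)\<close>,
  where \<open>\<kappa>\<close> is the density of the accepted moves, and \<open>\<integral> M\<^sup>2 / \<kappa> \<le> 5 / 2\<close>. This bounds the Dirichlet form
  of \<open>K\<^sub>j\<close> below by \<open>1 / (960 s)\<close> times that of the exact Gibbs update of block \<open>j\<close>.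

  The gaps of \<open>M\<close> and of the random-scan Gibbs sampler follow from Lipschitz contraction together with
  self-adjointness. The Gibbs sampler contracts the norm \<open>x \<mapsto> sqrt (x \<bullet> Q x)\<close>, with a rate that involves
  \<open>(1 - \<zeta>) / (1 + (N - 1) \<zeta>)\<close>. For the product \<open>T = K\<^sub>d \<cdots> K\<^sub>1\<close> of positive contractions,
  \<open>\<Sum>\<^sub>j \<langle>(I - K\<^sub>j) g, g\<rangle> \<le> d\<^sup>2 (\<parallel>g\<parallel>\<^sup>2 - \<parallel>T g\<parallel>\<^sup>2)\<close>, so the norm of \<open>T - \<Pi>\<close> is at most
  \<open>1 - (1 - \<zeta>) / (3840 s d\<^sup>2 (1 + (N - 1) \<zeta>))\<close>; this is smaller than the asserted bound because
  \<open>c\<^sub>0\<^sup>3\<close> is tiny and \<open>d \<le> d + 1\<close>, \<open>1 \<le> sqrt s\<close>, \<open>N = s d\<close>.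
\<close>

section \<open>Density of bounded Lipschitz functions in \<open>L\<^sup>2\<close>\<close>

text \<open>Rejections hide any contraction of MALA itself, hence the detour through
  \<open>M\<close>, for which a synchronous coupling contracts visibly. Gaps are stated as
  inequalities between double integrals of \<open>(f x - f y)^2\<close>, as nonnegative integrals,
  so that they can be compared fibre by fibre and integrated without integrability conditions. Test
  functions are bounded and Lipschitz: boundedness makes the integrals finite, the Lipschitz
  constant is what a contraction shrinks, and restriction to a fibre preserves both. Only at the end
  does density together with invariance pass to all of L2. The number 10 in the step size keeps the
  product of \<open>s\<close> one-dimensional comparison costs bounded. The factor \<open>s\<close>
  in the Dirichlet comparison then comes from the gap of \<open>M\<close>, of order
  \<open>1 / sqrt s\<close>, which enters twice: once directly and once through the choice of
  \<open>c\<close>. Exchangeability gives target, proposal and conditional covariance one common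
  eigenbasis on a block, and \<open>d \<ge> 2\<close> keeps the eigenvalues of a diagonal block of
  \<open>Q\<close> within a factor two, so one scalar step suits all directions.\<close>

definition bdd_lipschitz :: "('a::metric_space \<Rightarrow> real) \<Rightarrow> bool" where
  "bdd_lipschitz f \<longleftrightarrow> (\<exists>C. \<forall>x. \<bar>f x\<bar> \<le> C) \<and> (\<exists>L. \<forall>x y. \<bar>f x - f y\<bar> \<le> L * dist x y)"

lemma bdd_lipschitzI:
  "(\<And>x. \<bar>f x\<bar> \<le> C) \<Longrightarrow> (\<And>x y. \<bar>f x - f y\<bar> \<le> L * dist x y) \<Longrightarrow> bdd_lipschitz f"
  by (auto simp: bdd_lipschitz_def)

lemma bdd_lipschitz_const: "bdd_lipschitz (\<lambda>x. c)"
  by (rule bdd_lipschitzI[of _ "\<bar>c\<bar>" 0]) auto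

lemma bdd_lipschitz_add:
  assumes "bdd_lipschitz f" "bdd_lipschitz g"
  shows "bdd_lipschitz (\<lambda>x. f x + g x)"
proof -
  obtain C L C' L' where *: "\<And>x. \<bar>f x\<bar> \<le> C" "\<And>x y. \<bar>f x - f y\<bar> \<le> L * dist x y"
    "\<And>x. \<bar>g x\<bar> \<le> C'" "\<And>x y. \<bar>g x - g y\<bar> \<le> L' * dist x y"
    using assms unfolding bdd_lipschitz_def by metis
  show ?thesis
  proof (rule bdd_lipschitzI)
    show "\<bar>f x + g x\<bar> \<le> C + C'" for x using *(1)[of x] *(3)[of x] by linarith
    show "\<bar>f x + g x - (f y + g y)\<bar> \<le> (L + L') * dist x y" for x y
      using *(2)[of x y] *(4)[of x y] by (simp add: distrib_right abs_if split: if_splits)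
  qed
qed

lemma bdd_lipschitz_cmult:
  assumes "bdd_lipschitz f"
  shows "bdd_lipschitz (\<lambda>x. c * f x)"
proof -
  obtain C L where *: "\<And>x. \<bar>f x\<bar> \<le> C" "\<And>x y. \<bar>f x - f y\<bar> \<le> L * dist x y"
    using assms unfolding bdd_lipschitz_def by metis
  show ?thesis
  proof (rule bdd_lipschitzI)
    show "\<bar>c * f x\<bar> \<le> \<bar>c\<bar> * C" for x using *(1)[of x] by (simp add: abs_mult mult_left_mono)
    show "\<bar>c * f x - c * f y\<bar> \<le> (\<bar>c\<bar> * L) * dist x y" for x y
      using mult_left_mono[OF *(2)[of x y], of "\<bar>c\<bar>"]
      by (simp add: abs_mult right_diff_distrib[symmetric] mult.assoc)
  qed
qed

lemma bdd_lipschitz_continuous: "bdd_lipschitz f \<Longrightarrow> continuous_on UNIV f"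
proof -
  assume "bdd_lipschitz f"
  then obtain L where L: "\<And>x y. \<bar>f x - f y\<bar> \<le> L * dist x y" by (auto simp: bdd_lipschitz_def)
  have "L * dist x y \<le> \<bar>L\<bar> * dist x y" for x y by (intro mult_right_mono) auto
  then have "\<bar>L\<bar>-lipschitz_on UNIV f"
    using L by (intro lipschitz_onI) (auto simp: dist_real_def intro: order_trans[OF L])
  then show ?thesis by (rule lipschitz_on_continuous_on)
qed

lemma bdd_lipschitz_measurable: "bdd_lipschitz f \<Longrightarrow> f \<in> borel_measurable borel"
  by (intro borel_measurable_continuous_onI bdd_lipschitz_continuous)

text \<open>Membership in the L2 closure of the bounded Lipschitz functions. The error is a
  nonnegative integral, so square integrability of \<open>f\<close> does not have to be carried
  along.\<close>

definition L2_approx :: "'a::metric_space measure \<Rightarrow> ('a \<Rightarrow> real) \<Rightarrow> bool" where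
  "L2_approx M f \<longleftrightarrow> f \<in> borel_measurable borel \<and>
     (\<forall>e>0. \<exists>\<phi>. bdd_lipschitz \<phi> \<and> (\<integral>\<^sup>+x. ennreal ((f x - \<phi> x)\<^sup>2) \<partial>M) < ennreal e)"

text \<open>Since \<open>(a + b)^2 \<le> 2 a^2 + 2 b^2\<close>, two errors below \<open>e/4\<close>
  combine to one below \<open>e\<close>; this makes the class closed.\<close>

lemma L2_approx_lim:
  assumes M: "sets M = sets borel" and [measurable]: "f \<in> borel_measurable borel"
  assumes "\<And>e. e > 0 \<Longrightarrow> \<exists>g. L2_approx M g \<and> (\<integral>\<^sup>+x. ennreal ((f x - g x)\<^sup>2) \<partial>M) < ennreal e"
  shows "L2_approx M f"
  unfolding L2_approx_def
proof (intro conjI allI impI)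
  note [measurable_cong] = M
  fix e :: real assume e: "e > 0"
  obtain g where g: "L2_approx M g" "(\<integral>\<^sup>+x. ennreal ((f x - g x)\<^sup>2) \<partial>M) < ennreal (e/4)"
    using assms(3)[of "e/4"] e by auto
  from g(1) have [measurable]: "g \<in> borel_measurable borel" by (simp add: L2_approx_def)
  obtain \<phi> where p: "bdd_lipschitz \<phi>" "(\<integral>\<^sup>+x. ennreal ((g x - \<phi> x)\<^sup>2) \<partial>M) < ennreal (e/4)"
    using g(1) e unfolding L2_approx_def by (meson divide_pos_pos zero_less_numeral)
  have [measurable]: "\<phi> \<in> borel_measurable borel" by (rule bdd_lipschitz_measurable[OF p(1)])
  have "(\<integral>\<^sup>+x. ennreal ((f x - \<phi> x)\<^sup>2) \<partial>M)
     \<le> (\<integral>\<^sup>+x. 2 * ennreal ((f x - g x)\<^sup>2) + 2 * ennreal ((g x - \<phi> x)\<^sup>2) \<partial>M)"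
  proof (rule nn_integral_mono)
    fix x
    have "(f x - \<phi> x)\<^sup>2 \<le> 2 * (f x - g x)\<^sup>2 + 2 * (g x - \<phi> x)\<^sup>2"
      using sum_squares_bound[of "f x - g x" "g x - \<phi> x"] by (simp add: power2_eq_square algebra_simps)
    then have "ennreal ((f x - \<phi> x)\<^sup>2) \<le> ennreal (2 * (f x - g x)\<^sup>2 + 2 * (g x - \<phi> x)\<^sup>2)"
      by (rule ennreal_leI)
    also have "\<dots> = 2 * ennreal ((f x - g x)\<^sup>2) + 2 * ennreal ((g x - \<phi> x)\<^sup>2)"
      by (simp add: ennreal_plus ennreal_mult del: ennreal_plus[symmetric])
    finally show "ennreal ((f x - \<phi> x)\<^sup>2) \<le> 2 * ennreal ((f x - g x)\<^sup>2) + 2 * ennreal ((g x - \<phi> x)\<^sup>2)" .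
  qed
  also have "\<dots> = 2 * (\<integral>\<^sup>+x. ennreal ((f x - g x)\<^sup>2) \<partial>M) + 2 * (\<integral>\<^sup>+x. ennreal ((g x - \<phi> x)\<^sup>2) \<partial>M)"
    by (simp add: nn_integral_add nn_integral_cmult)
  also have "\<dots> < 2 * ennreal (e/4) + 2 * ennreal (e/4)"
    using g(2) p(2) by (intro add_strict_mono ennreal_mult_strict_left_mono) auto
  also have "\<dots> = ennreal e"
  proof -
    have "2 * ennreal (e/4) = ennreal (e/2)" using ennreal_mult[of 2 "e/4"] e by simp
    then have "2 * ennreal (e/4) + 2 * ennreal (e/4) = ennreal (e/2) + ennreal (e/2)" by simp
    also have "\<dots> = ennreal e" using e by (subst ennreal_plus[symmetric]) auto
    finally show ?thesis .
  qed
  finally show "\<exists>\<phi>. bdd_lipschitz \<phi> \<and> (\<integral>\<^sup>+x. ennreal ((f x - \<phi> x)\<^sup>2) \<partial>M) < ennreal e" using p(1) by blast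
qed fact

text \<open>Adding a Lipschitz summand shifts the approximant and leaves the error unchanged. The
  general case is a limit of such sums.\<close>

lemma L2_approx_add:
  assumes M: "sets M = sets borel" and f: "L2_approx M f" and g: "L2_approx M g"
  shows "L2_approx M (\<lambda>x. f x + g x)"
proof -
  note [measurable_cong] = M
  have [measurable]: "f \<in> borel_measurable borel" "g \<in> borel_measurable borel"
    using f g by (auto simp: L2_approx_def)
  have 1: "L2_approx M (\<lambda>x. f x + \<phi> x)" if p: "bdd_lipschitz \<phi>" for \<phi>
    unfolding L2_approx_def
  proof (intro conjI allI impI)
    note [measurable] = bdd_lipschitz_measurable[OF p]
    show "(\<lambda>x. f x + \<phi> x) \<in> borel_measurable borel" by measurable
    fix e :: real assume "e > 0"
    then obtain \<psi> where "bdd_lipschitz \<psi>" "(\<integral>\<^sup>+x. ennreal ((f x - \<psi> x)\<^sup>2) \<partial>M) < ennreal e"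
      using f unfolding L2_approx_def by blast
    then show "\<exists>\<psi>. bdd_lipschitz \<psi> \<and> (\<integral>\<^sup>+x. ennreal ((f x + \<phi> x - \<psi> x)\<^sup>2) \<partial>M) < ennreal e"
      using p by (intro exI[of _ "\<lambda>x. \<psi> x + \<phi> x"]) (auto intro: bdd_lipschitz_add)
  qed
  show ?thesis
  proof (rule L2_approx_lim[OF M])
    fix e :: real assume "e > 0"
    then obtain \<psi> where "bdd_lipschitz \<psi>" "(\<integral>\<^sup>+x. ennreal ((g x - \<psi> x)\<^sup>2) \<partial>M) < ennreal e"
      using g unfolding L2_approx_def by blast
    then show "\<exists>k. L2_approx M k \<and> (\<integral>\<^sup>+x. ennreal ((f x + g x - k x)\<^sup>2) \<partial>M) < ennreal e"
      using 1 by (intro exI[of _ "\<lambda>x. f x + \<psi> x"]) auto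
  qed measurable
qed

lemma L2_approx_cmult:
  assumes M: "sets M = sets borel" and f: "L2_approx M f"
  shows "L2_approx M (\<lambda>x. c * f x)"
proof (cases "c = 0")
  case True
  then show ?thesis by (auto simp: L2_approx_def intro!: exI[of _ "\<lambda>x. 0"] bdd_lipschitz_const)
next
  case False
  note [measurable_cong] = M
  have [measurable]: "f \<in> borel_measurable borel" using f by (auto simp: L2_approx_def)
  show ?thesis
    unfolding L2_approx_def
  proof (intro conjI allI impI)
    fix e :: real assume e: "e > 0"
    then obtain \<phi> where p: "bdd_lipschitz \<phi>" "(\<integral>\<^sup>+x. ennreal ((f x - \<phi> x)\<^sup>2) \<partial>M) < ennreal (e / c\<^sup>2)"
      using f False unfolding L2_approx_def by (meson divide_pos_pos zero_less_power2)
    note [measurable] = bdd_lipschitz_measurable[OF p(1)]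
    have "(\<integral>\<^sup>+x. ennreal ((c * f x - c * \<phi> x)\<^sup>2) \<partial>M) = (\<integral>\<^sup>+x. ennreal (c\<^sup>2) * ennreal ((f x - \<phi> x)\<^sup>2) \<partial>M)"
      by (simp add: right_diff_distrib[symmetric] power_mult_distrib ennreal_mult)
    also have "\<dots> = ennreal (c\<^sup>2) * (\<integral>\<^sup>+x. ennreal ((f x - \<phi> x)\<^sup>2) \<partial>M)" by (simp add: nn_integral_cmult)
    also have "\<dots> < ennreal (c\<^sup>2) * ennreal (e / c\<^sup>2)"
      using p(2) False by (intro ennreal_mult_strict_left_mono) auto
    also have "\<dots> = ennreal e" using False e by (simp add: ennreal_mult[symmetric])
    finally show "\<exists>\<phi>. bdd_lipschitz \<phi> \<and> (\<integral>\<^sup>+x. ennreal ((c * f x - \<phi> x)\<^sup>2) \<partial>M) < ennreal e"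
      using bdd_lipschitz_cmult[OF p(1)] by blast
  qed measurable
qed

lemma L2_approx_bdd_lipschitz: "bdd_lipschitz f \<Longrightarrow> L2_approx M f"
  by (auto simp: L2_approx_def intro: bdd_lipschitz_measurable intro!: exI[of _ f])

lemma L2_approx_sum:
  assumes "sets M = sets borel" "\<And>i. i \<in> I \<Longrightarrow> L2_approx M (f i)"
  shows "L2_approx M (\<lambda>x. \<Sum>i\<in>I. f i x)"
  using assms(2)
  by (induction I rule: infinite_finite_induct)
     (auto intro: L2_approx_bdd_lipschitz bdd_lipschitz_const L2_approx_add[OF assms(1)])

text \<open>Dominated convergence for the squared error. The passages to closed sets, disjoint
  unions, bounded functions and finally L2 functions all go through it.\<close>

lemma L2_approx_LIMSEQ:
  assumes M: "sets M = sets borel" and fin: "finite_measure M"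
    and f[measurable]: "f \<in> borel_measurable borel" and g: "\<And>n. L2_approx M (g n)"
    and dom: "\<And>n x. (f x - g n x)\<^sup>2 \<le> w x"
    and w: "w \<in> borel_measurable borel" "(\<integral>\<^sup>+x. ennreal (w x) \<partial>M) < \<infinity>"
    and lim: "\<And>x. (\<lambda>n. g n x) \<longlonglongrightarrow> f x"
  shows "L2_approx M f"
proof (rule L2_approx_lim[OF M f])
  note [measurable_cong] = M
  fix e :: real assume e: "e > 0"
  have [measurable]: "g n \<in> borel_measurable borel" for n using g by (auto simp: L2_approx_def)
  have "(\<lambda>n. \<integral>\<^sup>+x. ennreal ((f x - g n x)\<^sup>2) \<partial>M) \<longlonglongrightarrow> (\<integral>\<^sup>+x. 0 \<partial>M)"
  proof (rule nn_integral_dominated_convergence[where w = "\<lambda>x. ennreal (w x)"])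
    show "AE x in M. (\<lambda>n. ennreal ((f x - g n x)\<^sup>2)) \<longlonglongrightarrow> 0"
    proof (rule AE_I2)
      fix x
      have "(\<lambda>n. (f x - g n x)\<^sup>2) \<longlonglongrightarrow> (f x - f x)\<^sup>2" by (intro tendsto_intros lim)
      then show "(\<lambda>n. ennreal ((f x - g n x)\<^sup>2)) \<longlonglongrightarrow> 0"
        using tendsto_ennrealI by fastforce
    qed
  qed (use w dom in \<open>auto intro: ennreal_leI\<close>)
  then have "eventually (\<lambda>n. (\<integral>\<^sup>+x. ennreal ((f x - g n x)\<^sup>2) \<partial>M) < ennreal e) sequentially"
    using e by (intro order_tendstoD(2)[of _ 0]) auto
  then obtain n where "(\<integral>\<^sup>+x. ennreal ((f x - g n x)\<^sup>2) \<partial>M) < ennreal e"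
    by (auto simp: eventually_sequentially)
  then show "\<exists>g. L2_approx M g \<and> (\<integral>\<^sup>+x. ennreal ((f x - g x)\<^sup>2) \<partial>M) < ennreal e" using g by blast
qed

lemma L2_approx_indicator_closed:
  fixes F :: "'a::metric_space set"
  assumes M: "sets M = sets borel" and fin: "finite_measure M" and F: "closed F"
  shows "L2_approx M (indicator F)"
proof (cases "F = {}")
  case True
  then have "(indicator F :: 'a \<Rightarrow> real) = (\<lambda>x. 0)" by auto
  then show ?thesis by (simp add: L2_approx_bdd_lipschitz bdd_lipschitz_const)
next
  case False
  \<comment> \<open>These tents decrease to the indicator because \<open>F\<close> is closed. For
    empty \<open>F\<close> the default \<open>infdist x {} = 0\<close> would produce the limit 1,
    hence the separate case.\<close>
  define g where "g n x = max 0 (1 - real n * infdist x F)" for n x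
  show ?thesis
  proof (rule L2_approx_LIMSEQ[OF M fin, where g = g and w = "\<lambda>x. 1"])
    show "indicator F \<in> borel_measurable borel" using F by (intro borel_measurable_indicator borel_closed)
    show "L2_approx M (g n)" for n
    proof (rule L2_approx_bdd_lipschitz, rule bdd_lipschitzI)
      show "\<bar>g n x\<bar> \<le> 1" for x by (auto simp: g_def infdist_nonneg)
      fix x y
      have "\<bar>infdist x F - infdist y F\<bar> \<le> dist x y" using infdist_triangle_abs by blast
      then have "real n * \<bar>infdist x F - infdist y F\<bar> \<le> real n * dist x y" by (intro mult_left_mono) auto
      then have "\<bar>real n * infdist x F - real n * infdist y F\<bar> \<le> real n * dist x y"
        by (simp add: right_diff_distrib[symmetric] abs_mult)
      then show "\<bar>g n x - g n y\<bar> \<le> real n * dist x y" unfolding g_def by linarith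
    qed
    show "(indicator F x - g n x)\<^sup>2 \<le> 1" for n x
    proof -
      have "\<bar>indicator F x - g n x\<bar> \<le> 1" by (auto simp: g_def indicator_def infdist_nonneg)
      then show ?thesis by (simp add: abs_square_le_1)
    qed
    show "(\<integral>\<^sup>+x. ennreal 1 \<partial>M) < \<infinity>" using finite_measure.emeasure_finite[OF fin] by (simp add: top.not_eq_extremum)
    show "(\<lambda>n. g n x) \<longlonglongrightarrow> indicator F x" for x
    proof (cases "x \<in> F")
      case True then show ?thesis by (simp add: g_def)
    next
      case False
      then have pos: "infdist x F > 0" using F \<open>F \<noteq> {}\<close>
        by (metis in_closed_iff_infdist_zero infdist_nonneg less_eq_real_def)
      obtain N where N: "real N * infdist x F > 1" using pos reals_Archimedean3 by blast
      have "g n x = 0" if "n \<ge> N" for n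
      proof -
        have "real N * infdist x F \<le> real n * infdist x F" using that pos by (intro mult_right_mono) auto
        then show ?thesis using N by (simp add: g_def)
      qed
      then have "eventually (\<lambda>n. g n x = 0) sequentially" by (auto simp: eventually_sequentially)
      then show ?thesis using False by (simp add: tendsto_eventually)
    qed
  qed auto
qed

lemma Int_stable_closed: "Int_stable (Collect closed)"
  by (auto simp: Int_stable_def)

text \<open>Dynkin's argument: the closed sets generate the Borel sets and are stable under
  intersection, and the approximable sets are closed under complements and disjoint unions.\<close>

lemma L2_approx_indicator:
  fixes B :: "'a::metric_space set"
  assumes M: "sets M = sets borel" and fin: "finite_measure M" and B: "B \<in> sets borel"
  shows "L2_approx M (indicator B)"
proof -
  have "B \<in> sigma_sets UNIV (Collect closed)" using B by (simp add: borel_eq_closed)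
  with Int_stable_closed subset_UNIV[of "Collect closed", folded Pow_UNIV] show ?thesis
  proof (induction B rule: sigma_sets_induct_disjoint[of "Collect closed" UNIV, consumes 3, case_names basic empty compl union])
    case (basic A) then show ?case using L2_approx_indicator_closed[OF M fin] by simp
  next
    case empty
    then show ?case by (simp add: L2_approx_bdd_lipschitz bdd_lipschitz_const)
  next
    case (compl A)
    have "(indicator (UNIV - A) :: 'a \<Rightarrow> real) = (\<lambda>x. 1 + (-1) * indicator A x)" by (auto simp: indicator_def)
    then show ?case
      using L2_approx_add[OF M L2_approx_bdd_lipschitz[OF bdd_lipschitz_const[of 1]] L2_approx_cmult[OF M compl(2), of "-1"]]
      by (simp only:)
  next
    case (union A)
    have meas: "A i \<in> sets borel" for i using union(2) by (auto simp: borel_eq_closed)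
    show ?case
    proof (rule L2_approx_LIMSEQ[OF M fin, where g = "\<lambda>n x. \<Sum>i<n. indicator (A i) x" and w = "\<lambda>x. 1"])
      show "indicator (\<Union> (range A)) \<in> borel_measurable borel" using meas by measurable
      show "L2_approx M (\<lambda>x. \<Sum>i<n. indicator (A i) x)" for n
        using union(3) by (intro L2_approx_sum M)
      have eq: "(\<Sum>i<n. indicator (A i) x :: real) = indicator (\<Union>i<n. A i) x" for n x
        using union(1) by (subst indicator_UN_disjoint) (auto simp: disjoint_family_on_def)
      show "(indicator (\<Union> (range A)) x - (\<Sum>i<n. indicator (A i) x))\<^sup>2 \<le> (1::real)" for n x
        unfolding eq by (auto simp: indicator_def)
      show "(\<integral>\<^sup>+x. ennreal 1 \<partial>M) < \<infinity>" using finite_measure.emeasure_finite[OF fin] by (simp add: top.not_eq_extremum)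
      show "(\<lambda>n. \<Sum>i<n. indicator (A i) x :: real) \<longlonglongrightarrow> indicator (\<Union> (range A)) x" for x
        unfolding eq by (rule LIMSEQ_indicator_UN)
    qed auto
  qed
qed

text \<open>Rounding the values down to multiples of \<open>1 / (n + 1)\<close> is uniformly close,
  and boundedness leaves finitely many levels, so each approximant is a finite combination of
  indicators.\<close>

lemma L2_approx_bounded:
  fixes f :: "'a::metric_space \<Rightarrow> real"
  assumes M: "sets M = sets borel" and fin: "finite_measure M"
    and f[measurable]: "f \<in> borel_measurable borel" and C: "\<And>x. \<bar>f x\<bar> \<le> C"
  shows "L2_approx M f"
proof -
  define g where "g n x = of_int \<lfloor>real (Suc n) * f x\<rfloor> / real (Suc n)" for n x
  have close: "\<bar>f x - g n x\<bar> \<le> 1 / real (Suc n)" for n x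
  proof -
    have "\<bar>real (Suc n) * f x - of_int \<lfloor>real (Suc n) * f x\<rfloor>\<bar> \<le> 1" by linarith
    moreover have "f x - g n x = (real (Suc n) * f x - of_int \<lfloor>real (Suc n) * f x\<rfloor>) / real (Suc n)"
      by (simp add: g_def field_simps)
    ultimately show ?thesis by (simp add: divide_right_mono)
  qed
  show ?thesis
  proof (rule L2_approx_LIMSEQ[OF M fin f, where g = g and w = "\<lambda>x. 1"])
    fix n
    define K where "K = \<lceil>real (Suc n) * C\<rceil> + 1"
    have "g n x = (\<Sum>k\<in>{-K..K}. (of_int k / real (Suc n)) * indicator {x. \<lfloor>real (Suc n) * f x\<rfloor> = k} x)" for x
    proof -
      let ?k = "\<lfloor>real (Suc n) * f x\<rfloor>"
      have "\<bar>real (Suc n) * f x\<bar> \<le> real (Suc n) * C" using C[of x] by (simp add: abs_mult mult_left_mono)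
      then have "?k \<in> {-K..K}" unfolding K_def by (auto; linarith)
      then have "(\<Sum>k\<in>{-K..K}. (of_int k / real (Suc n)) * indicator {x. \<lfloor>real (Suc n) * f x\<rfloor> = k} x)
         = (\<Sum>k\<in>{?k}. (of_int k / real (Suc n)) * indicator {x. \<lfloor>real (Suc n) * f x\<rfloor> = k} x)"
        by (intro sum.mono_neutral_right) (auto simp: indicator_def)
      then show ?thesis by (simp add: g_def)
    qed
    then have eq: "g n = (\<lambda>x. \<Sum>k\<in>{-K..K}. (of_int k / real (Suc n)) * indicator {x. \<lfloor>real (Suc n) * f x\<rfloor> = k} x)"
      by auto
    show "L2_approx M (g n)"
      unfolding eq by (intro L2_approx_sum M L2_approx_cmult L2_approx_indicator fin) measurable
  next
    show "(f x - g n x)\<^sup>2 \<le> 1" for n x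
    proof -
      have "\<bar>f x - g n x\<bar> \<le> 1" using close[of x n] by (rule order_trans) simp
      then show ?thesis by (simp add: abs_square_le_1)
    qed
    show "(\<integral>\<^sup>+x. ennreal 1 \<partial>M) < \<infinity>" using finite_measure.emeasure_finite[OF fin] by (simp add: top.not_eq_extremum)
    show "(\<lambda>n. g n x) \<longlonglongrightarrow> f x" for x
    proof (rule LIM_zero_cancel, rule Lim_null_comparison[OF _ LIMSEQ_Suc[OF lim_1_over_n]])
      show "eventually (\<lambda>n. norm (g n x - f x) \<le> 1 / of_nat (Suc n)) sequentially"
        using close[of x] by (auto simp: abs_minus_commute)
    qed
  qed auto
qed

text \<open>Truncation at height \<open>n\<close> reduces to bounded functions; the squared error is
  dominated by \<open>f^2\<close>.\<close>

theorem bdd_lipschitz_dense_L2: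
  fixes f :: "'a::metric_space \<Rightarrow> real"
  assumes M: "sets M = sets borel" and fin: "finite_measure M"
    and f[measurable]: "f \<in> borel_measurable borel" and L2: "(\<integral>\<^sup>+x. ennreal ((f x)\<^sup>2) \<partial>M) < \<infinity>"
    and e: "e > 0"
  obtains \<phi> where "bdd_lipschitz \<phi>" "(\<integral>\<^sup>+x. ennreal ((f x - \<phi> x)\<^sup>2) \<partial>M) < ennreal e"
proof -
  have "L2_approx M f"
  proof (rule L2_approx_LIMSEQ[OF M fin f, where g = "\<lambda>n x. max (- real n) (min (real n) (f x))" and w = "\<lambda>x. (f x)\<^sup>2"])
    show "L2_approx M (\<lambda>x. max (- real n) (min (real n) (f x)))" for n
      by (rule L2_approx_bounded[OF M fin, where C = "real n"]) auto
    show "(f x - max (- real n) (min (real n) (f x)))\<^sup>2 \<le> (f x)\<^sup>2" for n x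
      by (subst abs_le_square_iff[symmetric]) auto
    show "(\<lambda>n. max (- real n) (min (real n) (f x))) \<longlonglongrightarrow> f x" for x
    proof (rule tendsto_eventually)
      obtain N where "real N \<ge> \<bar>f x\<bar>" using real_arch_simple by blast
      then show "eventually (\<lambda>n. max (- real n) (min (real n) (f x)) = f x) sequentially"
        unfolding eventually_sequentially by (intro exI[of _ N]) (auto simp: max_def min_def)
    qed
  qed (use L2 in auto)
  then show thesis using that e by (auto simp: L2_approx_def)
qed

section \<open>Spectral gaps from Lipschitz contraction\<close>

text \<open>If \<open>a 1\<close> were \<open>q * r * S\<close> with \<open>q > 1\<close>, repeated
  squaring would give \<open>a (2^k) \<ge> S * (r * q)^(2^k)\<close>, which outgrows
  \<open>C * r^(2^k)\<close> however large \<open>C\<close> is.\<close>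

lemma power_doubling_bound:
  fixes a :: "nat \<Rightarrow> real" and S C r :: real
  assumes S: "S > 0" and r: "r > 0" and a: "\<And>n. n \<ge> 1 \<Longrightarrow> (a n)\<^sup>2 \<le> S * a (2 * n)"
    and C: "\<And>n. n \<ge> 1 \<Longrightarrow> \<bar>a n\<bar> \<le> C * r ^ n"
  shows "a 1 \<le> r * S"
proof (rule ccontr)
  assume "\<not> a 1 \<le> r * S"
  define q where "q = a 1 / (r * S)"
  have rS: "r * S > 0" using r S by simp
  have q: "q > 1" using \<open>\<not> a 1 \<le> r * S\<close> rS by (simp add: q_def)
  have pos: "S * (r * q) ^ (2 ^ k) \<le> a (2 ^ k)" for k
  proof (induction k)
    case 0 show ?case using r S by (simp add: q_def)
  next
    case (Suc k)
    have "S * (r * q) ^ (2 ^ k) \<ge> 0" using S r q by simp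
    then have "(S * (r * q) ^ (2 ^ k))\<^sup>2 \<le> (a (2 ^ k))\<^sup>2" using Suc by (intro power_mono)
    also have "\<dots> \<le> S * a (2 * 2 ^ k)" by (rule a) simp
    finally have "S * (S * ((r * q) ^ (2 ^ k))\<^sup>2) \<le> S * a (2 * 2 ^ k)"
      by (simp add: power_mult_distrib power2_eq_square algebra_simps)
    then have "S * ((r * q) ^ (2 ^ k))\<^sup>2 \<le> a (2 * 2 ^ k)" using S by (simp only: mult_le_cancel_left_pos)
    then show ?case by (simp add: power_mult[symmetric] mult.commute)
  qed
  have bound: "q ^ (2 ^ k) \<le> C / S" for k
  proof -
    have "S * (r ^ (2 ^ k) * q ^ (2 ^ k)) \<le> C * r ^ (2 ^ k)"
      using pos[of k] C[of "2 ^ k"] by (simp add: power_mult_distrib)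
    then have "(S * q ^ (2 ^ k)) * r ^ (2 ^ k) \<le> C * r ^ (2 ^ k)" by (simp add: algebra_simps)
    then have "S * q ^ (2 ^ k) \<le> C" using r by (simp only: mult_le_cancel_right_pos zero_less_power)
    then show ?thesis using S by (simp add: field_simps)
  qed
  obtain n where n: "C / S < q ^ n" using real_arch_pow[OF q] by blast
  have "n \<le> 2 ^ n" by simp
  then have "q ^ n \<le> q ^ (2 ^ n)" using q by (intro power_increasing) auto
  then show False using n bound[of n] by linarith
qed

text \<open>The common core of Cauchy-Schwarz for the L2 inner product and for the form \<langle>T
  g, h\<rangle>. The minimiser is \<open>t = - b / a\<close>; for \<open>a = 0\<close> a nonnegative
  affine function has slope zero.\<close>

lemma quadratic_nonneg_discrim:
  fixes a b c :: real
  assumes q: "\<And>t. 0 \<le> t\<^sup>2 * a + 2 * t * b + c" and "a \<ge> 0"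
  shows "b\<^sup>2 \<le> a * c"
proof (cases "a = 0")
  case True
  have "b = 0"
  proof (rule ccontr)
    assume nz: "b \<noteq> 0"
    show False using q[of "- (c + 1) / (2 * b)"] nz True by (simp add: field_simps)
  qed
  then show ?thesis using True by simp
next
  case False
  then have a: "a > 0" using \<open>a \<ge> 0\<close> by simp
  have "0 \<le> a * ((- b / a)\<^sup>2 * a + 2 * (- b / a) * b + c)"
    using mult_nonneg_nonneg[OF less_imp_le[OF a] q[of "- b / a"]] .
  also have "\<dots> = a * c - b\<^sup>2" using a by (simp add: field_simps power2_eq_square)
  finally show ?thesis by simp
qed

text \<open>The difference of two independent copies has twice the variance. This puts the variance
  into the double-integral shape of a Dirichlet form.\<close>

lemma (in prob_space) nn_integral_pair_diff_sq:
  fixes f :: "'a \<Rightarrow> real"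
  assumes f[measurable]: "f \<in> borel_measurable M" and C: "\<And>x. \<bar>f x\<bar> \<le> C"
  shows "(\<integral>\<^sup>+x. \<integral>\<^sup>+y. ennreal ((f x - f y)\<^sup>2) \<partial>M \<partial>M) = ennreal (2 * (\<integral>x. (f x - expectation f)\<^sup>2 \<partial>M))"
proof -
  define g where "g x = f x - expectation f" for x
  define S where "S = (\<integral>x. (g x)\<^sup>2 \<partial>M)"
  have S: "S \<ge> 0" by (simp add: S_def)
  have f_int: "integrable M f" using C by (intro integrable_const_bound[where B = C]) auto
  then have g0: "(\<integral>x. g x \<partial>M) = 0" and g_int: "integrable M g"
    by (auto simp: g_def[abs_def] prob_space)
  have "(g x)\<^sup>2 \<le> (C + \<bar>expectation f\<bar>)\<^sup>2" for x
    using C[of x] by (intro power2_le_iff_abs_le[THEN iffD2]) (auto simp: g_def)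
  then have g2_int: "integrable M (\<lambda>x. (g x)\<^sup>2)"
    by (intro integrable_const_bound[where B = "(C + \<bar>expectation f\<bar>)\<^sup>2"]) (auto simp: g_def[abs_def])
  have 1: "(\<integral>\<^sup>+y. ennreal ((f x - f y)\<^sup>2) \<partial>M) = ennreal ((g x)\<^sup>2 + S)" for x
  proof -
    have "(\<integral>\<^sup>+y. ennreal ((f x - f y)\<^sup>2) \<partial>M) = (\<integral>\<^sup>+y. ennreal ((g x)\<^sup>2 - 2 * g x * g y + (g y)\<^sup>2) \<partial>M)"
      by (intro nn_integral_cong arg_cong[where f=ennreal]) (simp add: g_def power2_eq_square algebra_simps)
    also have "\<dots> = ennreal (\<integral>y. (g x)\<^sup>2 - 2 * g x * g y + (g y)\<^sup>2 \<partial>M)"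
    proof (rule nn_integral_eq_integral)
      show "AE y in M. 0 \<le> (g x)\<^sup>2 - 2 * g x * g y + (g y)\<^sup>2"
      proof (rule AE_I2)
        show "0 \<le> (g x)\<^sup>2 - 2 * g x * g y + (g y)\<^sup>2" for y
          using sum_squares_bound[of "g x" "g y"] by linarith
      qed
    qed (use g_int g2_int in auto)
    also have "(\<integral>y. (g x)\<^sup>2 - 2 * g x * g y + (g y)\<^sup>2 \<partial>M) = (g x)\<^sup>2 + S"
      using g_int g2_int g0 by (simp add: S_def prob_space)
    finally show ?thesis .
  qed
  have "(\<integral>\<^sup>+x. ennreal ((g x)\<^sup>2 + S) \<partial>M) = ennreal (\<integral>x. (g x)\<^sup>2 + S \<partial>M)"
    using g2_int S by (intro nn_integral_eq_integral) auto
  also have "(\<integral>x. (g x)\<^sup>2 + S \<partial>M) = 2 * S" using g2_int by (simp add: S_def prob_space)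
  finally show ?thesis by (simp add: 1 S_def g_def)
qed

section \<open>Bounded measurable functions and reversible kernels\<close>

definition bdd_meas :: "('a::topological_space \<Rightarrow> real) \<Rightarrow> bool" where
  "bdd_meas g \<longleftrightarrow> g \<in> borel_measurable borel \<and> (\<exists>C. \<forall>x. \<bar>g x\<bar> \<le> C)"

lemma bdd_meas_meas[measurable_dest]: "bdd_meas g \<Longrightarrow> g \<in> borel_measurable borel"
  by (simp add: bdd_meas_def)

lemma bdd_meas_mult: assumes "bdd_meas g" "bdd_meas h" shows "bdd_meas (\<lambda>x. g x * h x)"
proof -
  obtain C D where "\<And>x. \<bar>g x\<bar> \<le> C" "\<And>x. \<bar>h x\<bar> \<le> D" using assms by (auto simp: bdd_meas_def)
  then have "\<bar>g x * h x\<bar> \<le> C * D" for x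
    unfolding abs_mult by (meson abs_ge_zero mult_mono' )
  then show ?thesis using assms by (auto simp: bdd_meas_def)
qed

lemma bdd_meas_add: assumes "bdd_meas g" "bdd_meas h" shows "bdd_meas (\<lambda>x. g x + h x)"
proof -
  obtain C D where "\<And>x. \<bar>g x\<bar> \<le> C" "\<And>x. \<bar>h x\<bar> \<le> D" using assms by (auto simp: bdd_meas_def)
  then have "\<bar>g x + h x\<bar> \<le> C + D" for x
    using abs_triangle_ineq[of "g x" "h x"] by (meson add_mono order_trans)
  then show ?thesis using assms by (auto simp: bdd_meas_def)
qed

lemma bdd_meas_const: "bdd_meas (\<lambda>x. c)" by (auto simp: bdd_meas_def)

lemma bdd_meas_cmult: "bdd_meas g \<Longrightarrow> bdd_meas (\<lambda>x. c * g x)"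
  using bdd_meas_mult[OF bdd_meas_const] .

lemma bdd_meas_diff: "bdd_meas g \<Longrightarrow> bdd_meas h \<Longrightarrow> bdd_meas (\<lambda>x. g x - h x)"
  using bdd_meas_add[OF _ bdd_meas_cmult[of h "-1"], of g] by simp

text \<open>Reversibility is symmetry of the joint law of one step, tested on all nonnegative
  measurable \<open>F\<close>. Kernels with densities and kernels with a rejection atom fit this
  form alike.\<close>

locale rev_kernel = m: prob_space m
  for m :: "'a::euclidean_space measure" +
  fixes K :: "'a \<Rightarrow> 'a measure"
  assumes sets_m[measurable_cong]: "sets m = sets borel"
    and K_meas[measurable]: "K \<in> borel \<rightarrow>\<^sub>M prob_algebra borel"
    and rev: "\<And>F. F \<in> borel_measurable (borel \<Otimes>\<^sub>M borel) \<Longrightarrow>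
      (\<integral>\<^sup>+x. \<integral>\<^sup>+y. F (x, y) \<partial>K x \<partial>m) = (\<integral>\<^sup>+x. \<integral>\<^sup>+y. F (y, x) \<partial>K x \<partial>m)"
begin

abbreviation T :: "('a \<Rightarrow> real) \<Rightarrow> 'a \<Rightarrow> real" where
  "T \<equiv> kernel_op K"

lemma K_meas'[measurable]: "K \<in> borel \<rightarrow>\<^sub>M subprob_algebra borel"
  by (rule measurable_prob_algebraD) measurable

lemma prob_K: "prob_space (K x)" and sets_K[measurable_cong]: "sets (K x) = sets borel"
  using measurable_space[OF K_meas, of x] by (auto simp: space_prob_algebra)

lemma bdd_meas_integrable: assumes "bdd_meas g" shows "integrable m g"
proof -
  obtain C where "\<And>x. \<bar>g x\<bar> \<le> C" using assms by (auto simp: bdd_meas_def)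
  then show ?thesis using bdd_meas_meas[OF assms] by (intro m.integrable_const_bound[where B = C]) auto
qed

lemma bdd_meas_integrable_K: assumes "bdd_meas g" shows "integrable (K x) g"
proof -
  interpret K: prob_space "K x" by (rule prob_K)
  obtain C where "\<And>x. \<bar>g x\<bar> \<le> C" using assms by (auto simp: bdd_meas_def)
  then show ?thesis using bdd_meas_meas[OF assms] by (intro K.integrable_const_bound[where B = C]) auto
qed

lemma T_const: "T (\<lambda>_. c) x = c"
  using prob_space.prob_space[OF prob_K] by (simp add: kernel_op_def)

lemma bdd_meas_T: assumes "bdd_meas g" shows "bdd_meas (T g)"
proof -
  obtain C where C: "\<And>x. \<bar>g x\<bar> \<le> C" using assms by (auto simp: bdd_meas_def)
  note [measurable] = bdd_meas_meas[OF assms]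
  have "T g \<in> borel_measurable borel" unfolding kernel_op_def by measurable
  moreover have "\<bar>T g x\<bar> \<le> C" for x
  proof -
    interpret K: prob_space "K x" by (rule prob_K)
    have "\<bar>T g x\<bar> \<le> (\<integral>y. \<bar>g y\<bar> \<partial>K x)" unfolding kernel_op_def by (rule integral_abs_bound)
    also have "\<dots> \<le> (\<integral>y. C \<partial>K x)"
      using C bdd_meas_integrable_K[OF assms] by (intro integral_mono) auto
    finally show ?thesis by (simp add: K.prob_space)
  qed
  ultimately show ?thesis by (auto simp: bdd_meas_def)
qed

text \<open>Symmetry of the joint law tested on the product of \<open>h\<close> at the old and
  \<open>g\<close> at the new state. Nonnegativity allows the whole computation to run in
  \<open>ennreal\<close>.\<close>

lemma T_selfadjoint_nonneg:
  assumes g: "bdd_meas g" and h: "bdd_meas h" and nonneg: "\<And>x. 0 \<le> g x" "\<And>x. 0 \<le> h x"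
  shows "(\<integral>x. T g x * h x \<partial>m) = (\<integral>x. g x * T h x \<partial>m)"
proof -
  note [measurable] = bdd_meas_meas[OF g] bdd_meas_meas[OF h]
  have T_nn: "ennreal (T k x) = (\<integral>\<^sup>+y. ennreal (k y) \<partial>K x)" if "bdd_meas k" "\<And>x. 0 \<le> k x" for k x
    unfolding kernel_op_def using that by (intro nn_integral_eq_integral[symmetric] bdd_meas_integrable_K) auto
  have T_nonneg: "0 \<le> T k x" if "\<And>x. 0 \<le> k x" for k x unfolding kernel_op_def using that by simp
  have "ennreal (\<integral>x. T g x * h x \<partial>m) = (\<integral>\<^sup>+x. ennreal (T g x * h x) \<partial>m)"
    using nonneg by (intro nn_integral_eq_integral[symmetric] bdd_meas_integrable bdd_meas_mult bdd_meas_T g h) (auto simp: T_nonneg)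
  also have "\<dots> = (\<integral>\<^sup>+x. \<integral>\<^sup>+y. ennreal (h x) * ennreal (g y) \<partial>K x \<partial>m)"
    using nonneg by (intro nn_integral_cong) (simp add: nn_integral_cmult nn_integral_multc T_nn[OF g, symmetric] ennreal_mult'' T_nonneg mult.commute)
  also have "\<dots> = (\<integral>\<^sup>+x. \<integral>\<^sup>+y. ennreal (h y) * ennreal (g x) \<partial>K x \<partial>m)"
    using rev[of "\<lambda>p. ennreal (h (fst p)) * ennreal (g (snd p))"] by simp
  also have "\<dots> = (\<integral>\<^sup>+x. ennreal (g x * T h x) \<partial>m)"
    using nonneg by (intro nn_integral_cong) (simp add: nn_integral_cmult nn_integral_multc T_nn[OF h, symmetric] ennreal_mult'' T_nonneg mult.commute)
  also have "\<dots> = ennreal (\<integral>x. g x * T h x \<partial>m)"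
    using nonneg by (intro nn_integral_eq_integral bdd_meas_integrable bdd_meas_mult bdd_meas_T g h) (auto simp: T_nonneg)
  finally show ?thesis using nonneg by (subst (asm) ennreal_inj) (auto simp: T_nonneg)
qed

lemma T_add: "bdd_meas g \<Longrightarrow> bdd_meas h \<Longrightarrow> T (\<lambda>x. g x + h x) x = T g x + T h x"
  unfolding kernel_op_def by (intro Bochner_Integration.integral_add bdd_meas_integrable_K)

text \<open>Adding constants makes both functions nonnegative. The extra terms agree on the two
  sides because \<open>T\<close> fixes constants and preserves means.\<close>

lemma T_selfadjoint:
  assumes g: "bdd_meas g" and h: "bdd_meas h"
  shows "(\<integral>x. T g x * h x \<partial>m) = (\<integral>x. g x * T h x \<partial>m)"
proof -
  obtain C where C: "\<And>x. \<bar>g x\<bar> \<le> C" using g by (auto simp: bdd_meas_def)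
  obtain D where D: "\<And>x. \<bar>h x\<bar> \<le> D" using h by (auto simp: bdd_meas_def)
  have C0: "C \<ge> 0" and D0: "D \<ge> 0" using C[of 0] D[of 0] by linarith+
  have pos: "0 \<le> g x + C" "0 \<le> h x + D" for x using C[of x] D[of x] by linarith+
  have bmC: "bdd_meas (\<lambda>x. g x + C)" and bmD: "bdd_meas (\<lambda>x. h x + D)" using g h by (auto intro: bdd_meas_add bdd_meas_const)
  have mean: "(\<integral>x. T k x + c \<partial>m) = (\<integral>x. k x + c \<partial>m)" if k: "bdd_meas k" and p: "\<And>x. 0 \<le> k x + c" for k c
    using T_selfadjoint_nonneg[OF bdd_meas_add[OF k bdd_meas_const[of c]] bdd_meas_const[of 1] p] by (simp add: T_const T_add k bdd_meas_const)
  have eq: "(\<integral>x. (T g x + C) * (h x + D) \<partial>m) = (\<integral>x. (g x + C) * (T h x + D) \<partial>m)"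
    using T_selfadjoint_nonneg[OF bmC bmD pos] by (simp add: T_const T_add g h bdd_meas_const)
  note int = bdd_meas_integrable[OF bdd_meas_mult[OF bdd_meas_T[OF g] h]] bdd_meas_integrable[OF bdd_meas_mult[OF g bdd_meas_T[OF h]]]
    bdd_meas_integrable[OF g] bdd_meas_integrable[OF h] bdd_meas_integrable[OF bdd_meas_T[OF g]] bdd_meas_integrable[OF bdd_meas_T[OF h]]
  have "(\<integral>x. T g x \<partial>m) = (\<integral>x. g x \<partial>m)" "(\<integral>x. T h x \<partial>m) = (\<integral>x. h x \<partial>m)"
    using mean[OF g pos(1)] mean[OF h pos(2)] int by auto
  then show ?thesis using eq int by (simp add: distrib_left distrib_right m.prob_space)
qed

lemma T_mean: assumes "bdd_meas g" shows "(\<integral>x. T g x \<partial>m) = (\<integral>x. g x \<partial>m)"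
  using T_selfadjoint[OF assms bdd_meas_const[of 1]] by (simp add: T_const)

lemma cauchy_schwarz_bdd_meas:
  assumes g: "bdd_meas g" and h: "bdd_meas h"
  shows "(\<integral>x. g x * h x \<partial>m)\<^sup>2 \<le> (\<integral>x. (g x)\<^sup>2 \<partial>m) * (\<integral>x. (h x)\<^sup>2 \<partial>m)"
proof -
  let ?a = "\<integral>x. (g x)\<^sup>2 \<partial>m" and ?b = "\<integral>x. g x * h x \<partial>m" and ?c = "\<integral>x. (h x)\<^sup>2 \<partial>m"
  have int: "integrable m (\<lambda>x. (g x)\<^sup>2)" "integrable m (\<lambda>x. (h x)\<^sup>2)" "integrable m (\<lambda>x. g x * h x)"
    using bdd_meas_integrable[OF bdd_meas_mult] g h by (auto simp: power2_eq_square)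
  have q: "0 \<le> t\<^sup>2 * ?a + 2 * t * ?b + ?c" for t
  proof -
    have "0 \<le> (\<integral>x. (t * g x + h x)\<^sup>2 \<partial>m)" by simp
    also have "\<dots> = (\<integral>x. t\<^sup>2 * (g x)\<^sup>2 + 2 * t * (g x * h x) + (h x)\<^sup>2 \<partial>m)"
      by (simp add: power2_eq_square algebra_simps)
    also have "\<dots> = t\<^sup>2 * ?a + 2 * t * ?b + ?c" using int by simp
    finally show ?thesis .
  qed
  show ?thesis by (rule quadratic_nonneg_discrim) (use q in auto)
qed

text \<open>Reversibility gives \<open>\<langle>T\<^sup>n g, g\<rangle>\<^sup>2 \<le> \<parallel>g\<parallel>\<^sup>2 \<langle>T\<^sup>2\<^sup>n g, g\<rangle>\<close>, so along \<open>n = 2\<^sup>k\<close> only the exponential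
  rate of decay of \<open>\<langle>T\<^sup>n g, g\<rangle>\<close> matters: the unknown prefactor in the contraction bound disappears.\<close>

theorem lipschitz_contraction_gap:
  fixes nn :: "'a \<Rightarrow> real"
  assumes r: "0 < r" "r \<le> 1"
    and nn[measurable]: "nn \<in> borel_measurable borel" and nn0: "\<And>x. 0 \<le> nn x"
    and norm_le: "\<And>x. norm x \<le> c * nn x" and c: "c \<ge> 0"
    and contr: "\<And>g L x y. bdd_meas g \<Longrightarrow> L \<ge> 0 \<Longrightarrow> (\<And>x y. \<bar>g x - g y\<bar> \<le> L * nn (x - y)) \<Longrightarrow> \<bar>T g x - T g y\<bar> \<le> L * r * nn (x - y)"
    and mom: "(\<integral>\<^sup>+x. \<integral>\<^sup>+y. ennreal (nn (x - y)) \<partial>m \<partial>m) < \<infinity>"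
    and f: "bdd_lipschitz f"
  shows "ennreal (1 - r) * (\<integral>\<^sup>+x. \<integral>\<^sup>+y. ennreal ((f x - f y)\<^sup>2) \<partial>m \<partial>m)
      \<le> (\<integral>\<^sup>+x. \<integral>\<^sup>+y. ennreal ((f x - f y)\<^sup>2) \<partial>K x \<partial>m)"
proof -
  define g where "g x = f x - (\<integral>x. f x \<partial>m)" for x
  obtain C L0 where f_bd: "\<And>x. \<bar>f x\<bar> \<le> C" and f_lip: "\<And>x y. \<bar>f x - f y\<bar> \<le> L0 * dist x y"
    using f by (auto simp: bdd_lipschitz_def)
  \<comment> \<open>Converts the Lipschitz constant for \<open>dist\<close> into one for
    \<open>nn\<close>, by the bound of \<open>norm\<close> through \<open>nn\<close>.\<close>
  define L where "L = max L0 0 * c"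
  have L: "L \<ge> 0" using c by (simp add: L_def)
  note [measurable] = bdd_lipschitz_measurable[OF f]
  have bdd_meas_f: "bdd_meas f" using f_bd by (auto simp: bdd_meas_def)
  then have bdd_meas_g: "bdd_meas g" unfolding g_def[abs_def] by (intro bdd_meas_diff bdd_meas_const)
  obtain G where G: "\<And>x. \<bar>g x\<bar> \<le> G" using bdd_meas_g by (auto simp: bdd_meas_def)
  have bdd_meas_n: "bdd_meas ((T ^^ n) g)" for n by (induction n) (auto simp: bdd_meas_g bdd_meas_T)
  have mean_n: "(\<integral>x. (T ^^ n) g x \<partial>m) = 0" for n
  proof (induction n)
    case 0 show ?case using bdd_meas_integrable[OF bdd_meas_f] by (simp add: g_def m.prob_space)
  next
    case (Suc n) then show ?case using T_mean[OF bdd_meas_n[of n]] by simp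
  qed
  have lip_n: "\<bar>(T ^^ n) g x - (T ^^ n) g y\<bar> \<le> L * r ^ n * nn (x - y)" for n x y
  proof (induction n arbitrary: x y)
    case 0
    have "\<bar>f x - f y\<bar> \<le> max L0 0 * dist x y"
      using f_lip[of x y] by (rule order_trans) (intro mult_right_mono; simp)
    also have "\<dots> \<le> max L0 0 * (c * nn (x - y))"
      by (intro mult_left_mono) (auto simp: dist_norm norm_le)
    finally show ?case by (simp add: g_def L_def mult.assoc)
  next
    case (Suc n)
    show ?case using contr[OF bdd_meas_n[of n] _ Suc] L r by (simp add: mult_ac)
  qed
  interpret mm: pair_prob_space m m ..
  have nn_int: "integrable (m \<Otimes>\<^sub>M m) (\<lambda>p. nn (fst p - snd p))"
  proof (rule integrableI_nonneg)
    show "(\<integral>\<^sup>+p. ennreal (nn (fst p - snd p)) \<partial>(m \<Otimes>\<^sub>M m)) < \<infinity>"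
      using mom by (subst m.nn_integral_fst[symmetric]) auto
  qed (auto simp: nn0)
  define B where "B = (\<integral>x. \<integral>y. nn (x - y) \<partial>m \<partial>m)"
  have nn_int1: "AE x in m. integrable m (\<lambda>y. nn (x - y))"
    using mm.AE_integrable_fst'[OF nn_int] by simp
  have nn_int2: "integrable m (\<lambda>x. \<integral>y. nn (x - y) \<partial>m)"
    using mm.integrable_fst'[OF nn_int] by simp
  define a where "a n = (\<integral>x. (T ^^ n) g x * g x \<partial>m)" for n
  define S where "S = (\<integral>x. (g x)\<^sup>2 \<partial>m)"
  have a_bd: "\<bar>a n\<bar> \<le> (G * L * B) * r ^ n" for n
  proof -
    let ?h = "(T ^^ n) g"
    have G0: "G \<ge> 0" using G[of 0] by linarith
    note [measurable] = bdd_meas_meas[OF bdd_meas_n[of n]] bdd_meas_meas[OF bdd_meas_g]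
    \<comment> \<open>As \<open>?h\<close> has mean zero, \<open>?h x\<close> is the average of
      \<open>?h x - ?h y\<close> over \<open>y\<close>, so the Lipschitz bound becomes a bound on
      the size of \<open>?h\<close>.\<close>
    have 1: "AE x in m. \<bar>?h x\<bar> \<le> L * r ^ n * (\<integral>y. nn (x - y) \<partial>m)"
      using nn_int1
    proof eventually_elim
      fix x assume i: "integrable m (\<lambda>y. nn (x - y))"
      have "?h x = (\<integral>y. ?h x - ?h y \<partial>m)"
        using bdd_meas_integrable[OF bdd_meas_n[of n]] by (simp add: mean_n m.prob_space)
      then have "\<bar>?h x\<bar> \<le> (\<integral>y. \<bar>?h x - ?h y\<bar> \<partial>m)" by (metis integral_abs_bound)
      also have "\<dots> \<le> (\<integral>y. L * r ^ n * nn (x - y) \<partial>m)"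
        using bdd_meas_integrable[OF bdd_meas_n[of n]] i lip_n by (intro integral_mono) auto
      finally show "\<bar>?h x\<bar> \<le> L * r ^ n * (\<integral>y. nn (x - y) \<partial>m)" by simp
    qed
    have "\<bar>a n\<bar> \<le> (\<integral>x. \<bar>?h x * g x\<bar> \<partial>m)" unfolding a_def by (rule integral_abs_bound)
    also have "\<dots> \<le> (\<integral>x. (G * (L * r ^ n)) * (\<integral>y. nn (x - y) \<partial>m) \<partial>m)"
    proof (rule integral_mono_AE)
      show "integrable m (\<lambda>x. \<bar>?h x * g x\<bar>)" using bdd_meas_integrable[OF bdd_meas_mult[OF bdd_meas_n bdd_meas_g]] by simp
      show "integrable m (\<lambda>x. (G * (L * r ^ n)) * (\<integral>y. nn (x - y) \<partial>m))" using nn_int2 by simp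
      show "AE x in m. \<bar>?h x * g x\<bar> \<le> (G * (L * r ^ n)) * (\<integral>y. nn (x - y) \<partial>m)"
        using 1
      proof eventually_elim
        fix x assume *: "\<bar>?h x\<bar> \<le> L * r ^ n * (\<integral>y. nn (x - y) \<partial>m)"
        have "\<bar>?h x\<bar> * \<bar>g x\<bar> \<le> (L * r ^ n * (\<integral>y. nn (x - y) \<partial>m)) * G"
          using * G[of x] G0 by (intro mult_mono) (auto intro: order_trans[OF _ *])
        then show "\<bar>?h x * g x\<bar> \<le> (G * (L * r ^ n)) * (\<integral>y. nn (x - y) \<partial>m)"
          by (simp add: abs_mult algebra_simps)
      qed
    qed
    also have "\<dots> = (G * L * B) * r ^ n" by (simp add: B_def algebra_simps)
    finally show ?thesis .
  qed
  \<comment> \<open>Self-adjointness moves the factors \<open>T\<close> across one at a time; for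
    \<open>k = n\<close> this identifies \<open>a (2 * n)\<close> with the squared norm of
    \<open>(T ^^ n) g\<close>.\<close>
  have move: "(\<integral>x. (T ^^ k) ((T ^^ n) g) x * g x \<partial>m) = (\<integral>x. (T ^^ n) g x * (T ^^ k) g x \<partial>m)" for k n
  proof (induction k arbitrary: n)
    case 0 show ?case by simp
  next
    case (Suc k)
    have "(\<integral>x. (T ^^ Suc k) ((T ^^ n) g) x * g x \<partial>m) = (\<integral>x. (T ^^ k) ((T ^^ Suc n) g) x * g x \<partial>m)"
      by (simp add: funpow_swap1)
    also have "\<dots> = (\<integral>x. T ((T ^^ n) g) x * (T ^^ k) g x \<partial>m)" using Suc[of "Suc n"] by simp
    also have "\<dots> = (\<integral>x. (T ^^ n) g x * T ((T ^^ k) g) x \<partial>m)" by (rule T_selfadjoint[OF bdd_meas_n bdd_meas_n])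
    finally show ?case by simp
  qed
  have a_sq: "(a n)\<^sup>2 \<le> S * a (2 * n)" for n
  proof -
    have "(a n)\<^sup>2 \<le> (\<integral>x. ((T ^^ n) g x)\<^sup>2 \<partial>m) * S"
      unfolding a_def S_def by (rule cauchy_schwarz_bdd_meas[OF bdd_meas_n bdd_meas_g])
    also have "(\<integral>x. ((T ^^ n) g x)\<^sup>2 \<partial>m) = a (2 * n)"
      unfolding a_def using move[of n n] by (simp add: power2_eq_square mult_2 funpow_add)
    finally show ?thesis by (simp add: mult.commute)
  qed
  have "S \<ge> 0" by (simp add: S_def)
  have a1: "a 1 \<le> r * S"
  proof (cases "S = 0")
    case True
    then have "(a 1)\<^sup>2 \<le> 0" using a_sq[of 1] by simp
    then show ?thesis using True by simp
  next
    case False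
    then have "S > 0" using \<open>S \<ge> 0\<close> by simp
    then show ?thesis using power_doubling_bound[of S r a "G * L * B"] r a_sq a_bd by blast
  qed
  have intg2: "integrable m (\<lambda>x. (g x)\<^sup>2)" "integrable m g"
    using bdd_meas_integrable[OF bdd_meas_mult[OF bdd_meas_g bdd_meas_g]] bdd_meas_integrable[OF bdd_meas_g] by (auto simp: power2_eq_square)
  have g0: "(\<integral>x. g x \<partial>m) = 0" using mean_n[of 0] by simp
  \<comment> \<open>The double integral against \<open>m\<close> is \<open>2 * S\<close>, and the
    one against the kernel is \<open>2 * S - 2 * a 1\<close>, so the claim reduces to
    \<open>a 1 \<le> r * S\<close>.\<close>
  have V: "(\<integral>\<^sup>+x. \<integral>\<^sup>+y. ennreal ((f x - f y)\<^sup>2) \<partial>m \<partial>m) = ennreal (2 * S)"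
    unfolding S_def g_def using f_bd by (intro m.nn_integral_pair_diff_sq) auto
  have D: "(\<integral>\<^sup>+x. \<integral>\<^sup>+y. ennreal ((f x - f y)\<^sup>2) \<partial>K x \<partial>m) = ennreal (2 * S - 2 * a 1)"
  proof -
    let ?g2 = "\<lambda>x. g x * g x"
    have bm2: "bdd_meas ?g2" by (rule bdd_meas_mult[OF bdd_meas_g bdd_meas_g])
    have 1: "(\<integral>\<^sup>+y. ennreal ((f x - f y)\<^sup>2) \<partial>K x) = ennreal ((g x)\<^sup>2 - 2 * g x * T g x + T ?g2 x)"
      and pos: "0 \<le> (g x)\<^sup>2 - 2 * g x * T g x + T ?g2 x" for x
    proof -
      have eq: "(f x - f y)\<^sup>2 = (g x)\<^sup>2 - 2 * g x * g y + ?g2 y" for y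
        by (simp add: g_def power2_eq_square algebra_simps)
      interpret K: prob_space "K x" by (rule prob_K)
      have i: "integrable (K x) (\<lambda>y. (g x)\<^sup>2 - 2 * g x * g y + ?g2 y)"
        using bdd_meas_integrable_K[OF bm2, of x] bdd_meas_integrable_K[OF bdd_meas_g, of x] by simp
      have "(\<integral>\<^sup>+y. ennreal ((f x - f y)\<^sup>2) \<partial>K x) = ennreal (\<integral>y. (f x - f y)\<^sup>2 \<partial>K x)"
        by (rule nn_integral_eq_integral) (use i in \<open>auto simp only: eq[symmetric] zero_le_power2 AE_I2\<close>)
      also have eq2: "(\<integral>y. (f x - f y)\<^sup>2 \<partial>K x) = (g x)\<^sup>2 - 2 * g x * T g x + T ?g2 x"
        unfolding eq using bdd_meas_integrable_K[OF bm2, of x] bdd_meas_integrable_K[OF bdd_meas_g, of x]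
        by (simp add: kernel_op_def K.prob_space)
      finally show "(\<integral>\<^sup>+y. ennreal ((f x - f y)\<^sup>2) \<partial>K x) = ennreal ((g x)\<^sup>2 - 2 * g x * T g x + T ?g2 x)" .
      show "0 \<le> (g x)\<^sup>2 - 2 * g x * T g x + T ?g2 x" unfolding eq2[symmetric] by simp
    qed
    have i: "integrable m (\<lambda>x. T g x * g x)" "integrable m (T ?g2)"
      using bdd_meas_integrable[OF bdd_meas_mult[OF bdd_meas_T[OF bdd_meas_g] bdd_meas_g]] bdd_meas_integrable[OF bdd_meas_T[OF bm2]] by auto
    have "(\<lambda>x. 2 * g x * T g x) = (\<lambda>x. 2 * (T g x * g x))" by (auto simp: mult_ac)
    then have i': "integrable m (\<lambda>x. 2 * g x * T g x)" using i(1) by simp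
    have "(\<integral>\<^sup>+x. \<integral>\<^sup>+y. ennreal ((f x - f y)\<^sup>2) \<partial>K x \<partial>m) = ennreal (\<integral>x. (g x)\<^sup>2 - 2 * g x * T g x + T ?g2 x \<partial>m)"
      unfolding 1 using i i' intg2 pos by (intro nn_integral_eq_integral) auto
    also have "(\<integral>x. (g x)\<^sup>2 - 2 * g x * T g x + T ?g2 x \<partial>m) = S - 2 * a 1 + (\<integral>x. T ?g2 x \<partial>m)"
    proof -
      have "(\<integral>x. 2 * g x * T g x \<partial>m) = 2 * a 1"
        by (simp add: a_def integral_mult_right_zero[symmetric] mult_ac del: integral_mult_right_zero)
      then show ?thesis using i i' intg2 by (simp add: S_def)
    qed
    also have "(\<integral>x. T ?g2 x \<partial>m) = S" unfolding T_mean[OF bm2] by (simp add: S_def power2_eq_square)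
    finally show ?thesis by (simp add: algebra_simps)
  qed
  show ?thesis
    unfolding V D using r a1 \<open>S \<ge> 0\<close>
    by (subst ennreal_mult[symmetric]) (auto simp: algebra_simps intro!: ennreal_leI)
qed

end

section \<open>Kernels driven by a common noise\<close>

locale random_map =
  m: prob_space m + \<nu>: prob_space \<nu>
  for m :: "'a::euclidean_space measure" and \<nu> :: "'w measure" +
  fixes \<Phi> :: "'a \<Rightarrow> 'w \<Rightarrow> 'a"
  assumes sets_m[measurable_cong]: "sets m = sets borel"
    and \<Phi>[measurable]: "case_prod \<Phi> \<in> borel \<Otimes>\<^sub>M \<nu> \<rightarrow>\<^sub>M borel"
    and rev: "\<And>F. F \<in> borel_measurable (borel \<Otimes>\<^sub>M borel) \<Longrightarrow>
      (\<integral>\<^sup>+x. \<integral>\<^sup>+w. F (x, \<Phi> x w) \<partial>\<nu> \<partial>m) = (\<integral>\<^sup>+x. \<integral>\<^sup>+w. F (\<Phi> x w, x) \<partial>\<nu> \<partial>m)"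
begin

sublocale kernel: rev_kernel m "\<lambda>x. distr \<nu> borel (\<Phi> x)"
proof
  show "(\<lambda>x. distr \<nu> borel (\<Phi> x)) \<in> borel \<rightarrow>\<^sub>M prob_algebra borel"
    using \<nu>.prob_space_axioms by (intro measurable_distr_prob_space2[OF measurable_const \<Phi>]) (simp add: space_prob_algebra)
qed (simp_all add: sets_m nn_integral_distr rev)

text \<open>Synchronous coupling: both starting points are moved with the same \<open>w\<close>, so
  contraction of \<open>nn\<close> in expectation shrinks Lipschitz constants with respect to
  \<open>nn\<close> by the factor \<open>r\<close>.\<close>

theorem contraction_gap:
  fixes nn :: "'a \<Rightarrow> real"
  assumes r: "0 < r" "r \<le> 1"
    and nn[measurable]: "nn \<in> borel_measurable borel" and nn0: "\<And>x. 0 \<le> nn x"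
    and norm_le: "\<And>x. norm x \<le> c * nn x" and c: "c \<ge> 0"
    and contr: "\<And>x y. (\<integral>\<^sup>+w. ennreal (nn (\<Phi> x w - \<Phi> y w)) \<partial>\<nu>) \<le> ennreal (r * nn (x - y))"
    and mom: "(\<integral>\<^sup>+x. \<integral>\<^sup>+y. ennreal (nn (x - y)) \<partial>m \<partial>m) < \<infinity>"
    and f: "bdd_lipschitz f"
  shows "ennreal (1 - r) * (\<integral>\<^sup>+x. \<integral>\<^sup>+y. ennreal ((f x - f y)\<^sup>2) \<partial>m \<partial>m)
      \<le> (\<integral>\<^sup>+x. \<integral>\<^sup>+w. ennreal ((f x - f (\<Phi> x w))\<^sup>2) \<partial>\<nu> \<partial>m)"
proof -
  note [measurable] = bdd_lipschitz_measurable[OF f]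
  have "ennreal (1 - r) * (\<integral>\<^sup>+x. \<integral>\<^sup>+y. ennreal ((f x - f y)\<^sup>2) \<partial>m \<partial>m)
      \<le> (\<integral>\<^sup>+x. \<integral>\<^sup>+y. ennreal ((f x - f y)\<^sup>2) \<partial>distr \<nu> borel (\<Phi> x) \<partial>m)"
  proof (rule kernel.lipschitz_contraction_gap[OF r nn nn0 norm_le c _ mom f])
    fix h :: "'a \<Rightarrow> real" and L x y
    assume h: "bdd_meas h" and L: "L \<ge> 0" and lip: "\<And>x y. \<bar>h x - h y\<bar> \<le> L * nn (x - y)"
    note [measurable] = bdd_meas_meas[OF h]
    obtain C where C: "\<And>x. \<bar>h x\<bar> \<le> C" using h by (auto simp: bdd_meas_def)
    have int: "integrable \<nu> (\<lambda>w. h (\<Phi> x w))" for x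
      using C by (intro \<nu>.integrable_const_bound[where B = C]) auto
    have intnn: "integrable \<nu> (\<lambda>w. nn (\<Phi> x w - \<Phi> y w))"
    proof (rule integrableI_nonneg)
      show "(\<integral>\<^sup>+w. ennreal (nn (\<Phi> x w - \<Phi> y w)) \<partial>\<nu>) < \<infinity>"
        using contr[of x y] by (rule le_less_trans) simp
    qed (auto simp: nn0)
    have le: "(\<integral>w. nn (\<Phi> x w - \<Phi> y w) \<partial>\<nu>) \<le> r * nn (x - y)"
    proof -
      have "ennreal (\<integral>w. nn (\<Phi> x w - \<Phi> y w) \<partial>\<nu>) = (\<integral>\<^sup>+w. ennreal (nn (\<Phi> x w - \<Phi> y w)) \<partial>\<nu>)"
        using nn_integral_eq_integral[OF intnn] by (simp add: nn0)
      with contr[of x y] have "ennreal (\<integral>w. nn (\<Phi> x w - \<Phi> y w) \<partial>\<nu>) \<le> ennreal (r * nn (x - y))" by simp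
      moreover have "0 \<le> r * nn (x - y)" using r nn0[of "x - y"] by simp
      ultimately show ?thesis by (simp add: ennreal_le_iff)
    qed
    have "\<bar>kernel.T h x - kernel.T h y\<bar> = \<bar>\<integral>w. h (\<Phi> x w) - h (\<Phi> y w) \<partial>\<nu>\<bar>"
      unfolding kernel_op_def using int by (simp add: integral_distr)
    also have "\<dots> \<le> (\<integral>w. \<bar>h (\<Phi> x w) - h (\<Phi> y w)\<bar> \<partial>\<nu>)" by (rule integral_abs_bound)
    also have "\<dots> \<le> (\<integral>w. L * nn (\<Phi> x w - \<Phi> y w) \<partial>\<nu>)"
      using int intnn lip by (intro integral_mono) auto
    also have "\<dots> = L * (\<integral>w. nn (\<Phi> x w - \<Phi> y w) \<partial>\<nu>)" by simp
    also have "\<dots> \<le> L * (r * nn (x - y))" using le L by (rule mult_left_mono)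
    finally show "\<bar>kernel.T h x - kernel.T h y\<bar> \<le> L * r * nn (x - y)" by (simp add: mult.assoc)
  qed
  then show ?thesis by (simp add: nn_integral_distr)
qed

end

section \<open>Product Gaussian densities\<close>

text \<open>Independent coordinates along \<open>Basis\<close>, so that integrals factor. The
  Gaussians met later are brought to this form by a rotation.\<close>

definition gauss_prod :: "('a::euclidean_space \<Rightarrow> real) \<Rightarrow> ('a \<Rightarrow> real) \<Rightarrow> 'a \<Rightarrow> real" where
  "gauss_prod \<mu> \<sigma> x = (\<Prod>b\<in>Basis. normal_density (\<mu> b) (\<sigma> b) (x \<bullet> b))"

lemma gauss_prod_measurable[measurable]: "gauss_prod \<mu> \<sigma> \<in> borel_measurable borel"
  unfolding gauss_prod_def by measurable

lemma gauss_prod_nonneg[simp]: "0 \<le> gauss_prod \<mu> \<sigma> x"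
  unfolding gauss_prod_def by (intro prod_nonneg) auto

lemma gauss_prod_pos: "(\<And>b. b \<in> Basis \<Longrightarrow> 0 < \<sigma> b) \<Longrightarrow> 0 < gauss_prod \<mu> \<sigma> x"
  unfolding gauss_prod_def by (intro prod_pos) (auto intro: normal_density_pos)

lemma nn_integral_normal_density: "0 < \<sigma> \<Longrightarrow> (\<integral>\<^sup>+x. ennreal (normal_density \<mu> \<sigma> x) \<partial>lborel) = 1"
  by (subst nn_integral_eq_integral) auto

lemma nn_integral_gauss_prod:
  assumes "\<And>b. b \<in> Basis \<Longrightarrow> 0 < \<sigma> b"
  shows "(\<integral>\<^sup>+x. ennreal (gauss_prod \<mu> \<sigma> x) \<partial>lborel) = 1"
proof -
  have "(\<integral>\<^sup>+x. ennreal (gauss_prod \<mu> \<sigma> x) \<partial>lborel)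
      = (\<integral>\<^sup>+x. (\<Prod>b\<in>Basis. ennreal (normal_density (\<mu> b) (\<sigma> b) (x \<bullet> b))) \<partial>lborel)"
    by (simp add: gauss_prod_def prod_ennreal)
  also have "\<dots> = (\<Prod>b\<in>Basis. (\<integral>\<^sup>+x. ennreal (normal_density (\<mu> b) (\<sigma> b) x) \<partial>lborel))"
    by (intro nn_integral_lborel_prod) auto
  also have "\<dots> = 1" using assms by (intro prod.neutral) (auto simp: nn_integral_normal_density)
  finally show ?thesis .
qed

lemma prob_space_gauss_prod:
  assumes "\<And>b. b \<in> Basis \<Longrightarrow> 0 < \<sigma> b"
  shows "prob_space (density lborel (\<lambda>x. ennreal (gauss_prod \<mu> \<sigma> x)))"
  by (rule prob_spaceI) (simp add: emeasure_density nn_integral_gauss_prod[OF assms])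

lemma nn_integral_normal_density_abs:
  assumes "0 < \<sigma>"
  shows "(\<integral>\<^sup>+x. ennreal (\<bar>x\<bar> * normal_density 0 \<sigma> x) \<partial>lborel) < \<infinity>"
proof -
  have "integrable lborel (\<lambda>x. \<bar>x\<bar> * normal_density 0 \<sigma> x)"
    using integrable_normal_moment_abs[OF assms, of 0 1] by (simp add: mult.commute)
  then show ?thesis by (subst nn_integral_eq_integral) auto
qed

lemma ennreal_prod_less_top:
  fixes f :: "'a \<Rightarrow> ennreal"
  shows "(\<And>x. x \<in> A \<Longrightarrow> f x < top) \<Longrightarrow> prod f A < top"
  by (induction A rule: infinite_finite_induct) (auto simp: ennreal_mult_less_top)

text \<open>The norm is at most the sum of the absolute coordinates, and each resulting integral
  factors into one first absolute moment and total masses.\<close>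

lemma gauss_prod_norm_moment:
  fixes \<sigma> :: "'a::euclidean_space \<Rightarrow> real"
  assumes \<sigma>: "\<And>b. b \<in> Basis \<Longrightarrow> 0 < \<sigma> b"
  shows "(\<integral>\<^sup>+x. ennreal (norm x * gauss_prod (\<lambda>_. 0) \<sigma> x) \<partial>lborel) < \<infinity>"
proof -
  let ?G = "gauss_prod (\<lambda>_. 0) \<sigma>"
  have "(\<integral>\<^sup>+x. ennreal (norm x * ?G x) \<partial>lborel) \<le> (\<integral>\<^sup>+x. (\<Sum>b\<in>Basis. ennreal (\<bar>x \<bullet> b\<bar> * ?G x)) \<partial>lborel)"
  proof (rule nn_integral_mono)
    fix x :: 'a
    have "norm x * ?G x \<le> (\<Sum>b\<in>Basis. \<bar>x \<bullet> b\<bar>) * ?G x"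
      by (intro mult_right_mono norm_le_l1) auto
    then show "ennreal (norm x * ?G x) \<le> (\<Sum>b\<in>Basis. ennreal (\<bar>x \<bullet> b\<bar> * ?G x))"
      by (simp add: sum_distrib_right ennreal_leI)
  qed
  also have "\<dots> = (\<Sum>b\<in>Basis. \<integral>\<^sup>+x. ennreal (\<bar>x \<bullet> b\<bar> * ?G x) \<partial>lborel)"
    by (rule nn_integral_sum) auto
  also have "\<dots> < \<infinity>"
  proof -
    have "(\<integral>\<^sup>+x. ennreal (\<bar>x \<bullet> b\<bar> * ?G x) \<partial>lborel) < \<infinity>" if b: "b \<in> Basis" for b
    proof -
      let ?f = "\<lambda>b' t. ennreal ((if b' = b then \<bar>t\<bar> else 1) * normal_density 0 (\<sigma> b') t)"
      have "(\<integral>\<^sup>+x. ennreal (\<bar>x \<bullet> b\<bar> * ?G x) \<partial>lborel) = (\<integral>\<^sup>+x. (\<Prod>b'\<in>Basis. ?f b' (x \<bullet> b')) \<partial>lborel)"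
        using b by (intro nn_integral_cong)
          (simp add: prod_ennreal prod.distrib gauss_prod_def prod.delta')
      also have "\<dots> = (\<Prod>b'\<in>Basis. (\<integral>\<^sup>+t. ?f b' t \<partial>lborel))"
        by (intro nn_integral_lborel_prod) auto
      also have "\<dots> < top"
      proof (rule ennreal_prod_less_top)
        fix b' :: 'a assume "b' \<in> Basis"
        then show "(\<integral>\<^sup>+t. ?f b' t \<partial>lborel) < top"
          using nn_integral_normal_density_abs[OF \<sigma>] nn_integral_normal_density[OF \<sigma>, of b' 0]
          by (cases "b' = b") auto
      qed
      finally show ?thesis by simp
    qed
    then show ?thesis by (simp add: ennreal_sum_less_top)
  qed
  finally show ?thesis .
qed

section \<open>Translations, reflection and rotations of Lebesgue measure\<close>

lemma nn_integral_lborel_shift: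
  fixes f :: "'a::euclidean_space \<Rightarrow> ennreal"
  assumes [measurable]: "f \<in> borel_measurable borel"
  shows "(\<integral>\<^sup>+x. f (c + x) \<partial>lborel) = (\<integral>\<^sup>+x. f x \<partial>lborel)"
proof -
  have "(\<integral>\<^sup>+x. f x \<partial>lborel) = (\<integral>\<^sup>+x. f x \<partial>distr lborel borel ((+) c))" by (simp add: lborel_distr_plus)
  also have "\<dots> = (\<integral>\<^sup>+x. f (c + x) \<partial>lborel)" by (rule nn_integral_distr) auto
  finally show ?thesis by simp
qed

lemma nn_integral_lborel_uminus:
  fixes f :: "'a::euclidean_space \<Rightarrow> ennreal"
  assumes [measurable]: "f \<in> borel_measurable borel"
  shows "(\<integral>\<^sup>+x. f (- x) \<partial>lborel) = (\<integral>\<^sup>+x. f x \<partial>lborel)"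
proof -
  have "(\<integral>\<^sup>+x. f x \<partial>lborel) = (\<integral>\<^sup>+x. f x \<partial>distr lborel borel uminus)"
    by (subst (1) lborel_affine[of "-1" 0]) (simp_all add: density_1)
  also have "\<dots> = (\<integral>\<^sup>+x. f (- x) \<partial>lborel)" by (rule nn_integral_distr) auto
  finally show ?thesis by simp
qed

text \<open>The uniqueness argument for Haar measure: \<open>f (U x) * g (U x + y)\<close> is
  integrated over \<open>x\<close> and \<open>y\<close> with \<open>g\<close> the indicator of the
  unit ball, which \<open>U\<close> preserves. Translations move the shift from \<open>g\<close> to
  \<open>f\<close>, and the finite nonzero volume of the ball cancels.\<close>

lemma nn_integral_orthogonal:
  fixes U :: "'a::euclidean_space \<Rightarrow> 'a"
  assumes U: "orthogonal_transformation U" and f[measurable]: "f \<in> borel_measurable borel"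
  shows "(\<integral>\<^sup>+x. f (U x) \<partial>lborel) = (\<integral>\<^sup>+x. f x \<partial>lborel)"
proof -
  have lin: "linear U" using U by (simp add: orthogonal_transformation_linear)
  have [measurable]: "U \<in> borel_measurable borel"
    using lin by (intro borel_measurable_continuous_onI linear_continuous_on) (simp add: linear_conv_bounded_linear)
  have shift: "(\<integral>\<^sup>+x. k (c + U x) \<partial>lborel) = (\<integral>\<^sup>+x. k (U x) \<partial>lborel)"
    if [measurable]: "k \<in> borel_measurable borel" for k :: "'a \<Rightarrow> ennreal" and c
  proof -
    obtain c' where "c = U c'" using orthogonal_transformation_surj[OF U] by (metis surjD)
    then have "(\<integral>\<^sup>+x. k (c + U x) \<partial>lborel) = (\<integral>\<^sup>+x. k (U (c' + x)) \<partial>lborel)" by (simp add: linear_add[OF lin])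
    also have "\<dots> = (\<integral>\<^sup>+x. k (U x) \<partial>lborel)" by (rule nn_integral_lborel_shift) simp
    finally show ?thesis .
  qed
  let ?g = "indicator (ball 0 1) :: 'a \<Rightarrow> ennreal"
  have g[measurable]: "?g \<in> borel_measurable borel"
    by (rule borel_measurable_indicator, rule borel_open, rule open_ball)
  have "(\<integral>\<^sup>+x. f (U x) \<partial>lborel) * (\<integral>\<^sup>+y. ?g y \<partial>lborel)
      = (\<integral>\<^sup>+x. f (U x) * (\<integral>\<^sup>+y. ?g (U x + y) \<partial>lborel) \<partial>lborel)"
    by (simp only: nn_integral_lborel_shift[OF g]) (simp add: nn_integral_multc)
  also have "\<dots> = (\<integral>\<^sup>+x. \<integral>\<^sup>+y. f (U x) * ?g (U x + y) \<partial>lborel \<partial>lborel)"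
    by (intro nn_integral_cong) (simp add: nn_integral_cmult)
  also have "\<dots> = (\<integral>\<^sup>+y. \<integral>\<^sup>+x. f (U x) * ?g (U x + y) \<partial>lborel \<partial>lborel)"
    by (rule lborel_pair.Fubini') measurable
  also have "\<dots> = (\<integral>\<^sup>+y. \<integral>\<^sup>+x. f (- y + U x) * ?g (U x) \<partial>lborel \<partial>lborel)"
  proof (rule nn_integral_cong)
    show "(\<integral>\<^sup>+x. f (U x) * ?g (U x + y) \<partial>lborel) = (\<integral>\<^sup>+x. f (- y + U x) * ?g (U x) \<partial>lborel)" for y
      using shift[of "\<lambda>x. f x * ?g (x + y)" "- y"] by simp
  qed
  also have "\<dots> = (\<integral>\<^sup>+x. \<integral>\<^sup>+y. f (- y + U x) * ?g (U x) \<partial>lborel \<partial>lborel)"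
    by (rule lborel_pair.Fubini') measurable
  also have "\<dots> = (\<integral>\<^sup>+x. (\<integral>\<^sup>+y. f y \<partial>lborel) * ?g (U x) \<partial>lborel)"
  proof (rule nn_integral_cong)
    fix x
    have "(\<integral>\<^sup>+y. f (- y + U x) \<partial>lborel) = (\<integral>\<^sup>+y. f (U x + y) \<partial>lborel)"
      by (subst nn_integral_lborel_uminus[symmetric]) (auto simp: add.commute)
    also have "\<dots> = (\<integral>\<^sup>+y. f y \<partial>lborel)" by (rule nn_integral_lborel_shift) simp
    finally show "(\<integral>\<^sup>+y. f (- y + U x) * ?g (U x) \<partial>lborel) = (\<integral>\<^sup>+y. f y \<partial>lborel) * ?g (U x)"
      by (simp add: nn_integral_multc)
  qed
  also have "\<dots> = (\<integral>\<^sup>+y. f y \<partial>lborel) * (\<integral>\<^sup>+x. ?g x \<partial>lborel)"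
  proof -
    have "?g (U x) = ?g x" for x
      using orthogonal_transformation_norm[OF U, of x] by (simp add: indicator_def)
    then show ?thesis by (simp add: nn_integral_cmult)
  qed
  finally have eq: "(\<integral>\<^sup>+x. f (U x) \<partial>lborel) * emeasure lborel (ball (0::'a) 1)
      = (\<integral>\<^sup>+y. f y \<partial>lborel) * emeasure lborel (ball (0::'a) 1)" by simp
  have "emeasure lborel (ball (0::'a) 1) \<noteq> 0"
    using open_not_negligible[of "ball (0::'a) 1"] by (auto simp: negligible_iff_emeasure0 emeasure_lborel_ball_finite)
  moreover have "emeasure lborel (ball (0::'a) 1) \<noteq> top"
    using emeasure_lborel_ball_finite[of "0::'a" 1] by simp
  ultimately show ?thesis
    using eq by (simp add: mult.commute[of _ "emeasure lborel (ball 0 1)"] ennreal_mult_cancel_left)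
qed

text \<open>Completing the square in one coordinate; \<open>\<theta> = 0, 1\<close> correspond to the two arguments
  of the minimum in the acceptance probability.\<close>

lemma mala_ratio_coord:
  fixes h l u v \<theta> :: real
  assumes h: "h > 0" and l: "l > 0" and a: "h * l \<le> 1/2" and \<theta>: "0 \<le> \<theta>" "\<theta> \<le> 1"
  defines "q \<equiv> 1 - h * l / 2"
  defines "\<omega> \<equiv> (2 - q) / q - \<theta> * (h * l)\<^sup>2"
  defines "\<mu>' \<equiv> (1 - h * l) * u + \<theta> * (h * l)\<^sup>2 * (1 - h * l) * u / \<omega>"
  shows "(normal_density ((1 - h * l) * u) (sqrt (2 * h * q)) v)\<^sup>2 / normal_density ((1 - h * l) * u) (sqrt (2 * h)) v
      * exp (\<theta> * (h * l\<^sup>2 / 4 * (v\<^sup>2 - u\<^sup>2)))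
     \<le> 1 / (q * sqrt \<omega>) * normal_density \<mu>' (sqrt (2 * h / \<omega>)) v"
    and "1 / (q * sqrt \<omega>) \<le> 1 / sqrt (1 - 5 * (h * l)\<^sup>2 / 4)" and "\<omega> > 0"
proof -
  define a where "a = h * l"
  have a0: "0 < a" "a \<le> 1/2" using h l a by (auto simp: a_def)
  have q: "q = 1 - a / 2" "q > 0" using a0 by (auto simp: q_def a_def)
  have \<omega>1: "\<omega> = (1 + a / 2) / q - \<theta> * a\<^sup>2" by (simp add: \<omega>_def q a_def)
  have a2: "a\<^sup>2 \<le> a / 2" using a0 by (simp add: power2_eq_square)
  have "(1 + a) * q \<le> 1 + a / 2" using zero_le_square[of a] by (simp add: q(1) algebra_simps add_divide_distrib)
  then have "1 + a \<le> (1 + a / 2) / q" using q(2) by (simp add: pos_le_divide_eq)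
  moreover have "\<theta> * a\<^sup>2 \<le> 1 * (a / 2)" using \<theta> a2 a0 by (intro mult_mono) auto
  ultimately have \<omega>: "\<omega> \<ge> 1" using a0 by (simp add: \<omega>1)
  then show "\<omega> > 0" by simp
  \<comment> \<open>The loss against 1 is \<open>a^2 / 4\<close> from the changed variance and at
    most \<open>a^2\<close> from the acceptance weight, together the \<open>5 a^2 / 4\<close> of the
    second claim.\<close>
  have "q\<^sup>2 * \<omega> = (1 - a\<^sup>2 / 4) - \<theta> * a\<^sup>2 * q\<^sup>2"
    unfolding \<omega>1 using q(2) by (simp add: field_simps power2_eq_square) (simp add: q(1) field_simps)
  moreover have "\<theta> * a\<^sup>2 * q\<^sup>2 \<le> 1 * a\<^sup>2 * 1"
    using \<theta> q a0 by (intro mult_mono) (auto simp: power_le_one)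
  ultimately have *: "1 - 5 * a\<^sup>2 / 4 \<le> q\<^sup>2 * \<omega>" by simp
  have pos: "1 - 5 * a\<^sup>2 / 4 > 0" using a2 a0 by linarith
  have "sqrt (1 - 5 * a\<^sup>2 / 4) \<le> sqrt (q\<^sup>2 * \<omega>)" using * by simp
  also have "\<dots> = q * sqrt \<omega>" using q by (simp add: real_sqrt_mult)
  finally show "1 / (q * sqrt \<omega>) \<le> 1 / sqrt (1 - 5 * (h * l)\<^sup>2 / 4)"
    using pos unfolding a_def[symmetric] by (intro divide_left_mono mult_pos_pos) (use q \<omega> in auto)
  define n where "n = v - (1 - a) * u"
  define c where "c = \<theta> * a\<^sup>2 * (1 - a) * u / \<omega>"
  \<comment> \<open>Up to a nonpositive multiple of \<open>u^2\<close>, the exponent is a square in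
    \<open>n\<close> centred at \<open>c\<close>. This makes the constant in front independent of
    \<open>u\<close>.\<close>
  have key: "- n\<^sup>2 / (2 * h * q) + n\<^sup>2 / (4 * h) + \<theta> * (h * l\<^sup>2 / 4 * (v\<^sup>2 - u\<^sup>2))
     \<le> - (n - c)\<^sup>2 * \<omega> / (4 * h)"
  proof -
    have hl: "h * l\<^sup>2 / 4 = a\<^sup>2 / (4 * h)" using h by (simp add: a_def power2_eq_square field_simps)
    have v: "v = n + (1 - a) * u" by (simp add: n_def)
    have e1: "4 * h * (- n\<^sup>2 / (2 * h * q) + n\<^sup>2 / (4 * h)) = - n\<^sup>2 * (\<omega> + \<theta> * a\<^sup>2)"
    proof -
      have "(1 + a / 2) / q = 2 / q - 1" using q(2) by (simp add: q(1) field_simps)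
      then have "- n\<^sup>2 * (\<omega> + \<theta> * a\<^sup>2) = - n\<^sup>2 * (2 / q - 1)" by (simp add: \<omega>1)
      also have "\<dots> = - (4 * h * n\<^sup>2) / (2 * h * q) + 4 * h * n\<^sup>2 / (4 * h)" using h q(2) by (simp add: field_simps)
      also have "\<dots> = 4 * h * (- n\<^sup>2 / (2 * h * q) + n\<^sup>2 / (4 * h))"
        by (simp only: distrib_left times_divide_eq_right mult_minus_right)
      finally show ?thesis by simp
    qed
    have e2: "4 * h * (\<theta> * (h * l\<^sup>2 / 4 * (v\<^sup>2 - u\<^sup>2))) = \<theta> * a\<^sup>2 * ((n + (1 - a) * u)\<^sup>2 - u\<^sup>2)"
      unfolding hl v[symmetric] using h by simp
    have "4 * h * (- n\<^sup>2 / (2 * h * q) + n\<^sup>2 / (4 * h) + \<theta> * (h * l\<^sup>2 / 4 * (v\<^sup>2 - u\<^sup>2)))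
       = - n\<^sup>2 * (\<omega> + \<theta> * a\<^sup>2) + \<theta> * a\<^sup>2 * ((n + (1 - a) * u)\<^sup>2 - u\<^sup>2)"
      unfolding e1[symmetric] e2[symmetric] by (rule distrib_left)
    also have "\<dots> = - \<omega> * n\<^sup>2 + 2 * (\<theta> * a\<^sup>2 * (1 - a) * u) * n - \<theta> * a\<^sup>2 * (2 * a - a\<^sup>2) * u\<^sup>2"
      by (simp add: algebra_simps power2_eq_square)
    also have "\<dots> = - \<omega> * (n - c)\<^sup>2 + (\<theta> * a\<^sup>2 * (1 - a) * u)\<^sup>2 / \<omega> - \<theta> * a\<^sup>2 * (2 * a - a\<^sup>2) * u\<^sup>2"
      using \<omega> by (simp add: c_def power2_eq_square field_simps)
    \<comment> \<open>Completing the square adds a positive multiple of \<open>u^2\<close>. The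
      shrinking of the mean by \<open>1 - a\<close> supplies the term with
      \<open>2 * a - a^2\<close>, that is \<open>1 - (1 - a)^2\<close>, which absorbs it for
      \<open>a \<le> 1/2\<close>.\<close>
    also have "\<dots> \<le> - \<omega> * (n - c)\<^sup>2"
    proof -
      have "(\<theta> * a\<^sup>2 * (1 - a) * u)\<^sup>2 / \<omega> \<le> (\<theta> * a\<^sup>2 * (1 - a) * u)\<^sup>2 / 1"
        using \<omega> by (intro divide_left_mono) auto
      also have "\<dots> = (\<theta> * a\<^sup>2 * u\<^sup>2) * (\<theta> * a\<^sup>2 * (1 - a)\<^sup>2)" by (simp add: power2_eq_square)
      also have "\<dots> \<le> (\<theta> * a\<^sup>2 * u\<^sup>2) * (2 * a - a\<^sup>2)"
      proof (rule mult_left_mono)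
        have "\<theta> * a\<^sup>2 * (1 - a)\<^sup>2 \<le> 1 * a\<^sup>2 * 1" using \<theta> a0 by (intro mult_mono) (auto simp: power_le_one)
        then show "\<theta> * a\<^sup>2 * (1 - a)\<^sup>2 \<le> 2 * a - a\<^sup>2" using a2 a0 by linarith
      qed (use \<theta> in auto)
      finally show ?thesis by (simp add: algebra_simps)
    qed
    finally have "4 * h * (- n\<^sup>2 / (2 * h * q) + n\<^sup>2 / (4 * h) + \<theta> * (h * l\<^sup>2 / 4 * (v\<^sup>2 - u\<^sup>2))) \<le> - \<omega> * (n - c)\<^sup>2" .
    then show ?thesis using h by (simp add: field_simps)
  qed
  have d1: "(normal_density ((1 - h * l) * u) (sqrt (2 * h * q)) v)\<^sup>2 = 1 / (2 * pi * (2 * h * q)) * exp (- n\<^sup>2 / (2 * h * q))"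
    using h q by (simp add: normal_density_def n_def a_def power_mult_distrib power_divide exp_double[symmetric] field_simps)
  have d2: "normal_density ((1 - h * l) * u) (sqrt (2 * h)) v = 1 / sqrt (2 * pi * (2 * h)) * exp (- n\<^sup>2 / (4 * h))"
    using h by (simp add: normal_density_def n_def a_def)
  have d3: "normal_density \<mu>' (sqrt (2 * h / \<omega>)) v = 1 / sqrt (2 * pi * (2 * h / \<omega>)) * exp (- (n - c)\<^sup>2 * \<omega> / (4 * h))"
    using h \<omega> by (simp add: normal_density_def n_def c_def \<mu>'_def a_def field_simps)
  have const: "1 / (2 * pi * (2 * h * q)) * sqrt (2 * pi * (2 * h)) = 1 / (q * sqrt \<omega>) * (1 / sqrt (2 * pi * (2 * h / \<omega>)))"
  proof -
    have s: "sqrt (2 * pi * (2 * h / \<omega>)) = sqrt (2 * pi * (2 * h)) / sqrt \<omega>" by (simp add: real_sqrt_divide[symmetric])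
    have "sqrt (2 * pi * (2 * h)) * sqrt (2 * pi * (2 * h)) = 2 * pi * (2 * h)" using h by simp
    then show ?thesis unfolding s using h q \<omega> by (simp add: field_simps)
  qed
  have "(normal_density ((1 - h * l) * u) (sqrt (2 * h * q)) v)\<^sup>2 / normal_density ((1 - h * l) * u) (sqrt (2 * h)) v
      * exp (\<theta> * (h * l\<^sup>2 / 4 * (v\<^sup>2 - u\<^sup>2)))
    = 1 / (2 * pi * (2 * h * q)) * sqrt (2 * pi * (2 * h)) *
       exp (- n\<^sup>2 / (2 * h * q) + n\<^sup>2 / (4 * h) + \<theta> * (h * l\<^sup>2 / 4 * (v\<^sup>2 - u\<^sup>2)))"
  proof -
    have "exp (- n\<^sup>2 / (2 * h * q) + n\<^sup>2 / (4 * h) + \<theta> * (h * l\<^sup>2 / 4 * (v\<^sup>2 - u\<^sup>2)))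
      = exp (- n\<^sup>2 / (2 * h * q)) / exp (- n\<^sup>2 / (4 * h)) * exp (\<theta> * (h * l\<^sup>2 / 4 * (v\<^sup>2 - u\<^sup>2)))"
      by (simp add: exp_diff[symmetric] exp_add[symmetric])
    then show ?thesis unfolding d1 d2 by simp
  qed
  also have "\<dots> \<le> 1 / (2 * pi * (2 * h * q)) * sqrt (2 * pi * (2 * h)) * exp (- (n - c)\<^sup>2 * \<omega> / (4 * h))"
    using key h q by (intro mult_left_mono) auto
  also have "\<dots> = 1 / (q * sqrt \<omega>) * normal_density \<mu>' (sqrt (2 * h / \<omega>)) v"
    unfolding const d3 by simp
  finally show "(normal_density ((1 - h * l) * u) (sqrt (2 * h * q)) v)\<^sup>2 / normal_density ((1 - h * l) * u) (sqrt (2 * h)) v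
      * exp (\<theta> * (h * l\<^sup>2 / 4 * (v\<^sup>2 - u\<^sup>2)))
     \<le> 1 / (q * sqrt \<omega>) * normal_density \<mu>' (sqrt (2 * h / \<omega>)) v" .
qed

section \<open>Positivity of a diagonalised MALA kernel\<close>

text \<open>The two sides differ by twice the square of the integral of \<open>\<phi>\<close> times
  \<open>g\<close>. As an inequality between nonnegative integrals it can be integrated over a
  parameter.\<close>

lemma psd_rank_one:
  fixes g :: "'a::euclidean_space \<Rightarrow> real" and \<phi> :: "'a \<Rightarrow> ennreal"
  assumes [measurable]: "g \<in> borel_measurable borel" "\<phi> \<in> borel_measurable borel"
    and C: "\<And>x. \<bar>g x\<bar> \<le> C" and fin: "(\<integral>\<^sup>+x. \<phi> x \<partial>lborel) < \<infinity>"
  shows "(\<integral>\<^sup>+u. \<integral>\<^sup>+v. \<phi> u * \<phi> v * ennreal ((g u - g v)\<^sup>2) \<partial>lborel \<partial>lborel)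
      \<le> (\<integral>\<^sup>+u. \<integral>\<^sup>+v. \<phi> u * \<phi> v * ennreal ((g u)\<^sup>2 + (g v)\<^sup>2) \<partial>lborel \<partial>lborel)"
proof -
  define \<nu> where "\<nu> = density lborel \<phi>"
  have [measurable_cong]: "sets \<nu> = sets borel" by (simp add: \<nu>_def)
  interpret \<nu>: finite_measure \<nu>
    by (rule finite_measureI) (use fin in \<open>simp add: \<nu>_def emeasure_density\<close>)
  have dens: "(\<integral>\<^sup>+u. \<integral>\<^sup>+v. \<phi> u * \<phi> v * F u v \<partial>lborel \<partial>lborel) = (\<integral>\<^sup>+u. \<integral>\<^sup>+v. F u v \<partial>\<nu> \<partial>\<nu>)"
    if [measurable]: "case_prod F \<in> borel_measurable (borel \<Otimes>\<^sub>M borel)" for F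
    unfolding \<nu>_def by (simp add: nn_integral_density nn_integral_cmult[symmetric] mult.assoc)
  define I J S where "I = measure \<nu> UNIV" and "J = (\<integral>x. g x \<partial>\<nu>)" and "S = (\<integral>x. (g x)\<^sup>2 \<partial>\<nu>)"
  have space: "space \<nu> = UNIV" by (simp add: \<nu>_def)
  have C2: "(g x)\<^sup>2 \<le> C\<^sup>2" for x using C[of x] by (simp add: abs_le_square_iff[symmetric] order_trans[OF _ abs_ge_self])
  have int: "integrable \<nu> g" "integrable \<nu> (\<lambda>x. (g x)\<^sup>2)"
    subgoal using C by (intro \<nu>.integrable_const_bound[where B = C]) auto
    subgoal using C2 by (intro \<nu>.integrable_const_bound[where B = "C\<^sup>2"]) auto
    done
  have IS: "I \<ge> 0" "S \<ge> 0" by (auto simp: I_def S_def)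
  have in1: "(\<integral>\<^sup>+v. ennreal ((g u - g v)\<^sup>2) \<partial>\<nu>) = ennreal ((g u)\<^sup>2 * I - 2 * g u * J + S)"
    and in1p: "0 \<le> (g u)\<^sup>2 * I - 2 * g u * J + S" for u
  proof -
    have eq: "(g u - g v)\<^sup>2 = (g u)\<^sup>2 - 2 * g u * g v + (g v)\<^sup>2" for v by (simp add: power2_eq_square algebra_simps)
    have i: "integrable \<nu> (\<lambda>v. (g u - g v)\<^sup>2)" unfolding eq using int by auto
    have e: "(\<integral>v. (g u - g v)\<^sup>2 \<partial>\<nu>) = (g u)\<^sup>2 * I - 2 * g u * J + S"
      unfolding eq using int by (simp add: I_def J_def S_def space)
    show "(\<integral>\<^sup>+v. ennreal ((g u - g v)\<^sup>2) \<partial>\<nu>) = ennreal ((g u)\<^sup>2 * I - 2 * g u * J + S)"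
      unfolding e[symmetric] using i by (intro nn_integral_eq_integral) auto
    show "0 \<le> (g u)\<^sup>2 * I - 2 * g u * J + S" unfolding e[symmetric] by simp
  qed
  have in2: "(\<integral>\<^sup>+v. ennreal ((g u)\<^sup>2 + (g v)\<^sup>2) \<partial>\<nu>) = ennreal ((g u)\<^sup>2 * I + S)" for u
    using int by (subst nn_integral_eq_integral) (auto simp: I_def S_def space)
  have "(\<integral>\<^sup>+u. \<integral>\<^sup>+v. ennreal ((g u - g v)\<^sup>2) \<partial>\<nu> \<partial>\<nu>) = ennreal (\<integral>u. (g u)\<^sup>2 * I - 2 * g u * J + S \<partial>\<nu>)"
    unfolding in1 using int in1p by (intro nn_integral_eq_integral) auto
  also have "(\<integral>u. (g u)\<^sup>2 * I - 2 * g u * J + S \<partial>\<nu>) = S * I - 2 * J * J + S * I"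
    using int by (simp add: I_def[symmetric] J_def[symmetric] S_def[symmetric] space)
  also have "ennreal \<dots> \<le> ennreal (S * I + S * I)" by (intro ennreal_leI) simp
  also have "S * I + S * I = (\<integral>u. (g u)\<^sup>2 * I + S \<partial>\<nu>)"
    using int by (simp add: I_def[symmetric] S_def[symmetric] space)
  also have "ennreal \<dots> = (\<integral>\<^sup>+u. \<integral>\<^sup>+v. ennreal ((g u)\<^sup>2 + (g v)\<^sup>2) \<partial>\<nu> \<partial>\<nu>)"
    unfolding in2 using int IS by (intro nn_integral_eq_integral[symmetric]) auto
  finally show ?thesis by (simp add: dens)
qed

text \<open>Integrates the rank-one inequality over \<open>w\<close>. Finite mass is asked for each
  fixed \<open>w\<close> only, since Tonelli's theorem covers the rest.\<close>

lemma psd_mixture: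
  fixes g :: "'a::euclidean_space \<Rightarrow> real" and \<phi> :: "'a \<Rightarrow> 'b::euclidean_space \<Rightarrow> ennreal"
  assumes [measurable]: "g \<in> borel_measurable borel" "case_prod \<phi> \<in> borel_measurable (borel \<Otimes>\<^sub>M borel)"
    and C: "\<And>x. \<bar>g x\<bar> \<le> C" and fin: "\<And>w. (\<integral>\<^sup>+x. \<phi> x w \<partial>lborel) < \<infinity>"
  shows "(\<integral>\<^sup>+u. \<integral>\<^sup>+v. (\<integral>\<^sup>+w. \<phi> u w * \<phi> v w \<partial>lborel) * ennreal ((g u - g v)\<^sup>2) \<partial>lborel \<partial>lborel)
      \<le> (\<integral>\<^sup>+u. \<integral>\<^sup>+v. (\<integral>\<^sup>+w. \<phi> u w * \<phi> v w \<partial>lborel) * ennreal ((g u)\<^sup>2 + (g v)\<^sup>2) \<partial>lborel \<partial>lborel)"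
proof -
  have swap: "(\<integral>\<^sup>+u. \<integral>\<^sup>+v. (\<integral>\<^sup>+w. \<phi> u w * \<phi> v w \<partial>lborel) * F u v \<partial>lborel \<partial>lborel)
      = (\<integral>\<^sup>+w. \<integral>\<^sup>+u. \<integral>\<^sup>+v. \<phi> u w * \<phi> v w * F u v \<partial>lborel \<partial>lborel \<partial>lborel)"
    if [measurable]: "case_prod F \<in> borel_measurable (borel \<Otimes>\<^sub>M borel)" for F :: "'a \<Rightarrow> 'a \<Rightarrow> ennreal"
  proof -
    have "(\<integral>\<^sup>+u. \<integral>\<^sup>+v. (\<integral>\<^sup>+w. \<phi> u w * \<phi> v w \<partial>lborel) * F u v \<partial>lborel \<partial>lborel)
      = (\<integral>\<^sup>+u. \<integral>\<^sup>+v. \<integral>\<^sup>+w. \<phi> u w * \<phi> v w * F u v \<partial>lborel \<partial>lborel \<partial>lborel)"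
      by (intro nn_integral_cong) (simp add: nn_integral_multc)
    also have "\<dots> = (\<integral>\<^sup>+u. \<integral>\<^sup>+w. \<integral>\<^sup>+v. \<phi> u w * \<phi> v w * F u v \<partial>lborel \<partial>lborel \<partial>lborel)"
      by (intro nn_integral_cong lborel_pair.Fubini') measurable
    also have "\<dots> = (\<integral>\<^sup>+w. \<integral>\<^sup>+u. \<integral>\<^sup>+v. \<phi> u w * \<phi> v w * F u v \<partial>lborel \<partial>lborel \<partial>lborel)"
      by (rule lborel_pair.Fubini') measurable
    finally show ?thesis .
  qed
  have "(\<integral>\<^sup>+u. \<integral>\<^sup>+v. (\<integral>\<^sup>+w. \<phi> u w * \<phi> v w \<partial>lborel) * ennreal ((g u - g v)\<^sup>2) \<partial>lborel \<partial>lborel)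
      = (\<integral>\<^sup>+w. \<integral>\<^sup>+u. \<integral>\<^sup>+v. \<phi> u w * \<phi> v w * ennreal ((g u - g v)\<^sup>2) \<partial>lborel \<partial>lborel \<partial>lborel)"
    by (rule swap) measurable
  also have "\<dots> \<le> (\<integral>\<^sup>+w. \<integral>\<^sup>+u. \<integral>\<^sup>+v. \<phi> u w * \<phi> v w * ennreal ((g u)\<^sup>2 + (g v)\<^sup>2) \<partial>lborel \<partial>lborel \<partial>lborel)"
    by (rule nn_integral_mono, rule psd_rank_one[where C = C]) (use C fin in auto)
  also have "\<dots> = (\<integral>\<^sup>+u. \<integral>\<^sup>+v. (\<integral>\<^sup>+w. \<phi> u w * \<phi> v w \<partial>lborel) * ennreal ((g u)\<^sup>2 + (g v)\<^sup>2) \<partial>lborel \<partial>lborel)"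
    by (rule swap[symmetric]) measurable
  finally show ?thesis .
qed

text \<open>Completing the square around the midpoint. Integrating out \<open>w\<close> then
  exhibits a Gaussian in \<open>u - v\<close> as a mixture of products of a factor in
  \<open>u\<close> and a factor in \<open>v\<close>.\<close>

lemma normal_density_mult:
  assumes "\<tau> > 0"
  shows "normal_density u \<tau> w * normal_density v \<tau> w
    = exp (- (u - v)\<^sup>2 / (4 * \<tau>\<^sup>2)) / sqrt (4 * pi * \<tau>\<^sup>2) * normal_density ((u + v) / 2) (\<tau> / sqrt 2) w"
proof -
  have 1: "normal_density u \<tau> w * normal_density v \<tau> w
     = (1 / sqrt (2 * pi * \<tau>\<^sup>2) * (1 / sqrt (2 * pi * \<tau>\<^sup>2))) * exp (- (w - u)\<^sup>2 / (2 * \<tau>\<^sup>2) + - (w - v)\<^sup>2 / (2 * \<tau>\<^sup>2))"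
    unfolding normal_density_def exp_add by simp
  have e: "- (w - u)\<^sup>2 / (2 * \<tau>\<^sup>2) + - (w - v)\<^sup>2 / (2 * \<tau>\<^sup>2) = - (u - v)\<^sup>2 / (4 * \<tau>\<^sup>2) + - (w - (u + v) / 2)\<^sup>2 / (2 * (\<tau> / sqrt 2)\<^sup>2)"
    using assms by (simp add: power_divide field_simps power2_eq_square)
  have c: "1 / sqrt (2 * pi * \<tau>\<^sup>2) * (1 / sqrt (2 * pi * \<tau>\<^sup>2)) = 1 / sqrt (4 * pi * \<tau>\<^sup>2) * (1 / sqrt (2 * pi * (\<tau> / sqrt 2)\<^sup>2))"
  proof -
    have "sqrt (4 * pi * \<tau>\<^sup>2) * sqrt (2 * pi * (\<tau> / sqrt 2)\<^sup>2) = sqrt ((2 * pi * \<tau>\<^sup>2) * (2 * pi * \<tau>\<^sup>2))"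
      by (subst real_sqrt_mult[symmetric]) (simp add: power_divide)
    also have "\<dots> = sqrt (2 * pi * \<tau>\<^sup>2) * sqrt (2 * pi * \<tau>\<^sup>2)" by (rule real_sqrt_mult)
    finally show ?thesis by simp
  qed
  show ?thesis unfolding 1 e c exp_add by (simp add: normal_density_def)
qed

lemma normal_density_le: "normal_density \<mu> \<sigma> x \<le> 1 / sqrt (2 * pi * \<sigma>\<^sup>2)"
proof -
  have "normal_density \<mu> \<sigma> x \<le> 1 / sqrt (2 * pi * \<sigma>\<^sup>2) * 1"
    unfolding normal_density_def by (intro mult_left_mono) auto
  then show ?thesis by simp
qed

text \<open>MALA for the centred Gaussian with precision \<open>diag l\<close>. The acceptance ratio depends only on
  \<open>\<parallel>diag l u\<parallel>\<^sup>2 - \<parallel>diag l v\<parallel>\<^sup>2\<close>, and \<open>ar_dens\<close> is the autoregressive kernel with the drift of the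
  proposal whose variance is adjusted so that it is reversible for the target.\<close>

locale diag_mala =
  fixes l :: "'a::euclidean_space \<Rightarrow> real" and h :: real
  assumes h: "h > 0" and l: "\<And>b. b \<in> Basis \<Longrightarrow> 0 < l b"
    and up: "\<And>b. b \<in> Basis \<Longrightarrow> h * l b \<le> 1 / sqrt (10 * DIM('a))"
    and low: "\<And>b. b \<in> Basis \<Longrightarrow> 1 / (2 * sqrt (10 * DIM('a))) \<le> h * l b"
begin

definition target_dens :: "'a \<Rightarrow> real" where
  "target_dens = gauss_prod (\<lambda>_. 0) (\<lambda>b. 1 / sqrt (l b))"

definition prop_dens :: "'a \<Rightarrow> 'a \<Rightarrow> real" where
  "prop_dens u = gauss_prod (\<lambda>b. (1 - h * l b) * (u \<bullet> b)) (\<lambda>_. sqrt (2 * h))"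

text \<open>An autoregression with coefficient \<open>1 - h * l b\<close> has stationary variance
  \<open>1 / l b\<close> exactly when its noise variance is
  \<open>(1 - (1 - h * l b)^2) / l b\<close>, which equals
  \<open>2 * h * (1 - h * l b / 2)\<close>.\<close>

definition ar_dens :: "'a \<Rightarrow> 'a \<Rightarrow> real" where
  "ar_dens u = gauss_prod (\<lambda>b. (1 - h * l b) * (u \<bullet> b)) (\<lambda>b. sqrt (2 * h * (1 - h * l b / 2)))"

text \<open>The squared norm of the gradient of the log target.\<close>

definition grad_sq :: "'a \<Rightarrow> real" where
  "grad_sq u = (\<Sum>b\<in>Basis. (l b)\<^sup>2 * (u \<bullet> b)\<^sup>2)"

text \<open>Accepted moves only, without the rejection mass. The Metropolis ratio of this Gaussian
  target collapses to the exponential, as \<open>target_dens_prop_dens_ratio\<close>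
  confirms.\<close>

definition move_dens :: "'a \<Rightarrow> 'a \<Rightarrow> real" where
  "move_dens u v = prop_dens u v * min 1 (exp (h / 4 * (grad_sq u - grad_sq v)))"

lemma target_dens_meas[measurable]: "target_dens \<in> borel_measurable borel" by (simp add: target_dens_def)

lemma prop_dens_meas[measurable]: "case_prod prop_dens \<in> borel_measurable (borel \<Otimes>\<^sub>M borel)"
  unfolding prop_dens_def gauss_prod_def normal_density_def by measurable

lemma ar_dens_meas[measurable]: "case_prod ar_dens \<in> borel_measurable (borel \<Otimes>\<^sub>M borel)"
  unfolding ar_dens_def gauss_prod_def normal_density_def by measurable

lemma grad_sq_meas[measurable]: "grad_sq \<in> borel_measurable borel"
  unfolding grad_sq_def by measurable

lemma move_dens_meas[measurable]: "case_prod move_dens \<in> borel_measurable (borel \<Otimes>\<^sub>M borel)"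
  unfolding move_dens_def by measurable

lemma a_half: assumes "b \<in> Basis" shows "h * l b \<le> 1 / 2"
proof -
  have "(4::real) \<le> 10 * DIM('a)" using DIM_positive[where 'a='a] by linarith
  then have "sqrt 4 \<le> sqrt (10 * DIM('a))" by (rule real_sqrt_le_mono)
  then have "1 / sqrt (10 * DIM('a)) \<le> 1 / 2" by (intro divide_left_mono) auto
  then show ?thesis using up[OF assms] by linarith
qed

lemma a_pos: "b \<in> Basis \<Longrightarrow> 0 < h * l b" using h l by simp

lemma target_dens_nonneg[simp]: "0 \<le> target_dens u" by (simp add: target_dens_def)
lemma target_dens_pos: "0 < target_dens u" unfolding target_dens_def by (intro gauss_prod_pos) (simp add: l)
lemma prop_dens_pos: "0 < prop_dens u v" unfolding prop_dens_def using h by (intro gauss_prod_pos) simp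
lemma ar_dens_pos: "0 < ar_dens u v" unfolding ar_dens_def using h a_half
  by (intro gauss_prod_pos) (fastforce intro!: mult_pos_pos)
lemma move_dens_pos: "0 < move_dens u v" unfolding move_dens_def using prop_dens_pos by (simp add: min_def)

text \<open>In each coordinate the joint exponent is a multiple of
  \<open>x^2 + y^2 - 2 * (1 - a) * x * y\<close>, which is symmetric.\<close>

lemma target_dens_ar_dens_sym: "target_dens u * ar_dens u v = target_dens v * ar_dens v u"
proof -
  have "normal_density 0 (1 / sqrt (l b)) (u \<bullet> b) * normal_density ((1 - h * l b) * (u \<bullet> b)) (sqrt (2 * h * (1 - h * l b / 2))) (v \<bullet> b)
     = normal_density 0 (1 / sqrt (l b)) (v \<bullet> b) * normal_density ((1 - h * l b) * (v \<bullet> b)) (sqrt (2 * h * (1 - h * l b / 2))) (u \<bullet> b)"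
    if b: "b \<in> Basis" for b
  proof -
    define x y a q where "x = u \<bullet> b" and "y = v \<bullet> b" and "a = h * l b" and "q = 1 - h * l b / 2"
    have q: "q > 0" using a_half[OF b] by (simp add: q_def)
    have lb: "l b = a / h" using h by (simp add: a_def)
    have e: "- (x\<^sup>2 * l b) / 2 + - (y - (1 - a) * x)\<^sup>2 / (4 * h * q) = - (x\<^sup>2 + y\<^sup>2 - 2 * (1 - a) * x * y) / (4 * h * q)" for x y
    proof -
      have "- (x\<^sup>2 * l b) / 2 = - (2 * a * q * x\<^sup>2) / (4 * h * q)" using h q by (simp add: lb mult_ac)
      then have "- (x\<^sup>2 * l b) / 2 + - (y - (1 - a) * x)\<^sup>2 / (4 * h * q) = (- (2 * a * q * x\<^sup>2) - (y - (1 - a) * x)\<^sup>2) / (4 * h * q)"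
        by (simp add: add_divide_distrib[symmetric] diff_divide_distrib)
      also have "- (2 * a * q * x\<^sup>2) - (y - (1 - a) * x)\<^sup>2 = - (x\<^sup>2 + y\<^sup>2 - 2 * (1 - a) * x * y)"
        unfolding q_def a_def by (simp add: power2_eq_square field_simps)
      finally show ?thesis .
    qed
    have N: "normal_density 0 (1 / sqrt (l b)) x * normal_density ((1 - a) * x) (sqrt (2 * h * q)) y
       = 1 / sqrt (2 * pi / l b) * (1 / sqrt (2 * pi * (2 * h * q))) * exp (- (x\<^sup>2 * l b) / 2 + - (y - (1 - a) * x)\<^sup>2 / (4 * h * q))" for x y
      unfolding exp_add using h q l[OF b] by (simp add: normal_density_def power_divide)
    have "x\<^sup>2 + y\<^sup>2 - 2 * (1 - a) * x * y = y\<^sup>2 + x\<^sup>2 - 2 * (1 - a) * y * x" by simp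
    then show ?thesis
      unfolding x_def[symmetric] y_def[symmetric] q_def[symmetric]
      unfolding a_def[symmetric] N e by (simp only:)
  qed
  then show ?thesis
    unfolding target_dens_def ar_dens_def gauss_prod_def prod.distrib[symmetric] by (intro prod.cong) auto
qed

text \<open>The density of accepted moves against the target is an integral of \<open>mix_factor u \<cdot> mix_factor v\<close>:
  a Gaussian in \<open>u - v\<close> is a mixture over centres, and \<open>min\<close> of two weights is a mixture over levels.\<close>

definition tau :: "'a \<Rightarrow> real" where "tau b = sqrt (h / (1 - h * l b))"

lemma tau_pos: "b \<in> Basis \<Longrightarrow> tau b > 0"
  unfolding tau_def using a_half[of b] h by simp

text \<open>The square root of the unnormalised target, so that half of the target weight can be
  attached to each of \<open>u\<close> and \<open>v\<close>.\<close>

definition E :: "'a \<Rightarrow> real" where "E u = exp (- (\<Sum>b\<in>Basis. l b * (u \<bullet> b)\<^sup>2) / 4)"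

definition mix_factor :: "'a \<Rightarrow> 'a \<times> real \<Rightarrow> ennreal" where
  "mix_factor u p = ennreal (E u * gauss_prod (\<lambda>b. u \<bullet> b) tau (fst p) * (if 0 < snd p \<and> snd p < exp (- h / 4 * grad_sq u) then 1 else 0))"

definition mix_const :: real where
  "mix_const = (\<Prod>b\<in>Basis. 1 / sqrt (2 * pi / l b) * (1 / sqrt (2 * pi * (2 * h))) * sqrt (4 * pi * (tau b)\<^sup>2))"

text \<open>All asymmetry between \<open>u\<close> and \<open>v\<close> is collected in the factor
  \<open>exp (- h / 4 * grad_sq u)\<close>. Matching the cross terms of the exponents,
  \<open>(1 - h * l b) / (2 * h) = 1 / (2 * (tau b)^2)\<close>, determines
  \<open>tau\<close>.\<close>

lemma target_dens_prop_dens: "target_dens u * prop_dens u v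
   = mix_const * (E u * E v * exp (- h / 4 * grad_sq u) * (\<Prod>b\<in>Basis. exp (- (u \<bullet> b - v \<bullet> b)\<^sup>2 / (4 * (tau b)\<^sup>2)) / sqrt (4 * pi * (tau b)\<^sup>2)))"
proof -
  have "normal_density 0 (1 / sqrt (l b)) (u \<bullet> b) * normal_density ((1 - h * l b) * (u \<bullet> b)) (sqrt (2 * h)) (v \<bullet> b)
     = (1 / sqrt (2 * pi / l b) * (1 / sqrt (2 * pi * (2 * h))) * sqrt (4 * pi * (tau b)\<^sup>2)) *
       (exp (- (l b * (u \<bullet> b)\<^sup>2) / 4) * exp (- (l b * (v \<bullet> b)\<^sup>2) / 4) * exp (- h / 4 * ((l b)\<^sup>2 * (u \<bullet> b)\<^sup>2))
       * (exp (- (u \<bullet> b - v \<bullet> b)\<^sup>2 / (4 * (tau b)\<^sup>2)) / sqrt (4 * pi * (tau b)\<^sup>2)))" if b: "b \<in> Basis" for b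
  proof -
    define x y a where "x = u \<bullet> b" and "y = v \<bullet> b" and "a = h * l b"
    have a: "1 - a > 0" using a_half[OF b] by (simp add: a_def)
    have lb: "l b = a / h" using h by (simp add: a_def)
    have t2: "(tau b)\<^sup>2 = h / (1 - a)" unfolding tau_def using a h by (simp add: a_def)
    have t0: "sqrt (4 * pi * (tau b)\<^sup>2) > 0" using tau_pos[OF b] by simp
    have e: "- (x\<^sup>2 * l b) / 2 + - (y - (1 - a) * x)\<^sup>2 / (4 * h)
       = - (l b * x\<^sup>2) / 4 + - (l b * y\<^sup>2) / 4 + - h / 4 * ((l b)\<^sup>2 * x\<^sup>2) + - (x - y)\<^sup>2 / (4 * (tau b)\<^sup>2)"
      unfolding t2 lb using h a by (simp add: field_simps power2_eq_square)
    have "normal_density 0 (1 / sqrt (l b)) x * normal_density ((1 - a) * x) (sqrt (2 * h)) y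
       = 1 / sqrt (2 * pi / l b) * (1 / sqrt (2 * pi * (2 * h))) * exp (- (x\<^sup>2 * l b) / 2 + - (y - (1 - a) * x)\<^sup>2 / (4 * h))"
      unfolding exp_add using h l[OF b] by (simp add: normal_density_def power_divide)
    also have "\<dots> = (1 / sqrt (2 * pi / l b) * (1 / sqrt (2 * pi * (2 * h))) * sqrt (4 * pi * (tau b)\<^sup>2)) *
       (exp (- (l b * x\<^sup>2) / 4) * exp (- (l b * y\<^sup>2) / 4) * exp (- h / 4 * ((l b)\<^sup>2 * x\<^sup>2))
       * (exp (- (x - y)\<^sup>2 / (4 * (tau b)\<^sup>2)) / sqrt (4 * pi * (tau b)\<^sup>2)))"
      unfolding e exp_add using t0 tau_pos[OF b] by simp
    finally show ?thesis unfolding x_def y_def a_def .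
  qed
  then have "target_dens u * prop_dens u v = (\<Prod>b\<in>Basis. (1 / sqrt (2 * pi / l b) * (1 / sqrt (2 * pi * (2 * h))) * sqrt (4 * pi * (tau b)\<^sup>2)) *
       (exp (- (l b * (u \<bullet> b)\<^sup>2) / 4) * exp (- (l b * (v \<bullet> b)\<^sup>2) / 4) * exp (- h / 4 * ((l b)\<^sup>2 * (u \<bullet> b)\<^sup>2))
       * (exp (- (u \<bullet> b - v \<bullet> b)\<^sup>2 / (4 * (tau b)\<^sup>2)) / sqrt (4 * pi * (tau b)\<^sup>2))))"
    unfolding target_dens_def prop_dens_def gauss_prod_def prod.distrib[symmetric] by (intro prod.cong) auto
  then show ?thesis
    unfolding prod.distrib mix_const_def E_def grad_sq_def
    by (simp add: exp_sum[symmetric] sum_divide_distrib sum_negf sum_distrib_left)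
qed

lemma mix_const_nonneg: "mix_const \<ge> 0"
  unfolding mix_const_def
proof (intro prod_nonneg ballI)
  fix b :: 'a assume "b \<in> Basis"
  then have "l b > 0" by (rule l)
  then show "0 \<le> 1 / sqrt (2 * pi / l b) * (1 / sqrt (2 * pi * (2 * h))) * sqrt (4 * pi * (tau b)\<^sup>2)"
    using h by (intro mult_nonneg_nonneg divide_nonneg_nonneg real_sqrt_ge_zero) auto
qed

lemma E_meas[measurable]: "E \<in> borel_measurable borel"
  unfolding E_def by measurable

lemma mix_factor_meas[measurable]: "case_prod mix_factor \<in> borel_measurable (borel \<Otimes>\<^sub>M borel)"
  unfolding mix_factor_def split_beta' borel_prod[symmetric] gauss_prod_def normal_density_def by measurable

lemma min_nn_integral:
  assumes "0 \<le> x" "0 \<le> y"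
  shows "(\<integral>\<^sup>+t. ennreal ((if 0 < t \<and> t < x then 1 else 0) * (if 0 < t \<and> t < y then 1 else 0)) \<partial>lborel) = ennreal (min x y)"
proof -
  have "(\<integral>\<^sup>+t. ennreal ((if 0 < t \<and> t < x then 1 else 0) * (if 0 < t \<and> t < y then 1 else 0)) \<partial>lborel)
      = (\<integral>\<^sup>+t. indicator {0<..<min x y} t \<partial>lborel)"
    by (intro nn_integral_cong) (auto simp: indicator_def)
  also have "\<dots> = ennreal (min x y)" using assms by simp
  finally show ?thesis .
qed

lemma target_dens_move_dens_mixture:
  "ennreal (target_dens u * move_dens u v) = ennreal mix_const * (\<integral>\<^sup>+p. mix_factor u p * mix_factor v p \<partial>lborel)"
proof -
  let ?R = "\<Prod>b\<in>Basis. exp (- (u \<bullet> b - v \<bullet> b)\<^sup>2 / (4 * (tau b)\<^sup>2)) / sqrt (4 * pi * (tau b)\<^sup>2)"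
  let ?G = "\<lambda>u. gauss_prod (\<lambda>b. u \<bullet> b) tau" and ?W = "\<lambda>u. exp (- h / 4 * grad_sq u)"
  have R: "?R \<ge> 0" by (intro prod_nonneg) auto
  have G: "?G u w * ?G v w = ?R * gauss_prod (\<lambda>b. (u \<bullet> b + v \<bullet> b) / 2) (\<lambda>b. tau b / sqrt 2) w" for w
    unfolding gauss_prod_def prod.distrib[symmetric] using tau_pos
    by (intro prod.cong refl) (simp add: normal_density_mult)
  have "(\<integral>\<^sup>+p. mix_factor u p * mix_factor v p \<partial>lborel) = (\<integral>\<^sup>+p. mix_factor u p * mix_factor v p \<partial>(lborel \<Otimes>\<^sub>M lborel))"
    by (simp add: lborel_prod)
  also have "\<dots> = (\<integral>\<^sup>+w. \<integral>\<^sup>+t. mix_factor u (w, t) * mix_factor v (w, t) \<partial>lborel \<partial>lborel)"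
    by (subst lborel.nn_integral_fst[symmetric]) (auto simp: lborel_prod)
  also have "\<dots> = (\<integral>\<^sup>+w. \<integral>\<^sup>+t. ennreal (E u * E v * (?G u w * ?G v w)) * ennreal ((if 0 < t \<and> t < ?W u then 1 else 0) * (if 0 < t \<and> t < ?W v then 1 else 0)) \<partial>lborel \<partial>lborel)"
    by (intro nn_integral_cong) (simp add: mix_factor_def ennreal_mult[symmetric] E_def mult_ac)
  also have "\<dots> = (\<integral>\<^sup>+w. ennreal (E u * E v * (?G u w * ?G v w)) * ennreal (min (?W u) (?W v)) \<partial>lborel)"
    by (intro nn_integral_cong, subst nn_integral_cmult) (auto simp: min_nn_integral)
  also have "\<dots> = (\<integral>\<^sup>+w. ennreal (E u * E v * ?R * min (?W u) (?W v)) * ennreal (gauss_prod (\<lambda>b. (u \<bullet> b + v \<bullet> b) / 2) (\<lambda>b. tau b / sqrt 2) w) \<partial>lborel)"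
    unfolding G using R by (intro nn_integral_cong) (simp add: ennreal_mult[symmetric] E_def mult_ac min_def)
  also have "\<dots> = ennreal (E u * E v * ?R * min (?W u) (?W v))"
    by (subst nn_integral_cmult) (auto simp: nn_integral_gauss_prod tau_pos)
  finally have 1: "(\<integral>\<^sup>+p. mix_factor u p * mix_factor v p \<partial>lborel) = ennreal (E u * E v * ?R * min (?W u) (?W v))" .
  \<comment> \<open>The asymmetric weight left over by the proposal times the acceptance probability
    is the minimum of the two weights. This is both detailed balance and the source of the level
    variable.\<close>
  have "exp (- h / 4 * grad_sq u) * min 1 (exp (h / 4 * (grad_sq u - grad_sq v))) = min (?W u) (?W v)"
  proof -
    have "?W u * exp (h / 4 * (grad_sq u - grad_sq v)) = ?W v" by (simp add: exp_add[symmetric] algebra_simps)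
    moreover have "?W u * min 1 (exp (h / 4 * (grad_sq u - grad_sq v))) = min (?W u * 1) (?W u * exp (h / 4 * (grad_sq u - grad_sq v)))"
      by (simp add: min_mult_distrib_left)
    ultimately show ?thesis by simp
  qed
  then have "target_dens u * move_dens u v = mix_const * (E u * E v * ?R * min (?W u) (?W v))"
    unfolding move_dens_def mult.assoc[symmetric] target_dens_prop_dens by (simp add: mult_ac)
  then show ?thesis unfolding 1 using mix_const_nonneg by (simp add: ennreal_mult')
qed

lemma target_dens_move_dens_sym: "target_dens u * move_dens u v = target_dens v * move_dens v u"
proof -
  have "ennreal (target_dens u * move_dens u v) = ennreal (target_dens v * move_dens v u)"
    unfolding target_dens_move_dens_mixture by (simp add: mult.commute)
  then show ?thesis using move_dens_pos target_dens_pos by (simp add: less_imp_le)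
qed

text \<open>Formally this says that the accepted moves have a nonnegative quadratic form: the
  difference of the two sides is twice the integral of
  \<open>target_dens u * move_dens u v * g u * g v\<close>.\<close>

theorem fibre_psd:
  fixes g :: "'a \<Rightarrow> real"
  assumes g[measurable]: "g \<in> borel_measurable borel" and C: "\<And>x. \<bar>g x\<bar> \<le> C"
  shows "(\<integral>\<^sup>+u. \<integral>\<^sup>+v. ennreal (target_dens u * move_dens u v * (g u - g v)\<^sup>2) \<partial>lborel \<partial>lborel)
     \<le> (\<integral>\<^sup>+u. \<integral>\<^sup>+v. ennreal (target_dens u * move_dens u v * ((g u)\<^sup>2 + (g v)\<^sup>2)) \<partial>lborel \<partial>lborel)"
proof -
  have fin: "(\<integral>\<^sup>+x. mix_factor x p \<partial>lborel) < \<infinity>" for p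
  proof -
    \<comment> \<open>Replacing the Gaussian factor by its maximum \<open>G\<close> and the
      indicator by 1 leaves \<open>E\<close>, which is \<open>D\<close> times a product normal
      density with variances \<open>2 / l b\<close> and hence integrable.\<close>
    define G where "G = (\<Prod>b\<in>Basis. 1 / sqrt (2 * pi * (tau b)\<^sup>2))"
    have G0: "G \<ge> 0" unfolding G_def by (intro prod_nonneg) auto
    have gp: "gauss_prod (\<lambda>b. x \<bullet> b) tau w \<le> G" for x w
      unfolding gauss_prod_def G_def normal_density_def
      by (intro prod_mono conjI normal_density_le[unfolded normal_density_def]) auto
    define D where "D = (\<Prod>b\<in>(Basis::'a set). sqrt (2 * pi * (2 / l b)))"
    have D0: "D \<ge> 0" unfolding D_def using l by (intro prod_nonneg) (auto intro: less_imp_le)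
    have Eq: "E x = D * gauss_prod (\<lambda>_. 0) (\<lambda>b. sqrt (2 / l b)) x" for x
    proof -
      have "exp (- (l b * (x \<bullet> b)\<^sup>2) / 4) = sqrt (2 * pi * (2 / l b)) * normal_density 0 (sqrt (2 / l b)) (x \<bullet> b)"
        if "b \<in> Basis" for b
        using l[OF that] by (simp add: normal_density_def field_simps)
      moreover have "E x = (\<Prod>b\<in>Basis. exp (- (l b * (x \<bullet> b)\<^sup>2) / 4))"
        by (simp add: E_def exp_sum[symmetric] sum_divide_distrib sum_negf)
      ultimately show ?thesis
        unfolding D_def gauss_prod_def prod.distrib[symmetric] by (simp only: cong: prod.cong)
    qed
    have "(\<integral>\<^sup>+x. mix_factor x p \<partial>lborel) \<le> (\<integral>\<^sup>+x. ennreal (G * D) * ennreal (gauss_prod (\<lambda>_. 0) (\<lambda>b. sqrt (2 / l b)) x) \<partial>lborel)"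
    proof (rule nn_integral_mono)
      fix x
      have "E x * gauss_prod (\<lambda>b. x \<bullet> b) tau (fst p) * (if 0 < snd p \<and> snd p < exp (- h / 4 * grad_sq x) then 1 else 0) \<le> E x * G * 1"
        using gp G0 by (intro mult_mono) (auto simp: E_def)
      then show "mix_factor x p \<le> ennreal (G * D) * ennreal (gauss_prod (\<lambda>_. 0) (\<lambda>b. sqrt (2 / l b)) x)"
        unfolding mix_factor_def using G0 D0 by (simp add: ennreal_mult[symmetric] Eq mult_ac ennreal_leI)
    qed
    also have "\<dots> = ennreal (G * D)"
      using l by (subst nn_integral_cmult) (auto simp: nn_integral_gauss_prod)
    finally show ?thesis by (rule le_less_trans) simp
  qed
  have eq: "(\<integral>\<^sup>+u. \<integral>\<^sup>+v. ennreal (target_dens u * move_dens u v * F u v) \<partial>lborel \<partial>lborel)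
     = ennreal mix_const * (\<integral>\<^sup>+u. \<integral>\<^sup>+v. (\<integral>\<^sup>+p. mix_factor u p * mix_factor v p \<partial>lborel) * ennreal (F u v) \<partial>lborel \<partial>lborel)"
    if [measurable]: "case_prod F \<in> borel_measurable (borel \<Otimes>\<^sub>M borel)" and F0: "\<And>u v. F u v \<ge> 0" for F
  proof -
    have "(\<integral>\<^sup>+u. \<integral>\<^sup>+v. ennreal (target_dens u * move_dens u v * F u v) \<partial>lborel \<partial>lborel)
      = (\<integral>\<^sup>+u. \<integral>\<^sup>+v. ennreal mix_const * ((\<integral>\<^sup>+p. mix_factor u p * mix_factor v p \<partial>lborel) * ennreal (F u v)) \<partial>lborel \<partial>lborel)"
    proof (intro nn_integral_cong)
      fix u v
      have "ennreal (target_dens u * move_dens u v * F u v) = ennreal (target_dens u * move_dens u v) * ennreal (F u v)"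
        using F0 move_dens_pos[of u v] by (intro ennreal_mult) auto
      then show "ennreal (target_dens u * move_dens u v * F u v) = ennreal mix_const * ((\<integral>\<^sup>+p. mix_factor u p * mix_factor v p \<partial>lborel) * ennreal (F u v))"
        by (simp only: target_dens_move_dens_mixture mult.assoc)
    qed
    also have "\<dots> = (\<integral>\<^sup>+u. ennreal mix_const * (\<integral>\<^sup>+v. (\<integral>\<^sup>+p. mix_factor u p * mix_factor v p \<partial>lborel) * ennreal (F u v) \<partial>lborel) \<partial>lborel)"
      by (intro nn_integral_cong nn_integral_cmult) measurable
    also have "\<dots> = ennreal mix_const * (\<integral>\<^sup>+u. \<integral>\<^sup>+v. (\<integral>\<^sup>+p. mix_factor u p * mix_factor v p \<partial>lborel) * ennreal (F u v) \<partial>lborel \<partial>lborel)"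
      by (intro nn_integral_cmult) measurable
    finally show ?thesis .
  qed
  have "(\<integral>\<^sup>+u. \<integral>\<^sup>+v. ennreal (target_dens u * move_dens u v * (g u - g v)\<^sup>2) \<partial>lborel \<partial>lborel)
     = ennreal mix_const * (\<integral>\<^sup>+u. \<integral>\<^sup>+v. (\<integral>\<^sup>+p. mix_factor u p * mix_factor v p \<partial>lborel) * ennreal ((g u - g v)\<^sup>2) \<partial>lborel \<partial>lborel)"
    by (rule eq) auto
  also have "\<dots> \<le> ennreal mix_const * (\<integral>\<^sup>+u. \<integral>\<^sup>+v. (\<integral>\<^sup>+p. mix_factor u p * mix_factor v p \<partial>lborel) * ennreal ((g u)\<^sup>2 + (g v)\<^sup>2) \<partial>lborel \<partial>lborel)"
    by (rule mult_left_mono, rule psd_mixture[where C = C]) (use C fin in auto)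
  also have "\<dots> = (\<integral>\<^sup>+u. \<integral>\<^sup>+v. ennreal (target_dens u * move_dens u v * ((g u)\<^sup>2 + (g v)\<^sup>2)) \<partial>lborel \<partial>lborel)"
    by (rule eq[symmetric]) auto
  finally show ?thesis .
qed

end

section \<open>Spectral gap of a diagonalised MALA kernel\<close>

lemma norm_L2_set_Basis: "norm x = L2_set (\<lambda>b. x \<bullet> b) Basis" for x :: "'a::euclidean_space"
  unfolding norm_eq_sqrt_inner L2_set_def by (subst euclidean_inner) (simp add: power2_eq_square)

context diag_mala begin

text \<open>By \<open>h * l b \<le> 1 / sqrt (10 * s)\<close> the loss
  \<open>5 (h * l b)^2 / 4\<close> is at most \<open>1 / (8 * s)\<close>. So a coordinate costs at
  most \<open>c0\<close>, the remaining Gaussian integrates to 1, and the product of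
  \<open>s\<close> such costs stays bounded.\<close>

lemma ratio_int:
  assumes \<theta>: "0 \<le> \<theta>" "\<theta> \<le> 1"
  shows "(\<integral>\<^sup>+v. ennreal ((ar_dens u v)\<^sup>2 / prop_dens u v * exp (\<theta> * (h / 4 * (grad_sq v - grad_sq u)))) \<partial>lborel) \<le> ennreal (5 / 4)"
proof -
  define q \<omega> \<mu>' where "q b = 1 - h * l b / 2" and "\<omega> b = (2 - q b) / q b - \<theta> * (h * l b)\<^sup>2"
    and "\<mu>' b = (1 - h * l b) * (u \<bullet> b) + \<theta> * (h * l b)\<^sup>2 * (1 - h * l b) * (u \<bullet> b) / \<omega> b" for b
  define s :: real where "s = DIM('a)"
  have s1: "s \<ge> 1" using DIM_positive[where 'a='a] by (simp add: s_def)
  define c0 where "c0 = 1 / sqrt (1 - 1 / (8 * s))"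
  have r: "(normal_density ((1 - h * l b) * (u \<bullet> b)) (sqrt (2 * h * q b)) (v \<bullet> b))\<^sup>2
        / normal_density ((1 - h * l b) * (u \<bullet> b)) (sqrt (2 * h)) (v \<bullet> b)
        * exp (\<theta> * (h * (l b)\<^sup>2 / 4 * ((v \<bullet> b)\<^sup>2 - (u \<bullet> b)\<^sup>2)))
      \<le> 1 / (q b * sqrt (\<omega> b)) * normal_density (\<mu>' b) (sqrt (2 * h / \<omega> b)) (v \<bullet> b)"
    and c: "1 / (q b * sqrt (\<omega> b)) \<le> 1 / sqrt (1 - 5 * (h * l b)\<^sup>2 / 4)" and \<omega>: "\<omega> b > 0"
    if b: "b \<in> Basis" for b v
    using mala_ratio_coord(1)[OF h l[OF b] a_half[OF b] \<theta>, of "u \<bullet> b" "v \<bullet> b"]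
      mala_ratio_coord(2,3)[OF h l[OF b] a_half[OF b] \<theta>]
    unfolding q_def \<omega>_def \<mu>'_def by - assumption+
  have c': "1 / (q b * sqrt (\<omega> b)) \<le> c0" if b: "b \<in> Basis" for b
  proof -
    have "(h * l b)\<^sup>2 \<le> (1 / sqrt (10 * s))\<^sup>2" using up[OF b] a_pos[OF b] by (intro power_mono) (auto simp: s_def)
    also have "\<dots> = 1 / (10 * s)" using s1 by (simp add: power_divide)
    finally have "1 - 5 * (h * l b)\<^sup>2 / 4 \<ge> 1 - 1 / (8 * s)" by simp
    moreover have "1 - 1 / (8 * s) > 0" using s1 by simp
    ultimately have "1 / sqrt (1 - 5 * (h * l b)\<^sup>2 / 4) \<le> c0"
      unfolding c0_def by (intro divide_left_mono) auto
    then show ?thesis using c[OF b] by linarith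
  qed
  have q0: "q b > 0" if "b \<in> Basis" for b using a_half[OF that] by (simp add: q_def)
  have C: "(\<Prod>b\<in>(Basis::'a set). 1 / (q b * sqrt (\<omega> b))) \<le> 5 / 4"
  proof -
    have "(\<Prod>b\<in>(Basis::'a set). 1 / (q b * sqrt (\<omega> b))) \<le> (\<Prod>b\<in>(Basis::'a set). c0)"
      using c' q0 \<omega> by (intro prod_mono) (auto simp: less_imp_le)
    also have "\<dots> = c0 ^ DIM('a)" by simp
    also have "\<dots> \<le> 5 / 4"
    \<comment> \<open>Squaring removes the root in \<open>c0\<close>; Bernoulli's inequality then
      bounds the power by \<open>1 / (1 - 1/8) = 8/7\<close>, which is below
      \<open>25/16\<close>.\<close>
    proof (rule power2_le_imp_le)
      have p: "1 - 1 / (8 * s) > 0" using s1 by simp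
      have "(c0 ^ DIM('a))\<^sup>2 = (c0\<^sup>2) ^ DIM('a)" by (simp add: power_mult[symmetric] mult.commute)
      also have "c0\<^sup>2 = 1 / (1 - 1 / (8 * s))" using p by (simp add: c0_def power_divide)
      also have "(1 / (1 - 1 / (8 * s))) ^ DIM('a) = 1 / (1 + - (1 / (8 * s))) ^ DIM('a)" by (simp add: power_divide)
      also have "\<dots> \<le> 1 / (1 + real DIM('a) * - (1 / (8 * s)))"
      proof (rule divide_left_mono)
        show "1 + real DIM('a) * - (1 / (8 * s)) \<le> (1 + - (1 / (8 * s))) ^ DIM('a)"
          using s1 by (intro Bernoulli_inequality) auto
        show "0 < (1 + - (1 / (8 * s))) ^ DIM('a) * (1 + real DIM('a) * - (1 / (8 * s)))"
          using p s1 by (intro mult_pos_pos zero_less_power) (auto simp: s_def)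
      qed simp
      also have "\<dots> = 8 / 7" using s1 by (simp add: s_def)
      also have "\<dots> \<le> (5 / 4)\<^sup>2" by (simp add: power2_eq_square)
      finally show "(c0 ^ DIM('a))\<^sup>2 \<le> (5 / 4)\<^sup>2" .
    qed simp
    finally show ?thesis .
  qed
  have pw: "(ar_dens u v)\<^sup>2 / prop_dens u v * exp (\<theta> * (h / 4 * (grad_sq v - grad_sq u)))
     \<le> (\<Prod>b\<in>Basis. 1 / (q b * sqrt (\<omega> b))) * gauss_prod \<mu>' (\<lambda>b. sqrt (2 * h / \<omega> b)) v" for v
  proof -
    have ex: "exp (\<theta> * (h / 4 * (grad_sq v - grad_sq u))) = (\<Prod>b\<in>Basis. exp (\<theta> * (h * (l b)\<^sup>2 / 4 * ((v \<bullet> b)\<^sup>2 - (u \<bullet> b)\<^sup>2))))"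
      unfolding grad_sq_def sum_subtractf[symmetric] sum_distrib_left exp_sum[OF finite_Basis, symmetric]
      by (intro arg_cong[where f = exp] sum.cong refl) (simp add: algebra_simps)
    show ?thesis
      unfolding ex ar_dens_def prop_dens_def gauss_prod_def prod_power_distrib prod_dividef[symmetric] prod.distrib[symmetric]
    proof (rule prod_mono, rule conjI)
      fix b :: 'a assume b: "b \<in> Basis"
      show "0 \<le> (normal_density ((1 - h * l b) * (u \<bullet> b)) (sqrt (2 * h * (1 - h * l b / 2))) (v \<bullet> b))\<^sup>2
        / normal_density ((1 - h * l b) * (u \<bullet> b)) (sqrt (2 * h)) (v \<bullet> b)
        * exp (\<theta> * (h * (l b)\<^sup>2 / 4 * ((v \<bullet> b)\<^sup>2 - (u \<bullet> b)\<^sup>2)))" by simp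
    qed (use r in \<open>auto simp: q_def\<close>)
  qed
  have "(\<integral>\<^sup>+v. ennreal ((ar_dens u v)\<^sup>2 / prop_dens u v * exp (\<theta> * (h / 4 * (grad_sq v - grad_sq u)))) \<partial>lborel)
     \<le> (\<integral>\<^sup>+v. ennreal (\<Prod>b\<in>(Basis::'a set). 1 / (q b * sqrt (\<omega> b))) * ennreal (gauss_prod \<mu>' (\<lambda>b. sqrt (2 * h / \<omega> b)) v) \<partial>lborel)"
    using pw by (intro nn_integral_mono) (simp add: ennreal_mult''[symmetric] ennreal_leI)
  also have "\<dots> = ennreal (\<Prod>b\<in>(Basis::'a set). 1 / (q b * sqrt (\<omega> b)))"
    using h \<omega> by (subst nn_integral_cmult) (auto simp: nn_integral_gauss_prod)
  also have "\<dots> \<le> ennreal (5 / 4)" using C by (rule ennreal_leI)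
  finally show ?thesis .
qed

text \<open>Dividing by the acceptance probability costs a factor
  \<open>1 / min 1 (exp x) \<le> 1 + exp (- x)\<close>; the two summands are the cases \<theta> = 0
  and \<theta> = 1 of \<open>ratio_int\<close>.\<close>

lemma ar_dens_move_dens_int: "(\<integral>\<^sup>+v. ennreal ((ar_dens u v)\<^sup>2 / move_dens u v) \<partial>lborel) \<le> ennreal (5 / 2)"
proof -
  have pw: "(ar_dens u v)\<^sup>2 / move_dens u v \<le> (ar_dens u v)\<^sup>2 / prop_dens u v * exp (0 * (h / 4 * (grad_sq v - grad_sq u))) + (ar_dens u v)\<^sup>2 / prop_dens u v * exp (1 * (h / 4 * (grad_sq v - grad_sq u)))" for v
  proof -
    let ?x = "h / 4 * (grad_sq u - grad_sq v)"
    have "- ?x = h / 4 * (grad_sq v - grad_sq u)" by (simp add: algebra_simps)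
    moreover have "1 / min 1 (exp ?x) \<le> 1 + exp (- ?x)" by (simp add: min_def exp_minus field_simps)
    ultimately have "1 / min 1 (exp ?x) \<le> 1 + exp (h / 4 * (grad_sq v - grad_sq u))" by (simp only:)
    then have "(ar_dens u v)\<^sup>2 / prop_dens u v * (1 / min 1 (exp ?x)) \<le> (ar_dens u v)\<^sup>2 / prop_dens u v * (1 + exp (h / 4 * (grad_sq v - grad_sq u)))"
      using prop_dens_pos[of u v] by (intro mult_left_mono) auto
    then show ?thesis by (simp add: move_dens_def distrib_left)
  qed
  have "(\<integral>\<^sup>+v. ennreal ((ar_dens u v)\<^sup>2 / move_dens u v) \<partial>lborel)
     \<le> (\<integral>\<^sup>+v. ennreal ((ar_dens u v)\<^sup>2 / prop_dens u v * exp (0 * (h / 4 * (grad_sq v - grad_sq u)))) + ennreal ((ar_dens u v)\<^sup>2 / prop_dens u v * exp (1 * (h / 4 * (grad_sq v - grad_sq u)))) \<partial>lborel)"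
    using pw prop_dens_pos by (intro nn_integral_mono) (simp add: ennreal_plus[symmetric] less_imp_le ennreal_leI del: ennreal_plus)
  also have "\<dots> = (\<integral>\<^sup>+v. ennreal ((ar_dens u v)\<^sup>2 / prop_dens u v * exp (0 * (h / 4 * (grad_sq v - grad_sq u)))) \<partial>lborel) + (\<integral>\<^sup>+v. ennreal ((ar_dens u v)\<^sup>2 / prop_dens u v * exp (1 * (h / 4 * (grad_sq v - grad_sq u)))) \<partial>lborel)"
    by (rule nn_integral_add) measurable
  also have "\<dots> \<le> ennreal (5 / 4) + ennreal (5 / 4)" by (intro add_mono ratio_int) auto
  also have "\<dots> = ennreal (5 / 2)" by (subst ennreal_plus[symmetric]) auto
  finally show ?thesis .
qed

definition drift :: "'a \<Rightarrow> 'a" where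
  "drift u = (\<Sum>b\<in>Basis. ((1 - h * l b) * (u \<bullet> b)) *\<^sub>R b)"

lemma drift_inner: "b \<in> Basis \<Longrightarrow> drift u \<bullet> b = (1 - h * l b) * (u \<bullet> b)"
  unfolding drift_def by simp

lemma drift_meas[measurable]: "drift \<in> borel_measurable borel"
  unfolding drift_def by measurable

lemma ar_dens_shift: "ar_dens u (drift u + w) = gauss_prod (\<lambda>_. 0) (\<lambda>b. sqrt (2 * h * (1 - h * l b / 2))) w"
  unfolding ar_dens_def gauss_prod_def normal_density_def by (intro prod.cong) (auto simp: inner_add_left drift_inner)

text \<open>Every coordinate factor \<open>1 - h * l b\<close> lies between \<open>1/2\<close> and
  the stated rate, by \<open>a_half\<close> and \<open>low\<close>.\<close>

lemma drift_contraction: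
  "norm (drift u - drift v) \<le> (1 - 1 / (2 * sqrt (10 * DIM('a)))) * norm (u - v)"
proof -
  let ?r = "1 - 1 / (2 * sqrt (10 * DIM('a)))"
  have r0: "0 \<le> ?r"
  proof -
    obtain b :: 'a where b: "b \<in> Basis" using nonempty_Basis by blast
    show ?thesis using low[OF b] a_half[OF b] by linarith
  qed
  have "norm (drift u - drift v) = L2_set (\<lambda>b. (drift u - drift v) \<bullet> b) Basis" by (rule norm_L2_set_Basis)
  also have "\<dots> \<le> L2_set (\<lambda>b. ?r * ((u - v) \<bullet> b)) Basis"
    unfolding L2_set_def
  proof (intro real_sqrt_le_mono sum_mono)
    fix b :: 'a assume b: "b \<in> Basis"
    have "\<bar>(drift u - drift v) \<bullet> b\<bar> = \<bar>1 - h * l b\<bar> * \<bar>(u - v) \<bullet> b\<bar>"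
      using b by (simp add: inner_diff_left drift_inner abs_mult[symmetric] algebra_simps)
    also have "\<dots> \<le> ?r * \<bar>(u - v) \<bullet> b\<bar>"
      using low[OF b] a_half[OF b] by (intro mult_right_mono) auto
    also have "\<dots> = \<bar>?r * ((u - v) \<bullet> b)\<bar>" using r0 by (simp add: abs_mult)
    finally show "((drift u - drift v) \<bullet> b)\<^sup>2 \<le> (?r * ((u - v) \<bullet> b))\<^sup>2" by (simp add: abs_le_square_iff)
  qed
  also have "\<dots> = ?r * L2_set (\<lambda>b. (u - v) \<bullet> b) Basis" using r0 by (rule L2_set_right_distrib[symmetric])
  also have "L2_set (\<lambda>b. (u - v) \<bullet> b) Basis = norm (u - v)" by (rule norm_L2_set_Basis[symmetric])
  finally show ?thesis .
qed

definition m where "m = density lborel (\<lambda>u. ennreal (target_dens u))"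
definition \<nu> where "\<nu> = density lborel (\<lambda>w. ennreal (gauss_prod (\<lambda>_. 0) (\<lambda>b. sqrt (2 * h * (1 - h * l b / 2))) w))"

lemma sets_m[measurable_cong]: "sets m = sets borel" and sets_\<nu>[measurable_cong]: "sets \<nu> = sets borel"
  by (simp_all add: m_def \<nu>_def)

lemma nu_int:
  assumes [measurable]: "F \<in> borel_measurable borel"
  shows "(\<integral>\<^sup>+w. F (drift u + w) \<partial>\<nu>) = (\<integral>\<^sup>+v. ennreal (ar_dens u v) * F v \<partial>lborel)"
proof -
  have "(\<integral>\<^sup>+w. F (drift u + w) \<partial>\<nu>) = (\<integral>\<^sup>+w. ennreal (ar_dens u (drift u + w)) * F (drift u + w) \<partial>lborel)"
    unfolding \<nu>_def by (subst nn_integral_density) (auto simp: ar_dens_shift)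
  also have "\<dots> = (\<integral>\<^sup>+v. ennreal (ar_dens u v) * F v \<partial>lborel)"
    by (rule nn_integral_lborel_shift) (simp add: ar_dens_def)
  finally show ?thesis .
qed

lemma prob_m: "prob_space m"
  unfolding m_def target_dens_def using l by (intro prob_space_gauss_prod) simp

lemma m_int:
  assumes [measurable]: "F \<in> borel_measurable borel"
  shows "(\<integral>\<^sup>+u. F u \<partial>m) = (\<integral>\<^sup>+u. ennreal (target_dens u) * F u \<partial>lborel)"
  unfolding m_def by (simp add: nn_integral_density)

lemma random_map_ar_dens: "random_map m \<nu> (\<lambda>u w. drift u + w)"
proof -
  interpret m: prob_space m by (rule prob_m)
  interpret \<nu>: prob_space \<nu>
    unfolding \<nu>_def using h a_half by (intro prob_space_gauss_prod) fastforce
  show ?thesis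
  proof
    show "sets m = sets borel" by (rule sets_m)
    show "(\<lambda>(u, w). drift u + w) \<in> borel \<Otimes>\<^sub>M \<nu> \<rightarrow>\<^sub>M borel" by measurable
    fix F :: "'a \<times> 'a \<Rightarrow> ennreal" assume [measurable]: "F \<in> borel_measurable (borel \<Otimes>\<^sub>M borel)"
    have "(\<integral>\<^sup>+x. \<integral>\<^sup>+w. F (x, drift x + w) \<partial>\<nu> \<partial>m) = (\<integral>\<^sup>+x. \<integral>\<^sup>+y. ennreal (ar_dens x y) * F (x, y) \<partial>lborel \<partial>m)"
      by (intro nn_integral_cong nu_int) measurable
    also have "\<dots> = (\<integral>\<^sup>+x. ennreal (target_dens x) * (\<integral>\<^sup>+y. ennreal (ar_dens x y) * F (x, y) \<partial>lborel) \<partial>lborel)"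
      by (rule m_int) measurable
    also have "\<dots> = (\<integral>\<^sup>+x. \<integral>\<^sup>+y. ennreal (target_dens x * ar_dens x y) * F (x, y) \<partial>lborel \<partial>lborel)"
      by (intro nn_integral_cong) (simp add: nn_integral_cmult[symmetric] ennreal_mult' mult.assoc)
    also have "\<dots> = (\<integral>\<^sup>+y. \<integral>\<^sup>+x. ennreal (target_dens x * ar_dens x y) * F (x, y) \<partial>lborel \<partial>lborel)"
      by (rule lborel_pair.Fubini') measurable
    also have "\<dots> = (\<integral>\<^sup>+y. \<integral>\<^sup>+x. ennreal (target_dens y * ar_dens y x) * F (x, y) \<partial>lborel \<partial>lborel)"
      by (simp only: target_dens_ar_dens_sym)
    also have "\<dots> = (\<integral>\<^sup>+y. ennreal (target_dens y) * (\<integral>\<^sup>+x. ennreal (ar_dens y x) * F (x, y) \<partial>lborel) \<partial>lborel)"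
      by (intro nn_integral_cong) (simp add: nn_integral_cmult[symmetric] ennreal_mult' mult.assoc)
    also have "\<dots> = (\<integral>\<^sup>+y. \<integral>\<^sup>+x. ennreal (ar_dens y x) * F (x, y) \<partial>lborel \<partial>m)"
      by (rule m_int[symmetric]) measurable
    also have "\<dots> = (\<integral>\<^sup>+x. \<integral>\<^sup>+w. F (drift x + w, x) \<partial>\<nu> \<partial>m)"
      by (intro nn_integral_cong nu_int[symmetric]) measurable
    finally show "(\<integral>\<^sup>+x. \<integral>\<^sup>+w. F (x, drift x + w) \<partial>\<nu> \<partial>m) = (\<integral>\<^sup>+x. \<integral>\<^sup>+w. F (drift x + w, x) \<partial>\<nu> \<partial>m)" .
  qed
qed

text \<open>Let \<eta> be \<open>1 / sqrt (10 * s)\<close>. The gap of the autoregression gives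
  \<open>\<eta> * V \<le> D\<close>, and the comparison gives
  \<open>D \<le> c * Dk + 10 * V / c\<close>. With \<open>c\<close> of order
  \<open>1 / \<eta>\<close> the last term is absorbed, leaving a bound on \<open>V\<close> of order
  \<open>Dk / \<eta>^2\<close>, that is \<open>s * Dk\<close>.\<close>

theorem fibre_gap:
  assumes g: "bdd_lipschitz g"
  shows "(\<integral>\<^sup>+u. \<integral>\<^sup>+v. ennreal (target_dens u * target_dens v * (g u - g v)\<^sup>2) \<partial>lborel \<partial>lborel)
    \<le> ennreal (960 * DIM('a)) * (\<integral>\<^sup>+u. \<integral>\<^sup>+v. ennreal (target_dens u * move_dens u v * (g u - g v)\<^sup>2) \<partial>lborel \<partial>lborel)"
proof -
  define s :: real where "s = DIM('a)"
  define \<eta> where "\<eta> = 1 / sqrt (10 * s)"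
  have s1: "s \<ge> 1" using DIM_positive[where 'a='a] by (simp add: s_def)
  have \<eta>: "\<eta> > 0" "\<eta>\<^sup>2 = 1 / (10 * s)" using s1 by (auto simp: \<eta>_def power_divide)
  note [measurable] = bdd_lipschitz_measurable[OF g]
  obtain C where C: "\<And>x. \<bar>g x\<bar> \<le> C" using g by (auto simp: bdd_lipschitz_def)
  interpret m: prob_space m by (rule prob_m)
  interpret R: random_map m \<nu> "\<lambda>u w. drift u + w" by (rule random_map_ar_dens)
  define D where "D = (\<integral>\<^sup>+u. \<integral>\<^sup>+v. ennreal (target_dens u * ar_dens u v * (g u - g v)\<^sup>2) \<partial>lborel \<partial>lborel)"
  define Dk where "Dk = (\<integral>\<^sup>+u. \<integral>\<^sup>+v. ennreal (target_dens u * move_dens u v * (g u - g v)\<^sup>2) \<partial>lborel \<partial>lborel)"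
  define V where "V = (\<integral>x. (g x - m.expectation g)\<^sup>2 \<partial>m)"
  have V0: "V \<ge> 0" by (simp add: V_def)
  have X: "(\<integral>\<^sup>+u. \<integral>\<^sup>+v. ennreal ((g u - g v)\<^sup>2) \<partial>m \<partial>m) = ennreal (2 * V)"
    unfolding V_def using C by (intro m.nn_integral_pair_diff_sq) auto
  have X': "(\<integral>\<^sup>+u. \<integral>\<^sup>+v. ennreal (target_dens u * target_dens v * (g u - g v)\<^sup>2) \<partial>lborel \<partial>lborel) = ennreal (2 * V)"
    unfolding X[symmetric]
    by (simp add: m_int nn_integral_cmult[symmetric] ennreal_mult' mult.assoc)
  have one: "ennreal (\<eta> / 2) * ennreal (2 * V) \<le> D"
  proof -
    have "ennreal (1 - (1 - \<eta> / 2)) * (\<integral>\<^sup>+u. \<integral>\<^sup>+v. ennreal ((g u - g v)\<^sup>2) \<partial>m \<partial>m)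
       \<le> (\<integral>\<^sup>+u. \<integral>\<^sup>+w. ennreal ((g u - g (drift u + w))\<^sup>2) \<partial>\<nu> \<partial>m)"
    proof (rule R.contraction_gap[where nn = norm and c = 1])
      have "\<eta> \<le> 1" unfolding \<eta>_def using s1 by simp
      then show "0 < 1 - \<eta> / 2" "1 - \<eta> / 2 \<le> 1" using \<eta> by auto
      \<comment> \<open>The noise is additive and shared, so it cancels and the distance after one
        step is deterministic.\<close>
      show "(\<integral>\<^sup>+w. ennreal (norm ((drift x + w) - (drift y + w))) \<partial>\<nu>) \<le> ennreal ((1 - \<eta> / 2) * norm (x - y))" for x y
      proof -
        have "(\<integral>\<^sup>+w. ennreal (norm ((drift x + w) - (drift y + w))) \<partial>\<nu>) = ennreal (norm (drift x - drift y))"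
          using R.\<nu>.emeasure_space_1 by simp
        also have "\<dots> \<le> ennreal ((1 - 1 / (2 * sqrt (10 * DIM('a)))) * norm (x - y))"
          by (rule ennreal_leI[OF drift_contraction])
        also have "1 / (2 * sqrt (10 * DIM('a))) = \<eta> / 2" by (simp add: \<eta>_def s_def)
        finally show ?thesis .
      qed
      show "(\<integral>\<^sup>+x. \<integral>\<^sup>+y. ennreal (norm (x - y)) \<partial>m \<partial>m) < \<infinity>"
      proof -
        have mom: "(\<integral>\<^sup>+x. ennreal (norm x) \<partial>m) < \<infinity>"
          unfolding m_int[of "\<lambda>x. ennreal (norm x)", simplified]
          using gauss_prod_norm_moment[of "\<lambda>b. 1 / sqrt (l b)"] l
          by (simp add: target_dens_def ennreal_mult'[symmetric] mult.commute)
        have "(\<integral>\<^sup>+x. \<integral>\<^sup>+y. ennreal (norm (x - y)) \<partial>m \<partial>m) \<le> (\<integral>\<^sup>+x. \<integral>\<^sup>+y. ennreal (norm x) + ennreal (norm y) \<partial>m \<partial>m)"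
          by (intro nn_integral_mono) (auto simp: ennreal_plus[symmetric] norm_triangle_ineq4 simp del: ennreal_plus intro!: ennreal_leI)
        also have "\<dots> = (\<integral>\<^sup>+x. ennreal (norm x) \<partial>m) + (\<integral>\<^sup>+x. ennreal (norm x) \<partial>m)"
          by (simp add: nn_integral_add m.emeasure_space_1)
        also have "\<dots> < \<infinity>" using mom by simp
        finally show ?thesis .
      qed
    qed (use g in auto)
    also have "\<dots> = (\<integral>\<^sup>+u. \<integral>\<^sup>+v. ennreal (ar_dens u v) * ennreal ((g u - g v)\<^sup>2) \<partial>lborel \<partial>m)"
      by (intro nn_integral_cong nu_int) measurable
    also have "\<dots> = D"
      unfolding D_def
    proof (subst m_int)
      have "ennreal (target_dens u) * (\<integral>\<^sup>+v. ennreal (ar_dens u v) * ennreal ((g u - g v)\<^sup>2) \<partial>lborel)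
          = (\<integral>\<^sup>+v. ennreal (target_dens u * ar_dens u v * (g u - g v)\<^sup>2) \<partial>lborel)" for u
        by (subst nn_integral_cmult[symmetric]) (auto simp: ennreal_mult less_imp_le[OF ar_dens_pos] mult.assoc)
      then show "(\<integral>\<^sup>+u. ennreal (target_dens u) * (\<integral>\<^sup>+v. ennreal (ar_dens u v) * ennreal ((g u - g v)\<^sup>2) \<partial>lborel) \<partial>lborel)
          = (\<integral>\<^sup>+u. \<integral>\<^sup>+v. ennreal (target_dens u * ar_dens u v * (g u - g v)\<^sup>2) \<partial>lborel \<partial>lborel)" by simp
    qed measurable
    finally show ?thesis by (simp add: X)
  qed
  \<comment> \<open>Then \<open>10 * V / c\<close> is \<open>10/24\<close> of
    \<open>\<eta> * V\<close>, and \<open>14/24\<close> of it remains on the left after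
    absorption.\<close>
  define c where "c = 24 / \<eta>"
  have c: "c > 0" using \<eta> by (simp add: c_def)
  \<comment> \<open>The target weight times the squared autoregressive density over the move
    density. It is symmetric because both kernels are in detailed balance with the target, so the
    terms with \<open>f u\<close> and \<open>f v\<close> have equal integrals.\<close>
  define S where "S u v = target_dens u * ((ar_dens u v)\<^sup>2 / move_dens u v)" for u v
  have S0: "S u v \<ge> 0" for u v using move_dens_pos[of u v] by (simp add: S_def)
  have S_sym: "S u v = S v u" for u v
  proof -
    have "S u v = (target_dens u * ar_dens u v)\<^sup>2 / (target_dens u * move_dens u v)" for u v
      using target_dens_pos[of u] by (simp add: S_def power2_eq_square)
    then show ?thesis using target_dens_ar_dens_sym target_dens_move_dens_sym by metis
  qed
  have [measurable]: "case_prod S \<in> borel_measurable (borel \<Otimes>\<^sub>M borel)" unfolding S_def by measurable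
  define f where "f u = g u - m.expectation g" for u
  have [measurable]: "f \<in> borel_measurable borel" unfolding f_def by measurable
  have S_int: "(\<integral>\<^sup>+u. \<integral>\<^sup>+v. ennreal (S u v * (f u)\<^sup>2) \<partial>lborel \<partial>lborel) \<le> ennreal (5 / 2 * V)"
  proof -
    have "(\<integral>\<^sup>+u. \<integral>\<^sup>+v. ennreal (S u v * (f u)\<^sup>2) \<partial>lborel \<partial>lborel)
       = (\<integral>\<^sup>+u. ennreal (target_dens u * (f u)\<^sup>2) * (\<integral>\<^sup>+v. ennreal ((ar_dens u v)\<^sup>2 / move_dens u v) \<partial>lborel) \<partial>lborel)"
      by (intro nn_integral_cong) (simp add: nn_integral_cmult[symmetric] S_def ennreal_mult'[symmetric] mult_ac)
    also have "\<dots> \<le> (\<integral>\<^sup>+u. ennreal (target_dens u * (f u)\<^sup>2) * ennreal (5 / 2) \<partial>lborel)"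
      by (intro nn_integral_mono mult_left_mono ar_dens_move_dens_int) auto
    also have "\<dots> = (\<integral>\<^sup>+u. ennreal ((f u)\<^sup>2) \<partial>m) * ennreal (5 / 2)"
      by (simp add: nn_integral_multc m_int ennreal_mult')
    also have "(\<integral>\<^sup>+u. ennreal ((f u)\<^sup>2) \<partial>m) = ennreal V"
    proof -
      have "(f u)\<^sup>2 \<le> (C + \<bar>m.expectation g\<bar>)\<^sup>2" for u
        using C[of u] by (intro power2_le_iff_abs_le[THEN iffD2]) (auto simp: f_def)
      then show ?thesis unfolding V_def f_def[symmetric]
        by (intro nn_integral_eq_integral m.integrable_const_bound[where B = "(C + \<bar>m.expectation g\<bar>)\<^sup>2"]) auto
    qed
    finally show ?thesis using V0 by (simp add: ennreal_mult'[symmetric] mult.commute)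
  qed
  have two: "D \<le> ennreal c * Dk + ennreal (10 * V / c)"
  proof -
    have pw: "target_dens u * ar_dens u v * (g u - g v)\<^sup>2
      \<le> c * (target_dens u * move_dens u v * (g u - g v)\<^sup>2) + (2 / c) * (S u v * (f u)\<^sup>2) + (2 / c) * (S v u * (f v)\<^sup>2)" for u v
    proof -
      have k: "move_dens u v > 0" by (rule move_dens_pos)
      define X where "X = c * move_dens u v"
      have X: "X > 0" using c k by (simp add: X_def)
      have "2 * X * ar_dens u v \<le> X\<^sup>2 + (ar_dens u v)\<^sup>2" by (rule sum_squares_bound)
      moreover have "X * ar_dens u v \<ge> 0" using X ar_dens_pos[of u v] by simp
      ultimately have "X * ar_dens u v \<le> X\<^sup>2 + (ar_dens u v)\<^sup>2" by linarith
      then have "ar_dens u v * X \<le> X * X + (ar_dens u v)\<^sup>2" by (simp add: power2_eq_square mult.commute)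
      then have "ar_dens u v \<le> (X * X + (ar_dens u v)\<^sup>2) / X" using X by (simp add: pos_le_divide_eq)
      also have "\<dots> = X + (ar_dens u v)\<^sup>2 / X" using X by (simp add: add_divide_distrib)
      finally have "ar_dens u v \<le> c * move_dens u v + (ar_dens u v)\<^sup>2 / (c * move_dens u v)" unfolding X_def .
      then have "target_dens u * (g u - g v)\<^sup>2 * ar_dens u v \<le> target_dens u * (g u - g v)\<^sup>2 * (c * move_dens u v + (ar_dens u v)\<^sup>2 / (c * move_dens u v))"
        by (intro mult_left_mono) auto
      also have "\<dots> = c * (target_dens u * move_dens u v * (g u - g v)\<^sup>2) + (1 / c) * S u v * (g u - g v)\<^sup>2"
        using c k by (simp add: S_def field_simps)
      also have "(1 / c) * S u v * (g u - g v)\<^sup>2 \<le> (1 / c) * S u v * (2 * (f u)\<^sup>2 + 2 * (f v)\<^sup>2)"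
      proof (rule mult_left_mono)
        have "(g u - g v)\<^sup>2 = (f u - f v)\<^sup>2" by (simp add: f_def)
        then show "(g u - g v)\<^sup>2 \<le> 2 * (f u)\<^sup>2 + 2 * (f v)\<^sup>2"
          using sum_squares_bound[of "f u" "- f v"] by (simp add: power2_diff)
      qed (use c S0 in auto)
      also have "\<dots> = (2 / c) * (S u v * (f u)\<^sup>2) + (2 / c) * (S v u * (f v)\<^sup>2)"
        by (simp add: S_sym[of v u] algebra_simps)
      finally show ?thesis by (simp add: mult_ac)
    qed
    have "D \<le> (\<integral>\<^sup>+u. \<integral>\<^sup>+v. ennreal c * ennreal (target_dens u * move_dens u v * (g u - g v)\<^sup>2)
        + (ennreal (2 / c) * ennreal (S u v * (f u)\<^sup>2) + ennreal (2 / c) * ennreal (S v u * (f v)\<^sup>2)) \<partial>lborel \<partial>lborel)"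
      unfolding D_def
    proof (intro nn_integral_mono)
      fix u v
      show "ennreal (target_dens u * ar_dens u v * (g u - g v)\<^sup>2) \<le> ennreal c * ennreal (target_dens u * move_dens u v * (g u - g v)\<^sup>2)
        + (ennreal (2 / c) * ennreal (S u v * (f u)\<^sup>2) + ennreal (2 / c) * ennreal (S v u * (f v)\<^sup>2))"
      proof -
        have "ennreal c * ennreal A + (ennreal (2 / c) * ennreal B + ennreal (2 / c) * ennreal B') = ennreal (c * A + 2 / c * B + 2 / c * B')"
          if "A \<ge> 0" "B \<ge> 0" "B' \<ge> 0" for A B B'
          using that c by (simp add: ennreal_mult'[symmetric] ennreal_plus[symmetric] add.assoc del: ennreal_plus)
        then show ?thesis using ennreal_leI[OF pw[of u v]] S0 move_dens_pos[of u v] by (simp add: less_imp_le)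
      qed
    qed
    also have "\<dots> = (\<integral>\<^sup>+u. ennreal c * (\<integral>\<^sup>+v. ennreal (target_dens u * move_dens u v * (g u - g v)\<^sup>2) \<partial>lborel)
        + (ennreal (2 / c) * (\<integral>\<^sup>+v. ennreal (S u v * (f u)\<^sup>2) \<partial>lborel) + ennreal (2 / c) * (\<integral>\<^sup>+v. ennreal (S v u * (f v)\<^sup>2) \<partial>lborel)) \<partial>lborel)"
      by (intro nn_integral_cong) (simp add: nn_integral_add nn_integral_cmult)
    also have "\<dots> = ennreal c * Dk + (ennreal (2 / c) * (\<integral>\<^sup>+u. \<integral>\<^sup>+v. ennreal (S u v * (f u)\<^sup>2) \<partial>lborel \<partial>lborel)
        + ennreal (2 / c) * (\<integral>\<^sup>+u. \<integral>\<^sup>+v. ennreal (S v u * (f v)\<^sup>2) \<partial>lborel \<partial>lborel))"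
      unfolding Dk_def by (simp add: nn_integral_add nn_integral_cmult)
    also have "(\<integral>\<^sup>+u. \<integral>\<^sup>+v. ennreal (S v u * (f v)\<^sup>2) \<partial>lborel \<partial>lborel) = (\<integral>\<^sup>+u. \<integral>\<^sup>+v. ennreal (S u v * (f u)\<^sup>2) \<partial>lborel \<partial>lborel)"
      by (rule lborel_pair.Fubini') measurable
    also have "ennreal c * Dk + (ennreal (2 / c) * (\<integral>\<^sup>+u. \<integral>\<^sup>+v. ennreal (S u v * (f u)\<^sup>2) \<partial>lborel \<partial>lborel)
        + ennreal (2 / c) * (\<integral>\<^sup>+u. \<integral>\<^sup>+v. ennreal (S u v * (f u)\<^sup>2) \<partial>lborel \<partial>lborel))
      \<le> ennreal c * Dk + (ennreal (2 / c) * ennreal (5 / 2 * V) + ennreal (2 / c) * ennreal (5 / 2 * V))"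
      by (intro add_mono mult_left_mono S_int order_refl) auto
    also have "\<dots> = ennreal c * Dk + ennreal (10 * V / c)"
      using c V0 by (simp add: ennreal_mult'[symmetric] ennreal_plus[symmetric] del: ennreal_plus)
    finally show ?thesis .
  qed
  have fin: "ennreal (2 * V) \<le> ennreal (960 * s) * Dk"
  proof (cases Dk)
    case (real t)
    have "ennreal (\<eta> / 2 * (2 * V)) \<le> ennreal (c * t + 10 * V / c)"
      using order_trans[OF one two] real c \<eta> V0 by (simp add: ennreal_mult'[symmetric] ennreal_plus[symmetric] del: ennreal_plus)
    then have "\<eta> * V \<le> c * t + 10 * V / c"
      using real c V0 by (subst (asm) ennreal_le_iff) auto
    then have "\<eta> * V \<le> 24 / \<eta> * t + 10 / 24 * (\<eta> * V)" unfolding c_def using \<eta> by (simp add: mult_ac)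
    then have "\<eta> * (\<eta> * V) \<le> \<eta> * (24 / \<eta> * t * (24 / 14))" using \<eta> by (intro mult_left_mono) auto
    then have "\<eta>\<^sup>2 * V \<le> 24 * 24 / 14 * t" using \<eta>(1) by (simp add: power2_eq_square)
    then have "V \<le> 10 * s * (24 * 24 / 14 * t)" using s1 unfolding \<eta>(2) by (simp add: field_simps)
    \<comment> \<open>\<open>24 * 24 / 14 \<le> 48\<close>; with
      \<open>1 / \<eta>^2 = 10 * s\<close> and the factor 2 of the variance this gives 960.\<close>
    also have "\<dots> \<le> 10 * s * (48 * t)" using s1 real by (intro mult_left_mono) auto
    finally have "2 * V \<le> 960 * s * t" by simp
    then show ?thesis using real s1 by (simp add: ennreal_mult'[symmetric] ennreal_leI)
  next
    case top
    then show ?thesis using s1 by (simp add: ennreal_mult_top)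
  qed
  then show ?thesis unfolding X' Dk_def s_def by simp
qed

end

section \<open>Integration along blocks\<close>

text \<open>The adjoint of \<open>\<lambda>x. block x j\<close>. Through it a block update becomes a
  translation, to which the invariance of Lebesgue measure applies.\<close>

definition emb :: "'d::finite \<Rightarrow> real ^ 's::finite \<Rightarrow> real ^ ('d \<times> 's)" where
  "emb j z = (\<chi> i. if fst i = j then z $ snd i else 0)"

lemma block_upd_eq: "block_upd x j z = x + emb j (z - block x j)"
  by (auto simp: vec_eq_iff block_upd_def emb_def block_def)

lemma block_add: "block (x + y) j = block x j + block y j"
  and block_diff: "block (x - y) j = block x j - block y j"
  and block_minus: "block (- x) j = - block x j"
  and block_scaleR: "block (c *\<^sub>R x) j = c *\<^sub>R block x j"
  by (auto simp: vec_eq_iff block_def)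

lemma block_emb: "block (emb j z) j = z"
  by (auto simp: vec_eq_iff block_def emb_def)

lemma emb_add: "emb j (y + z) = emb j y + emb j z"
  and emb_diff: "emb j (y - z) = emb j y - emb j z"
  and emb_minus: "emb j (- z) = - emb j z"
  and emb_scaleR: "emb j (c *\<^sub>R z) = c *\<^sub>R emb j z"
  by (auto simp: vec_eq_iff emb_def)

lemma block_block_upd: "block (block_upd x j z) j = z"
  by (auto simp: vec_eq_iff block_def block_upd_def)

lemma block_upd_block_upd: "block_upd (block_upd x j z) j z' = block_upd x j z'"
  by (auto simp: vec_eq_iff block_upd_def)

lemma block_upd_block: "block_upd x j (block x j) = x"
  by (auto simp: vec_eq_iff block_def block_upd_def)

lemma linear_block: "linear (\<lambda>x. block x j)"
  by (rule linearI) (auto simp: block_add block_scaleR)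

lemma linear_emb: "linear (emb j)"
  by (rule linearI) (auto simp: emb_add emb_scaleR)

lemma linear_borel_measurable: "linear f \<Longrightarrow> f \<in> borel_measurable borel"
  for f :: "'a::euclidean_space \<Rightarrow> 'b::euclidean_space"
  by (intro borel_measurable_continuous_onI linear_continuous_on) (simp add: linear_conv_bounded_linear)

lemma block_measurable[measurable (raw)]: "f \<in> borel_measurable M \<Longrightarrow> (\<lambda>x. block (f x) j) \<in> borel_measurable M"
  by (rule measurable_compose[OF _ linear_borel_measurable[OF linear_block]])

lemma emb_measurable[measurable (raw)]: "f \<in> borel_measurable M \<Longrightarrow> (\<lambda>x. emb j (f x)) \<in> borel_measurable M"
  by (rule measurable_compose[OF _ linear_borel_measurable[OF linear_emb]])

lemma block_upd_measurable[measurable (raw)]: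
  "f \<in> borel_measurable M \<Longrightarrow> g \<in> borel_measurable M \<Longrightarrow> (\<lambda>x. block_upd (f x) j (g x)) \<in> borel_measurable M"
  unfolding block_upd_eq
  by (intro borel_measurable_add borel_measurable_diff emb_measurable block_measurable)

lemma inner_emb: "emb j z \<bullet> x = z \<bullet> block x j"
proof -
  have "emb j z \<bullet> x = (\<Sum>i\<in>UNIV \<times> UNIV. emb j z $ i * x $ i)" by (simp add: inner_vec_def)
  also have "\<dots> = (\<Sum>k\<in>UNIV. \<Sum>a\<in>UNIV. emb j z $ (k, a) * x $ (k, a))" by (simp add: sum.cartesian_product split_beta)
  also have "\<dots> = (\<Sum>k\<in>UNIV. if k = j then \<Sum>a\<in>UNIV. z $ a * x $ (j, a) else 0)"
    by (intro sum.cong) (auto simp: emb_def)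
  also have "\<dots> = z \<bullet> block x j" by (simp add: inner_vec_def block_def)
  finally show ?thesis .
qed

lemma norm_emb: "norm (emb j z) = norm z"
  by (simp add: norm_eq_sqrt_inner inner_emb block_emb)

lemma dist_block_upd: "dist (block_upd x j z) (block_upd x j z') = dist z z'"
  by (simp add: block_upd_eq dist_norm emb_diff[symmetric] norm_emb)

lemma inner_eq_sum_block: "x \<bullet> y = (\<Sum>j\<in>UNIV. block x j \<bullet> block y j)"
proof -
  have "x \<bullet> y = (\<Sum>i\<in>UNIV \<times> UNIV. x $ i * y $ i)" by (simp add: inner_vec_def)
  also have "\<dots> = (\<Sum>k\<in>UNIV. \<Sum>a\<in>UNIV. x $ (k, a) * y $ (k, a))" by (simp add: sum.cartesian_product split_beta)
  finally show ?thesis by (simp add: inner_vec_def block_def)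
qed

text \<open>The exchange of the current block with the proposed one preserves Lebesgue measure on
  pairs: in the variable \<open>w = z - block x j\<close> it consists of a translation of
  \<open>x\<close> along the block and the reflection of \<open>w\<close>.\<close>

lemma nn_integral_block_swap:
  fixes F :: "real ^ ('d::finite \<times> 's::finite) \<Rightarrow> real ^ 's \<Rightarrow> ennreal"
  assumes [measurable]: "case_prod F \<in> borel_measurable (borel \<Otimes>\<^sub>M borel)"
  shows "(\<integral>\<^sup>+x. \<integral>\<^sup>+z. F x z \<partial>lborel \<partial>lborel) = (\<integral>\<^sup>+x. \<integral>\<^sup>+z. F (block_upd x j z) (block x j) \<partial>lborel \<partial>lborel)"
proof -
  have "(\<integral>\<^sup>+x. \<integral>\<^sup>+z. F x z \<partial>lborel \<partial>lborel) = (\<integral>\<^sup>+x. \<integral>\<^sup>+w. F x (block x j + w) \<partial>lborel \<partial>lborel)"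
    by (intro nn_integral_cong nn_integral_lborel_shift[symmetric]) measurable
  also have "\<dots> = (\<integral>\<^sup>+w. \<integral>\<^sup>+x. F x (block x j + w) \<partial>lborel \<partial>lborel)"
    by (rule lborel_pair.Fubini') measurable
  also have "\<dots> = (\<integral>\<^sup>+w. \<integral>\<^sup>+x. F (- emb j w + x) (block (- emb j w + x) j + w) \<partial>lborel \<partial>lborel)"
    by (intro nn_integral_cong nn_integral_lborel_shift[symmetric]) measurable
  also have "\<dots> = (\<integral>\<^sup>+w. \<integral>\<^sup>+x. F (- emb j w + x) (block x j) \<partial>lborel \<partial>lborel)"
    by (simp add: block_add block_diff block_minus block_emb)
  also have "\<dots> = (\<integral>\<^sup>+w. \<integral>\<^sup>+x. F (- emb j (- w) + x) (block x j) \<partial>lborel \<partial>lborel)"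
    by (intro nn_integral_lborel_uminus[symmetric]) measurable
  also have "\<dots> = (\<integral>\<^sup>+w. \<integral>\<^sup>+x. F (x + emb j w) (block x j) \<partial>lborel \<partial>lborel)"
    by (simp add: emb_minus add.commute)
  also have "\<dots> = (\<integral>\<^sup>+x. \<integral>\<^sup>+w. F (x + emb j w) (block x j) \<partial>lborel \<partial>lborel)"
    by (rule lborel_pair.Fubini') measurable
  also have "\<dots> = (\<integral>\<^sup>+x. \<integral>\<^sup>+w. F (x + emb j (- block x j + w)) (block x j) \<partial>lborel \<partial>lborel)"
    by (intro nn_integral_cong nn_integral_lborel_shift[symmetric]) measurable
  finally show ?thesis by (simp add: block_upd_eq)
qed

text \<open>Weighting the current block by an arbitrary probability density \<open>\<phi>\<close> replaces a product
  decomposition of Lebesgue measure into the block and its complement.\<close>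

lemma nn_integral_block_average:
  fixes G :: "real ^ ('d::finite \<times> 's::finite) \<Rightarrow> ennreal" and \<phi> :: "real ^ 's \<Rightarrow> ennreal"
  assumes [measurable]: "G \<in> borel_measurable borel" "\<phi> \<in> borel_measurable borel"
    and \<phi>: "(\<integral>\<^sup>+z. \<phi> z \<partial>lborel) = 1"
  shows "(\<integral>\<^sup>+x. G x \<partial>lborel) = (\<integral>\<^sup>+x. \<phi> (block x j) * (\<integral>\<^sup>+u. G (block_upd x j u) \<partial>lborel) \<partial>lborel)"
proof -
  have "(\<integral>\<^sup>+x. \<phi> (block x j) * (\<integral>\<^sup>+u. G (block_upd x j u) \<partial>lborel) \<partial>lborel)
      = (\<integral>\<^sup>+x. \<integral>\<^sup>+u. \<phi> (block x j) * G (block_upd x j u) \<partial>lborel \<partial>lborel)"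
    by (intro nn_integral_cong) (simp add: nn_integral_cmult)
  also have "\<dots> = (\<integral>\<^sup>+x. \<integral>\<^sup>+z. \<phi> z * G x \<partial>lborel \<partial>lborel)"
    by (rule nn_integral_block_swap[symmetric]) measurable
  also have "\<dots> = (\<integral>\<^sup>+x. G x \<partial>lborel)" by (simp add: nn_integral_multc \<phi>)
  finally show ?thesis by simp
qed

text \<open>The hypothesis compares integrals over whole fibres, which do not depend on block
  \<open>j\<close> of \<open>x\<close>; averaging against a density in that block turns them into
  integrals over the whole space. A standard Gaussian serves as this density.\<close>

lemma nn_integral_fibre_mono:
  fixes F G :: "real ^ ('d::finite \<times> 's::finite) \<Rightarrow> real ^ 's \<Rightarrow> ennreal"
  assumes [measurable]: "case_prod F \<in> borel_measurable (borel \<Otimes>\<^sub>M borel)" "case_prod G \<in> borel_measurable (borel \<Otimes>\<^sub>M borel)"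
    and le: "\<And>x. (\<integral>\<^sup>+u. \<integral>\<^sup>+v. F (block_upd x j u) v \<partial>lborel \<partial>lborel) \<le> c * (\<integral>\<^sup>+u. \<integral>\<^sup>+v. G (block_upd x j u) v \<partial>lborel \<partial>lborel)"
  shows "(\<integral>\<^sup>+x. \<integral>\<^sup>+z. F x z \<partial>lborel \<partial>lborel) \<le> c * (\<integral>\<^sup>+x. \<integral>\<^sup>+z. G x z \<partial>lborel \<partial>lborel)"
proof -
  define \<phi> :: "real ^ 's \<Rightarrow> ennreal" where "\<phi> z = ennreal (gauss_prod (\<lambda>_. 0) (\<lambda>_. 1) z)" for z
  have [measurable]: "\<phi> \<in> borel_measurable borel" unfolding \<phi>_def by measurable
  have \<phi>: "(\<integral>\<^sup>+z. \<phi> z \<partial>lborel) = 1" unfolding \<phi>_def by (rule nn_integral_gauss_prod) simp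
  have av: "(\<integral>\<^sup>+x. \<integral>\<^sup>+z. H x z \<partial>lborel \<partial>lborel) = (\<integral>\<^sup>+x. \<phi> (block x j) * (\<integral>\<^sup>+u. \<integral>\<^sup>+v. H (block_upd x j u) v \<partial>lborel \<partial>lborel) \<partial>lborel)"
    if [measurable]: "case_prod H \<in> borel_measurable (borel \<Otimes>\<^sub>M borel)" for H :: "real ^ ('d::finite \<times> 's::finite) \<Rightarrow> real ^ 's \<Rightarrow> ennreal"
    by (rule nn_integral_block_average[OF _ _ \<phi>]) measurable
  have "(\<integral>\<^sup>+x. \<integral>\<^sup>+z. F x z \<partial>lborel \<partial>lborel) \<le> (\<integral>\<^sup>+x. c * (\<phi> (block x j) * (\<integral>\<^sup>+u. \<integral>\<^sup>+v. G (block_upd x j u) v \<partial>lborel \<partial>lborel)) \<partial>lborel)"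
    unfolding av[of F, simplified]
  proof (rule nn_integral_mono)
    show "\<phi> (block x j) * (\<integral>\<^sup>+u. \<integral>\<^sup>+v. F (block_upd x j u) v \<partial>lborel \<partial>lborel)
      \<le> c * (\<phi> (block x j) * (\<integral>\<^sup>+u. \<integral>\<^sup>+v. G (block_upd x j u) v \<partial>lborel \<partial>lborel))" for x
      using mult_left_mono[OF le[of x], of "\<phi> (block x j)"] by (simp add: mult_ac)
  qed
  also have "\<dots> = c * (\<integral>\<^sup>+x. \<integral>\<^sup>+z. G x z \<partial>lborel \<partial>lborel)"
    unfolding av[of G, simplified] by (rule nn_integral_cmult) measurable
  finally show ?thesis .
qed

section \<open>Deterministic scans of positive reversible kernels\<close>

text \<open>The Dirichlet form \<langle>(I - K) g, g\<rangle>; for reversible kernels it is half the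
  mean squared jump of \<open>g\<close>.\<close>

definition gap_form :: "'a measure \<Rightarrow> ('a \<Rightarrow> 'a measure) \<Rightarrow> ('a \<Rightarrow> real) \<Rightarrow> real" where
  "gap_form m K g = (\<integral>x. (g x)\<^sup>2 \<partial>m) - (\<integral>x. kernel_op K g x * g x \<partial>m)"

context rev_kernel begin

lemma bdd_meas_sq_int: "bdd_meas g \<Longrightarrow> integrable m (\<lambda>x. (g x)\<^sup>2)"
  using bdd_meas_integrable[OF bdd_meas_mult[of g g]] by (simp add: power2_eq_square)

lemma nn_integral_T: "bdd_meas g \<Longrightarrow> (\<And>x. 0 \<le> g x) \<Longrightarrow> (\<integral>\<^sup>+y. ennreal (g y) \<partial>K x) = ennreal (T g x)"
  unfolding kernel_op_def by (intro nn_integral_eq_integral bdd_meas_integrable_K) auto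

text \<open>After expanding the square, the terms in \<open>g x\<close> and \<open>g y\<close> have
  the same integral because \<open>T\<close> preserves the mean of \<open>g^2\<close>.\<close>

lemma dirichlet_form:
  assumes g: "bdd_meas g"
  shows "(\<integral>\<^sup>+x. \<integral>\<^sup>+y. ennreal ((g x - g y)\<^sup>2) \<partial>K x \<partial>m) = ennreal (2 * gap_form m K g)" and "0 \<le> gap_form m K g"
proof -
  note [measurable] = bdd_meas_meas[OF g]
  let ?g2 = "\<lambda>x. g x * g x"
  have bm2: "bdd_meas ?g2" by (rule bdd_meas_mult[OF g g])
  have T_eq: "T (\<lambda>y. (g x - g y)\<^sup>2) x = (g x)\<^sup>2 - 2 * (T g x * g x) + T ?g2 x" for x
  proof -
    interpret K: prob_space "K x" by (rule prob_K)
    have "(\<lambda>y. (g x - g y)\<^sup>2) = (\<lambda>y. (g x)\<^sup>2 - 2 * g x * g y + ?g2 y)"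
      by (auto simp: power2_eq_square algebra_simps)
    then show ?thesis
      unfolding kernel_op_def using bdd_meas_integrable_K[OF bm2, of x] bdd_meas_integrable_K[OF g, of x] by (simp add: K.prob_space)
  qed
  have bmx: "bdd_meas (\<lambda>y. (g x - g y)\<^sup>2)" for x
    using bdd_meas_mult[OF bdd_meas_diff[OF bdd_meas_const g] bdd_meas_diff[OF bdd_meas_const g]] by (simp add: power2_eq_square)
  have pos: "0 \<le> (g x)\<^sup>2 - 2 * (T g x * g x) + T ?g2 x" for x
    unfolding T_eq[symmetric] unfolding kernel_op_def by simp
  have i: "integrable m (\<lambda>x. T g x * g x)" "integrable m (T ?g2)"
    using bdd_meas_integrable[OF bdd_meas_mult[OF bdd_meas_T[OF g] g]] bdd_meas_integrable[OF bdd_meas_T[OF bm2]] by auto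
  have e: "(\<integral>x. (g x)\<^sup>2 - 2 * (T g x * g x) + T ?g2 x \<partial>m) = 2 * gap_form m K g"
    using i bdd_meas_sq_int[OF g] T_mean[OF bm2] by (simp add: gap_form_def power2_eq_square)
  have "(\<integral>\<^sup>+x. \<integral>\<^sup>+y. ennreal ((g x - g y)\<^sup>2) \<partial>K x \<partial>m) = (\<integral>\<^sup>+x. ennreal ((g x)\<^sup>2 - 2 * (T g x * g x) + T ?g2 x) \<partial>m)"
    by (intro nn_integral_cong) (simp add: nn_integral_T[OF bmx] T_eq)
  also have "\<dots> = ennreal (2 * gap_form m K g)"
    unfolding e[symmetric] using i bdd_meas_sq_int[OF g] pos by (intro nn_integral_eq_integral) auto
  finally show "(\<integral>\<^sup>+x. \<integral>\<^sup>+y. ennreal ((g x - g y)\<^sup>2) \<partial>K x \<partial>m) = ennreal (2 * gap_form m K g)" .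
  have "0 \<le> (\<integral>x. (g x)\<^sup>2 - 2 * (T g x * g x) + T ?g2 x \<partial>m)" using pos by (intro Bochner_Integration.integral_nonneg) auto
  then show "0 \<le> gap_form m K g" unfolding e by simp
qed

lemma invariant:
  assumes [measurable]: "F \<in> borel_measurable borel"
  shows "(\<integral>\<^sup>+x. \<integral>\<^sup>+y. F y \<partial>K x \<partial>m) = (\<integral>\<^sup>+x. F x \<partial>m)"
  using rev[of "\<lambda>p. F (snd p)"] prob_space.emeasure_space_1[OF prob_K] by simp

end

text \<open>In view of \<open>dirichlet_form\<close> the condition means \<langle>K g, g\<rangle>
  \<ge> 0. It is written as a bound on the Dirichlet form because this is what integration over
  fibres delivers.\<close>

locale psd_kernel = rev_kernel +
  assumes psd: "bdd_meas g \<Longrightarrow> (\<integral>\<^sup>+x. \<integral>\<^sup>+y. ennreal ((g x - g y)\<^sup>2) \<partial>K x \<partial>m) \<le> ennreal (2 * (\<integral>x. (g x)\<^sup>2 \<partial>m))"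
begin

lemma T_psd: "bdd_meas g \<Longrightarrow> 0 \<le> (\<integral>x. T g x * g x \<partial>m)"
  using psd[of g] dirichlet_form[of g] by (simp add: gap_form_def)

text \<open>This is \<open>T^2 \<le> T\<close> for \<open>0 \<le> T \<le> I\<close>, without
  functional calculus: Cauchy-Schwarz in the form \<langle>T g, h\<rangle> applied to
  \<open>g\<close> and \<open>T g\<close> gives \<open>?b^2 \<le> ?a * ?c\<close>, and
  \<open>?c \<le> ?b\<close> since \<open>T \<le> I\<close>.\<close>

lemma norm_T_sq_le:
  assumes g: "bdd_meas g"
  shows "(\<integral>x. (T g x)\<^sup>2 \<partial>m) \<le> (\<integral>x. T g x * g x \<partial>m)"
proof -
  let ?a = "\<integral>x. T g x * g x \<partial>m" and ?b = "\<integral>x. (T g x)\<^sup>2 \<partial>m" and ?c = "\<integral>x. T (T g) x * T g x \<partial>m"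
  have Tg: "bdd_meas (T g)" "bdd_meas (T (T g))" using g by (auto intro: bdd_meas_T)
  have int: "integrable m (\<lambda>x. T g x * g x)" "integrable m (\<lambda>x. (T g x)\<^sup>2)" "integrable m (\<lambda>x. T (T g) x * T g x)"
    "integrable m (\<lambda>x. T (T g) x * g x)"
    using bdd_meas_integrable[OF bdd_meas_mult] g Tg bdd_meas_sq_int by auto
  have sa: "(\<integral>x. T (T g) x * g x \<partial>m) = ?b" using T_selfadjoint[OF Tg(1) g] by (simp add: power2_eq_square)
  have "?b\<^sup>2 \<le> ?a * ?c"
  proof (rule quadratic_nonneg_discrim)
    fix t
    let ?k = "\<lambda>x. t * g x + T g x"
    have k: "bdd_meas ?k" by (intro bdd_meas_add bdd_meas_cmult g Tg)
    have Tk: "T ?k x = t * T g x + T (T g) x" for x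
      using T_add[OF bdd_meas_cmult[OF g] Tg(1)] by (simp add: kernel_op_def)
    have "0 \<le> (\<integral>x. T ?k x * ?k x \<partial>m)" by (rule T_psd[OF k])
    also have "\<dots> = (\<integral>x. t\<^sup>2 * (T g x * g x) + t * (T g x)\<^sup>2 + t * (T (T g) x * g x) + T (T g) x * T g x \<partial>m)"
        unfolding Tk by (simp add: power2_eq_square algebra_simps)
    also have "\<dots> = t\<^sup>2 * ?a + 2 * t * ?b + ?c" using int sa by simp
    finally show "0 \<le> t\<^sup>2 * ?a + 2 * t * ?b + ?c" .
  qed (rule T_psd[OF g])
  also have "\<dots> \<le> ?a * ?b"
    using dirichlet_form(2)[OF Tg(1)] T_psd[OF g] by (intro mult_left_mono) (auto simp: gap_form_def)
  finally have "?b * ?b \<le> ?a * ?b" by (simp add: power2_eq_square)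
  moreover have "?b \<ge> 0" by simp
  ultimately show ?thesis using T_psd[OF g] by (cases "?b = 0") (auto simp: mult_le_cancel_right)
qed

text \<open>The counterpart \<open>(I - T)^2 \<le> I - T\<close>, by expanding the square and
  inserting \<open>T^2 \<le> T\<close>.\<close>

lemma norm_diff_T_sq_le:
  assumes g: "bdd_meas g"
  shows "(\<integral>x. (g x - T g x)\<^sup>2 \<partial>m) \<le> gap_form m K g"
proof -
  have Tg: "bdd_meas (T g)" using g by (rule bdd_meas_T)
  have int: "integrable m (\<lambda>x. T g x * g x)" "integrable m (\<lambda>x. (T g x)\<^sup>2)" "integrable m (\<lambda>x. (g x)\<^sup>2)"
    using bdd_meas_integrable[OF bdd_meas_mult] g Tg bdd_meas_sq_int by auto
  have "(\<integral>x. (g x - T g x)\<^sup>2 \<partial>m) = (\<integral>x. (g x)\<^sup>2 - 2 * (T g x * g x) + (T g x)\<^sup>2 \<partial>m)"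
    by (simp add: power2_eq_square algebra_simps)
  also have "\<dots> = (\<integral>x. (g x)\<^sup>2 \<partial>m) - 2 * (\<integral>x. T g x * g x \<partial>m) + (\<integral>x. (T g x)\<^sup>2 \<partial>m)"
    using int by simp
  finally show ?thesis using norm_T_sq_le[OF g] by (simp add: gap_form_def)
qed

end

text \<open>Young's inequality for every single jump, integrated. The weight \<open>t\<close> stays
  free for the scan estimate.\<close>

lemma (in rev_kernel) gap_form_young:
  assumes g: "bdd_meas g" and k: "bdd_meas k" and t: "t > 0"
  shows "gap_form m K g \<le> (1 + t) * gap_form m K k + (1 + 1 / t) * gap_form m K (\<lambda>x. g x - k x)"
proof -
  let ?d = "\<lambda>x. g x - k x"
  have d: "bdd_meas ?d" using g k by (rule bdd_meas_diff)
  have "ennreal (2 * gap_form m K g) \<le> (\<integral>\<^sup>+x. \<integral>\<^sup>+y. ennreal (1 + t) * ennreal ((k x - k y)\<^sup>2) + ennreal (1 + 1 / t) * ennreal ((?d x - ?d y)\<^sup>2) \<partial>K x \<partial>m)"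
    unfolding dirichlet_form(1)[OF g, symmetric]
  proof (intro nn_integral_mono)
    fix x y
    let ?a = "k x - k y" and ?b = "?d x - ?d y"
    have "0 \<le> (t * ?a - ?b)\<^sup>2 / t" using t by simp
    then have "2 * ?a * ?b \<le> t * ?a\<^sup>2 + ?b\<^sup>2 / t" using t by (simp add: power2_eq_square field_simps)
    moreover have "(g x - g y)\<^sup>2 = ?a\<^sup>2 + 2 * ?a * ?b + ?b\<^sup>2" by (simp add: power2_eq_square algebra_simps)
    ultimately have "(g x - g y)\<^sup>2 \<le> (1 + t) * ?a\<^sup>2 + (1 + 1 / t) * ?b\<^sup>2" by (simp add: algebra_simps)
    then show "ennreal ((g x - g y)\<^sup>2) \<le> ennreal (1 + t) * ennreal (?a\<^sup>2) + ennreal (1 + 1 / t) * ennreal (?b\<^sup>2)"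
      using t by (simp add: ennreal_mult[symmetric] ennreal_plus[symmetric] ennreal_leI del: ennreal_plus)
  qed
  also have "\<dots> = ennreal (1 + t) * ennreal (2 * gap_form m K k) + ennreal (1 + 1 / t) * ennreal (2 * gap_form m K ?d)"
  proof -
    note [measurable] = bdd_meas_meas[OF k] bdd_meas_meas[OF g] bdd_meas_meas[OF d]
    have [measurable]: "(\<lambda>x. \<integral>\<^sup>+y. ennreal ((f x - f y)\<^sup>2) \<partial>K x) \<in> borel_measurable borel"
      if [measurable]: "f \<in> borel_measurable borel" for f :: "'a \<Rightarrow> real"
      by (rule nn_integral_measurable_subprob_algebra2[where N = borel]) measurable
    show ?thesis
      unfolding dirichlet_form(1)[OF k, symmetric] dirichlet_form(1)[OF d, symmetric]
      by (simp add: nn_integral_add nn_integral_cmult)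
  qed
  also have "\<dots> = ennreal ((1 + t) * (2 * gap_form m K k) + (1 + 1 / t) * (2 * gap_form m K ?d))"
    using t dirichlet_form(2)[OF k] dirichlet_form(2)[OF d]
    by (subst ennreal_plus) (auto simp: ennreal_mult)
  finally have "2 * gap_form m K g \<le> (1 + t) * (2 * gap_form m K k) + (1 + 1 / t) * (2 * gap_form m K ?d)"
    using t dirichlet_form(2)[OF k] dirichlet_form(2)[OF d] by (subst (asm) ennreal_le_iff) auto
  then show ?thesis by (simp add: algebra_simps)
qed

lemma (in psd_kernel) gap_form_le: "bdd_meas g \<Longrightarrow> gap_form m K g \<le> (\<integral>x. (g x)\<^sup>2 \<partial>m)"
  using T_psd[of g] by (simp add: gap_form_def)

text \<open>The weight \<open>t = 1 / n\<close> in Young's inequality is what makes the constant quadratic in the number of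
  kernels.\<close>

theorem scan_gap:
  assumes "\<And>j. j \<in> set js \<Longrightarrow> psd_kernel m (K j)" and "bdd_meas g"
  shows "bdd_meas (fold (\<lambda>j. kernel_op (K j)) js g) \<and>
    (\<Sum>j\<leftarrow>js. gap_form m (K j) g)
      \<le> (real (length js))\<^sup>2 * ((\<integral>x. (g x)\<^sup>2 \<partial>m) - (\<integral>x. (fold (\<lambda>j. kernel_op (K j)) js g x)\<^sup>2 \<partial>m))"
  using assms
proof (induction js arbitrary: g)
  case Nil
  then show ?case by simp
next
  case (Cons j js)
  note g = \<open>bdd_meas g\<close>
  interpret j: psd_kernel m "K j" using Cons.prems(1) by simp
  define k where "k = kernel_op (K j) g"
  have k: "bdd_meas k" unfolding k_def by (rule j.bdd_meas_T[OF g])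
  define n where "n = real (length js)"
  define a where "a = gap_form m (K j) g"
  define R where "R = (\<integral>x. (k x)\<^sup>2 \<partial>m) - (\<integral>x. (fold (\<lambda>j. kernel_op (K j)) js k x)\<^sup>2 \<partial>m)"
  define r where "r = (\<integral>x. (g x)\<^sup>2 \<partial>m) - (\<integral>x. (k x)\<^sup>2 \<partial>m)"
  have IH: "bdd_meas (fold (\<lambda>j. kernel_op (K j)) js k)" "(\<Sum>i\<leftarrow>js. gap_form m (K i) k) \<le> n\<^sup>2 * R"
    using Cons.IH[OF _ k] Cons.prems(1) by (auto simp: n_def R_def)
  \<comment> \<open>By \<open>T^2 \<le> T\<close>, the gap of the first kernel at \<open>g\<close>
    is at most the drop in squared norm that it causes.\<close>
  have a: "0 \<le> a" "a \<le> r"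
    using j.dirichlet_form(2)[OF g] j.norm_T_sq_le[OF g] by (auto simp: a_def r_def k_def gap_form_def)
  have d: "bdd_meas (\<lambda>x. g x - k x)" using g k by (rule bdd_meas_diff)
  have main: "(\<Sum>i\<leftarrow>js. gap_form m (K i) g) + a \<le> (n + 1)\<^sup>2 * (R + r)"
  proof (cases "js = []")
    case True
    then show ?thesis using a by (simp add: n_def R_def)
  next
    case False
    then have n: "n \<ge> 1" by (simp add: n_def Suc_le_eq)
    \<comment> \<open>The later gaps at \<open>g\<close> are compared with those at
      \<open>k\<close>. The form at the difference is at most the squared norm of
      \<open>g - k\<close>, hence at most \<open>a\<close>, because \<open>K i\<close> is positive
      and by \<open>(I - T)^2 \<le> I - T\<close>.\<close>
    have "gap_form m (K i) g \<le> (1 + 1 / n) * gap_form m (K i) k + (1 + n) * a" if "i \<in> set js" for i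
    proof -
      interpret i: psd_kernel m "K i" using Cons.prems(1) that by simp
      have "gap_form m (K i) (\<lambda>x. g x - k x) \<le> (\<integral>x. (g x - k x)\<^sup>2 \<partial>m)" by (rule i.gap_form_le[OF d])
      also have "\<dots> \<le> a" unfolding k_def a_def by (rule j.norm_diff_T_sq_le[OF g])
      finally have "(1 + n) * gap_form m (K i) (\<lambda>x. g x - k x) \<le> (1 + n) * a" using n by (intro mult_left_mono) auto
      moreover have "gap_form m (K i) g \<le> (1 + 1 / n) * gap_form m (K i) k + (1 + n) * gap_form m (K i) (\<lambda>x. g x - k x)"
        using i.gap_form_young[OF g k, of "1 / n"] n by simp
      ultimately show ?thesis by linarith
    qed
    then have "(\<Sum>i\<leftarrow>js. gap_form m (K i) g) \<le> (\<Sum>i\<leftarrow>js. (1 + 1 / n) * gap_form m (K i) k + (1 + n) * a)"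
      by (intro sum_list_mono) auto
    also have "\<dots> = (1 + 1 / n) * (\<Sum>i\<leftarrow>js. gap_form m (K i) k) + n * ((1 + n) * a)"
      by (simp add: sum_list_addf sum_list_const_mult sum_list_triv n_def)
    also have "\<dots> \<le> (1 + 1 / n) * (n\<^sup>2 * R) + n * ((1 + n) * a)"
      using IH(2) n by (intro add_right_mono mult_left_mono) auto
    also have "(1 + 1 / n) * (n\<^sup>2 * R) = (n * (n + 1)) * R" using n by (simp add: power2_eq_square field_simps)
    finally have 1: "(\<Sum>i\<leftarrow>js. gap_form m (K i) g) + a \<le> (n * (n + 1)) * R + (n * (n + 1) + 1) * a"
      by (simp add: algebra_simps)
    \<comment> \<open>The induction hypothesis bounds this sum by \<open>n^2 * R\<close>, so its
      sign yields \<open>R \<ge> 0\<close>, which allows enlarging the coefficient of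
      \<open>R\<close> to \<open>(n + 1)^2\<close>.\<close>
    have "0 \<le> (\<Sum>i\<leftarrow>js. gap_form m (K i) k)"
    proof (rule sum_list_nonneg)
      fix x assume "x \<in> set (map (\<lambda>i. gap_form m (K i) k) js)"
      then obtain i where i: "i \<in> set js" "x = gap_form m (K i) k" by auto
      interpret i: psd_kernel m "K i" using Cons.prems(1) i by simp
      show "0 \<le> x" using i.dirichlet_form(2)[OF k] i by simp
    qed
    then have "0 \<le> n\<^sup>2 * R" using IH(2) by linarith
    then have R: "0 \<le> R" using n by (simp add: zero_le_mult_iff)
    have "(n * (n + 1)) * R \<le> (n + 1)\<^sup>2 * R" using R n by (intro mult_right_mono) (auto simp: power2_eq_square)
    moreover have "(n * (n + 1) + 1) * a \<le> (n + 1)\<^sup>2 * r" using a n by (intro mult_mono) (auto simp: power2_eq_square algebra_simps)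
    ultimately show ?thesis using 1 by (simp add: distrib_left)
  qed
  have "R + r = (\<integral>x. (g x)\<^sup>2 \<partial>m) - (\<integral>x. (fold (\<lambda>j. kernel_op (K j)) (j # js) g x)\<^sup>2 \<partial>m)"
    by (simp add: R_def r_def k_def)
  then show ?case using main IH(1) by (simp add: a_def k_def n_def add.commute)
qed

section \<open>The composed kernel as a kernel and as an operator\<close>

lemma kernel_scan_measurable:
  assumes "\<And>j. j \<in> set js \<Longrightarrow> K j \<in> borel \<rightarrow>\<^sub>M prob_algebra borel"
  shows "kernel_scan K js \<in> borel \<rightarrow>\<^sub>M prob_algebra borel"
  using assms
proof (induction js)
  case (Cons j js)
  then have [measurable]: "K j \<in> borel \<rightarrow>\<^sub>M prob_algebra borel" "kernel_scan K js \<in> borel \<rightarrow>\<^sub>M prob_algebra borel"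
    by auto
  show ?case unfolding kernel_scan.simps kernel_comp_def by (rule measurable_bind_prob_space) measurable
qed simp

text \<open>The head of the list is the last move of the chain, hence the first operator to act on
  \<open>g\<close>; this is the order in which \<open>fold\<close> applies its functions.\<close>

lemma kernel_scan_op:
  assumes "\<And>j. j \<in> set js \<Longrightarrow> rev_kernel m (K j)" and g: "bdd_meas g"
  shows "kernel_op (kernel_scan K js) g = fold (\<lambda>j. kernel_op (K j)) js g"
  using assms
proof (induction js arbitrary: g)
  case Nil
  then have "g \<in> borel_measurable borel" by (simp add: bdd_meas_def)
  then show ?case by (auto simp: kernel_op_def integral_return)
next
  case (Cons j js)
  interpret j: rev_kernel m "K j" using Cons.prems by simp
  have meas: "kernel_scan K js \<in> borel \<rightarrow>\<^sub>M prob_algebra borel"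
    using Cons.prems by (intro kernel_scan_measurable) (auto intro: rev_kernel.K_meas)
  obtain C where C: "\<And>x. \<bar>g x\<bar> \<le> C" using Cons.prems(2) by (auto simp: bdd_meas_def)
  note [measurable] = bdd_meas_meas[OF Cons.prems(2)]
  have "kernel_op (kernel_scan K (j # js)) g x = kernel_op (kernel_scan K js) (kernel_op (K j) g) x" for x
  proof -
    have S: "prob_space (kernel_scan K js x)" and sets[measurable_cong]: "sets (kernel_scan K js x) = sets borel"
      using measurable_space[OF meas, of x] by (auto simp: space_prob_algebra)
    show ?thesis unfolding kernel_op_def kernel_scan.simps kernel_comp_def
    proof (rule integral_bind[where B' = 1 and B = C and K = borel])
      show "finite_measure (kernel_scan K js x)" using S by (simp add: prob_space_def)
      show "AE y in kernel_scan K js x. emeasure (K j y) (space (K j y)) \<le> ennreal 1"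
        using prob_space.emeasure_space_1[OF j.prob_K] by simp
    qed (use C in measurable)
  qed
  then show ?case using Cons.IH[OF _ j.bdd_meas_T[OF Cons.prems(2)]] Cons.prems(1) by auto
qed

lemma kernel_scan_invariant:
  assumes "\<And>j. j \<in> set js \<Longrightarrow> rev_kernel m (K j)" and F: "F \<in> borel_measurable borel" and m: "sets m = sets borel"
  shows "(\<integral>\<^sup>+x. \<integral>\<^sup>+y. F y \<partial>kernel_scan K js x \<partial>m) = (\<integral>\<^sup>+x. F x \<partial>m)"
  using assms(1) F
proof (induction js arbitrary: F)
  case Nil
  then show ?case by (simp add: nn_integral_return)
next
  case (Cons j js)
  note [measurable] = Cons.prems(2)
  interpret j: rev_kernel m "K j" using Cons.prems by simp
  have meas: "kernel_scan K js \<in> borel \<rightarrow>\<^sub>M prob_algebra borel"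
    using Cons.prems by (intro kernel_scan_measurable) (auto intro: rev_kernel.K_meas)
  have sets[measurable_cong]: "sets (kernel_scan K js x) = sets borel" for x
    using measurable_space[OF meas, of x] by (auto simp: space_prob_algebra)
  have "(\<integral>\<^sup>+x. \<integral>\<^sup>+y. F y \<partial>kernel_scan K (j # js) x \<partial>m) = (\<integral>\<^sup>+x. \<integral>\<^sup>+y. (\<integral>\<^sup>+z. F z \<partial>K j y) \<partial>kernel_scan K js x \<partial>m)"
    unfolding kernel_scan.simps kernel_comp_def by (intro nn_integral_cong nn_integral_bind[where B = borel]) measurable
  also have "\<dots> = (\<integral>\<^sup>+x. (\<integral>\<^sup>+z. F z \<partial>K j x) \<partial>m)"
    using Cons.prems by (intro Cons.IH) auto
  also have "\<dots> = (\<integral>\<^sup>+x. F x \<partial>m)" by (rule j.invariant) measurable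
  finally show ?case .
qed

text \<open>Jensen's inequality in a form free of integrability conditions: if \<open>d\<close> is
  not integrable its integral is 0 by default, and if \<open>d^2\<close> is not integrable the right
  side is infinite.\<close>

lemma prob_space_integral_sq_le:
  fixes d :: "'a \<Rightarrow> real"
  assumes "prob_space M" and [measurable]: "d \<in> borel_measurable M"
  shows "ennreal ((\<integral>x. d x \<partial>M)\<^sup>2) \<le> (\<integral>\<^sup>+x. ennreal ((d x)\<^sup>2) \<partial>M)"
proof -
  interpret prob_space M by fact
  show ?thesis
  proof (cases "integrable M (\<lambda>x. (d x)\<^sup>2) \<and> integrable M d")
    case True
    then have "(\<integral>x. d x \<partial>M)\<^sup>2 \<le> (\<integral>x. (d x)\<^sup>2 \<partial>M)"
      using variance_eq[of d] variance_positive[of d] by simp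
    then show ?thesis using True by (subst nn_integral_eq_integral) (auto intro: ennreal_leI)
  next
    case False
    then consider "\<not> integrable M d" | "\<not> integrable M (\<lambda>x. (d x)\<^sup>2)" by blast
    then show ?thesis
    proof cases
      case 1
      then show ?thesis by (simp add: not_integrable_integral_eq)
    next
      case 2
      have "(\<integral>\<^sup>+x. ennreal ((d x)\<^sup>2) \<partial>M) = \<infinity>"
      proof (rule ccontr)
        assume "(\<integral>\<^sup>+x. ennreal ((d x)\<^sup>2) \<partial>M) \<noteq> \<infinity>"
        then have "(\<integral>\<^sup>+x. ennreal ((d x)\<^sup>2) \<partial>M) < \<infinity>" by (simp add: less_top)
        then have "integrable M (\<lambda>x. (d x)\<^sup>2)" by (intro integrableI_nonneg) simp_all
        with 2 show False by simp
      qed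
      then show ?thesis by simp
    qed
  qed
qed

text \<open>\<open>f\<close> is split into a Lipschitz part \<open>\<phi>\<close> and a small
  remainder \<open>d\<close>. The bound for \<open>\<phi>\<close> is assumed, the image of
  \<open>d\<close> is small by Jensen's inequality and invariance, and Young's inequality recombines
  them at a cost \<open>1 + t\<close> that tends to 1.\<close>

theorem L2_opnorm_le_dense:
  fixes S :: "'a::euclidean_space \<Rightarrow> 'a measure"
  assumes m: "prob_space m" and sets_m: "sets m = sets borel" and S: "S \<in> borel \<rightarrow>\<^sub>M prob_algebra borel"
    and inv: "\<And>F. F \<in> borel_measurable borel \<Longrightarrow> (\<integral>\<^sup>+x. \<integral>\<^sup>+y. F y \<partial>S x \<partial>m) = (\<integral>\<^sup>+x. F x \<partial>m)"
    and q: "0 \<le> q"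
    and lip: "\<And>\<phi>. bdd_lipschitz \<phi> \<Longrightarrow>
      (\<integral>\<^sup>+x. ennreal ((kernel_op S \<phi> x - (\<integral>y. \<phi> y \<partial>m))\<^sup>2) \<partial>m) \<le> ennreal (q\<^sup>2) * (\<integral>\<^sup>+x. ennreal ((\<phi> x)\<^sup>2) \<partial>m)"
  shows "L2_opnorm m (\<lambda>f x. kernel_op S f x - (\<integral>y. f y \<partial>m)) \<le> ereal q"
  unfolding L2_opnorm_def
proof (rule SUP_least)
  interpret m: prob_space m by fact
  note [measurable_cong] = sets_m
  have [measurable]: "S \<in> borel \<rightarrow>\<^sub>M subprob_algebra borel" using S by (rule measurable_prob_algebraD)
  have prob_S: "prob_space (S x)" and sets_S[measurable_cong]: "sets (S x) = sets borel" for x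
    using measurable_space[OF S, of x] by (auto simp: space_prob_algebra)
  fix f assume "f \<in> {f. L2_norm m f \<le> 1}"
  then have "L2_norm m f \<le> 1" by simp
  then have f0: "f \<in> borel_measurable m" and f2: "integrable m (\<lambda>x. (f x)\<^sup>2)" and f1: "sqrt (\<integral>x. (f x)\<^sup>2 \<partial>m) \<le> 1"
    by (auto simp: L2_norm_def one_ereal_def split: if_splits)
  have f[measurable]: "f \<in> borel_measurable borel" using f0 sets_m by (metis measurable_cong_sets)
  have fnn: "(\<integral>\<^sup>+x. ennreal ((f x)\<^sup>2) \<partial>m) \<le> 1"
    using f1 f2 by (subst nn_integral_eq_integral) auto
  have fint: "integrable m f" using m.square_integrable_imp_integrable[OF f0 f2] .
  let ?U = "\<lambda>f x. kernel_op S f x - (\<integral>y. f y \<partial>m)"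
  have op_meas[measurable]: "kernel_op S f \<in> borel_measurable borel" if [measurable]: "f \<in> borel_measurable borel" for f :: "'a \<Rightarrow> real"
    unfolding kernel_op_def by measurable
  have young: "(a + b)\<^sup>2 \<le> (1 + t) * a\<^sup>2 + (1 + 1 / t) * b\<^sup>2" if t: "t > 0" for a b t :: real
  proof -
    have "0 \<le> (t * a - b)\<^sup>2 / t" using t by simp
    then have "2 * a * b \<le> t * a\<^sup>2 + b\<^sup>2 / t" using t by (simp add: power2_eq_square field_simps)
    then show ?thesis by (simp add: power2_eq_square algebra_simps)
  qed
  have eps: "(\<integral>\<^sup>+x. ennreal ((?U f x)\<^sup>2) \<partial>m) \<le> ennreal ((1 + t) * q\<^sup>2 * (1 + t + (1 + 1 / t) * e) + (1 + 1 / t) * (4 * e))"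
    if t: "t > 0" and e: "e > 0" for t e :: real
  proof -
    obtain \<phi> where \<phi>: "bdd_lipschitz \<phi>" and close: "(\<integral>\<^sup>+x. ennreal ((f x - \<phi> x)\<^sup>2) \<partial>m) < ennreal e"
      using bdd_lipschitz_dense_L2[OF sets_m m.finite_measure_axioms f _ e] fnn
      by (metis ennreal_one_less_top infinity_ennreal_def le_less_trans)
    note [measurable] = bdd_lipschitz_measurable[OF \<phi>]
    define d where "d x = f x - \<phi> x" for x
    have [measurable]: "d \<in> borel_measurable borel" unfolding d_def by measurable
    have dnn: "(\<integral>\<^sup>+x. ennreal ((d x)\<^sup>2) \<partial>m) \<le> ennreal e" using close by (simp add: d_def)
    obtain C where C: "\<And>x. \<bar>\<phi> x\<bar> \<le> C" using \<phi> by (auto simp: bdd_lipschitz_def)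
    have \<phi>int: "integrable m \<phi>" using C by (intro m.integrable_const_bound[where B = C]) auto
    have \<phi>S: "integrable (S x) \<phi>" for x
    proof -
      interpret S: prob_space "S x" by (rule prob_S)
      show ?thesis using C by (intro S.integrable_const_bound[where B = C]) auto
    qed
    \<comment> \<open>The Bochner integral is additive only where \<open>f\<close> is integrable;
      invariance of \<open>m\<close> guarantees this for almost every \<open>x\<close>.\<close>
    have "AE x in m. integrable (S x) f"
    proof -
      have "(\<integral>\<^sup>+x. \<integral>\<^sup>+y. ennreal \<bar>f y\<bar> \<partial>S x \<partial>m) \<noteq> \<infinity>"
        using fint by (simp add: inv integrable_iff_bounded less_top)
      then have "AE x in m. (\<integral>\<^sup>+y. ennreal \<bar>f y\<bar> \<partial>S x) \<noteq> \<infinity>"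
        by (intro nn_integral_PInf_AE) measurable
      then show ?thesis by eventually_elim (simp add: integrable_iff_bounded less_top)
    qed
    then have split: "AE x in m. ?U f x = ?U \<phi> x + ?U d x"
    proof eventually_elim
      case (elim x)
      then show ?case using \<phi>S[of x] \<phi>int fint by (simp add: kernel_op_def d_def)
    qed
    have \<phi>nn: "(\<integral>\<^sup>+x. ennreal ((\<phi> x)\<^sup>2) \<partial>m) \<le> ennreal (1 + t + (1 + 1 / t) * e)"
    proof -
      have "(\<integral>\<^sup>+x. ennreal ((\<phi> x)\<^sup>2) \<partial>m) \<le> (\<integral>\<^sup>+x. ennreal (1 + t) * ennreal ((f x)\<^sup>2) + ennreal (1 + 1 / t) * ennreal ((d x)\<^sup>2) \<partial>m)"
      proof (rule nn_integral_mono)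
        fix x
        have e: "f x + - d x = \<phi> x" by (simp add: d_def)
        have "(\<phi> x)\<^sup>2 \<le> (1 + t) * (f x)\<^sup>2 + (1 + 1 / t) * (d x)\<^sup>2"
          using young[OF t, of "f x" "- d x"] unfolding e by simp
        then show "ennreal ((\<phi> x)\<^sup>2) \<le> ennreal (1 + t) * ennreal ((f x)\<^sup>2) + ennreal (1 + 1 / t) * ennreal ((d x)\<^sup>2)"
          using t by (simp add: ennreal_mult[symmetric] ennreal_plus[symmetric] ennreal_leI del: ennreal_plus)
      qed
      also have "\<dots> = ennreal (1 + t) * (\<integral>\<^sup>+x. ennreal ((f x)\<^sup>2) \<partial>m) + ennreal (1 + 1 / t) * (\<integral>\<^sup>+x. ennreal ((d x)\<^sup>2) \<partial>m)"
        by (simp add: nn_integral_add nn_integral_cmult)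
      also have "\<dots> \<le> ennreal (1 + t) * 1 + ennreal (1 + 1 / t) * ennreal e"
        using fnn dnn by (intro add_mono mult_left_mono) auto
      also have "\<dots> = ennreal (1 + t + (1 + 1 / t) * e)"
        using t e by (simp add: ennreal_mult[symmetric] ennreal_plus[symmetric] del: ennreal_plus)
      finally show ?thesis .
    qed
    have dU: "(\<integral>\<^sup>+x. ennreal ((?U d x)\<^sup>2) \<partial>m) \<le> ennreal (4 * e)"
    proof -
      have "(\<integral>\<^sup>+x. ennreal ((?U d x)\<^sup>2) \<partial>m) \<le> (\<integral>\<^sup>+x. 2 * (\<integral>\<^sup>+y. ennreal ((d y)\<^sup>2) \<partial>S x) + 2 * (\<integral>\<^sup>+y. ennreal ((d y)\<^sup>2) \<partial>m) \<partial>m)"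
      proof (rule nn_integral_mono)
        fix x
        have "(?U d x)\<^sup>2 \<le> 2 * (kernel_op S d x)\<^sup>2 + 2 * (\<integral>y. d y \<partial>m)\<^sup>2"
          using young[of 1 "kernel_op S d x" "- (\<integral>y. d y \<partial>m)"] by simp
        then have "ennreal ((?U d x)\<^sup>2) \<le> 2 * ennreal ((kernel_op S d x)\<^sup>2) + 2 * ennreal ((\<integral>y. d y \<partial>m)\<^sup>2)"
          using ennreal_leI by (fastforce simp: ennreal_mult ennreal_plus)
        also have "\<dots> \<le> 2 * (\<integral>\<^sup>+y. ennreal ((d y)\<^sup>2) \<partial>S x) + 2 * (\<integral>\<^sup>+y. ennreal ((d y)\<^sup>2) \<partial>m)"
          unfolding kernel_op_def
          by (intro add_mono mult_left_mono prob_space_integral_sq_le prob_S m) auto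
        finally show "ennreal ((?U d x)\<^sup>2) \<le> 2 * (\<integral>\<^sup>+y. ennreal ((d y)\<^sup>2) \<partial>S x) + 2 * (\<integral>\<^sup>+y. ennreal ((d y)\<^sup>2) \<partial>m)" .
      qed
      also have "\<dots> = 2 * (\<integral>\<^sup>+y. ennreal ((d y)\<^sup>2) \<partial>m) + 2 * (\<integral>\<^sup>+y. ennreal ((d y)\<^sup>2) \<partial>m)"
        by (simp add: nn_integral_add nn_integral_cmult inv m.emeasure_space_1)
      also have "\<dots> \<le> 2 * ennreal e + 2 * ennreal e" using dnn by (intro add_mono mult_left_mono) auto
      also have "\<dots> = ennreal (4 * e)"
      proof -
        have "2 * ennreal e = ennreal (2 * e)" using ennreal_mult[of 2 e] e by simp
        then show ?thesis using e by (simp add: ennreal_plus[symmetric] del: ennreal_plus)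
      qed
      finally show ?thesis .
    qed
    have "(\<integral>\<^sup>+x. ennreal ((?U f x)\<^sup>2) \<partial>m) = (\<integral>\<^sup>+x. ennreal ((?U \<phi> x + ?U d x)\<^sup>2) \<partial>m)"
    proof (rule nn_integral_cong_AE)
      show "AE x in m. ennreal ((?U f x)\<^sup>2) = ennreal ((?U \<phi> x + ?U d x)\<^sup>2)"
        using split by eventually_elim (simp only:)
    qed
    also have "\<dots> \<le> (\<integral>\<^sup>+x. ennreal (1 + t) * ennreal ((?U \<phi> x)\<^sup>2) + ennreal (1 + 1 / t) * ennreal ((?U d x)\<^sup>2) \<partial>m)"
      using young[OF t] t
      by (intro nn_integral_mono) (simp add: ennreal_mult[symmetric] ennreal_plus[symmetric] ennreal_leI del: ennreal_plus)
    also have "\<dots> = ennreal (1 + t) * (\<integral>\<^sup>+x. ennreal ((?U \<phi> x)\<^sup>2) \<partial>m) + ennreal (1 + 1 / t) * (\<integral>\<^sup>+x. ennreal ((?U d x)\<^sup>2) \<partial>m)"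
      by (simp add: nn_integral_add nn_integral_cmult)
    also have "\<dots> \<le> ennreal (1 + t) * (ennreal (q\<^sup>2) * ennreal (1 + t + (1 + 1 / t) * e)) + ennreal (1 + 1 / t) * ennreal (4 * e)"
      using dU by (intro add_mono mult_left_mono order_trans[OF lip[OF \<phi>] mult_left_mono[OF \<phi>nn]]) auto
    also have "\<dots> = ennreal ((1 + t) * q\<^sup>2 * (1 + t + (1 + 1 / t) * e) + (1 + 1 / t) * (4 * e))"
      using t e by (simp add: ennreal_mult[symmetric] ennreal_plus[symmetric] mult.assoc del: ennreal_plus)
    finally show ?thesis .
  qed
  \<comment> \<open>With \<open>e = t^2\<close> every term carrying \<open>1 / t\<close> vanishes as
    \<open>t\<close> tends to 0 from the right.\<close>
  have le: "(\<integral>\<^sup>+x. ennreal ((?U f x)\<^sup>2) \<partial>m) \<le> ennreal (q\<^sup>2)"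
  proof (rule tendsto_lowerbound)
    have "((\<lambda>t. (1 + t) * q\<^sup>2 * (1 + t + (1 + 1 / t) * t\<^sup>2) + (1 + 1 / t) * (4 * t\<^sup>2)) \<longlongrightarrow> (1 + 0) * q\<^sup>2 * (1 + 0 + (0\<^sup>2 + 0)) + (4 * 0\<^sup>2 + 4 * 0)) (at_right (0::real))"
    proof (rule Lim_transform_eventually)
      show "((\<lambda>t. (1 + t) * q\<^sup>2 * (1 + t + (t\<^sup>2 + t)) + (4 * t\<^sup>2 + 4 * t)) \<longlongrightarrow> (1 + 0) * q\<^sup>2 * (1 + 0 + (0\<^sup>2 + 0)) + (4 * 0\<^sup>2 + 4 * 0)) (at_right (0::real))"
        by (intro tendsto_intros)
      show "\<forall>\<^sub>F t in at_right 0. (1 + t) * q\<^sup>2 * (1 + t + (t\<^sup>2 + t)) + (4 * t\<^sup>2 + 4 * t) = (1 + t) * q\<^sup>2 * (1 + t + (1 + 1 / t) * t\<^sup>2) + (1 + 1 / t) * (4 * t\<^sup>2)"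
        by (auto simp: eventually_at_right_less power2_eq_square distrib_right intro!: eventually_mono[OF eventually_at_right_less])
    qed
    then show "((\<lambda>t. ennreal ((1 + t) * q\<^sup>2 * (1 + t + (1 + 1 / t) * t\<^sup>2) + (1 + 1 / t) * (4 * t\<^sup>2))) \<longlongrightarrow> ennreal (q\<^sup>2)) (at_right (0::real))"
      using tendsto_ennrealI by fastforce
    show "\<forall>\<^sub>F t in at_right (0::real). (\<integral>\<^sup>+x. ennreal ((?U f x)\<^sup>2) \<partial>m) \<le> ennreal ((1 + t) * q\<^sup>2 * (1 + t + (1 + 1 / t) * t\<^sup>2) + (1 + 1 / t) * (4 * t\<^sup>2))"
      using eps by (intro eventually_mono[OF eventually_at_right_less]) auto
  qed simp
  have "integrable m (\<lambda>x. (?U f x)\<^sup>2)"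
    by (rule integrableI_nonneg) (use le in \<open>auto intro: le_less_trans\<close>)
  moreover from this have "(\<integral>x. (?U f x)\<^sup>2 \<partial>m) \<le> q\<^sup>2"
    using le by (subst (asm) nn_integral_eq_integral) auto
  then have "sqrt (\<integral>x. (?U f x)\<^sup>2 \<partial>m) \<le> q" using q by (metis real_sqrt_le_mono real_sqrt_unique)
  ultimately show "L2_norm m (?U f) \<le> ereal q" by (simp add: L2_norm_def)
qed

section \<open>Exchangeable matrices\<close>

text \<open>The matrices \<open>a I + b J\<close> with \<open>J\<close> all ones. They form a
  commutative algebra containing the covariance, the precision and its diagonal blocks with their
  inverses, and the proposal covariance.\<close>

definition emat :: "real \<Rightarrow> real \<Rightarrow> real ^ 'n::finite ^ 'n" where
  "emat a b = (\<chi> i k. (if i = k then a else 0) + b)"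

lemma emat_mult_vec: "emat a b *v x = a *\<^sub>R x + (b * (\<Sum>i\<in>UNIV. x $ i)) *\<^sub>R 1"
  by (simp add: vec_eq_iff emat_def matrix_vector_mult_def distrib_right sum.distrib if_distrib[where f = "\<lambda>a. a * _"]
      sum_distrib_left cong: if_cong)

lemma emat_mult: "emat a b ** emat a' b' = (emat (a * a') (a * b' + b * a' + real CARD('n) * (b * b')) :: real ^ 'n::finite ^ 'n)"
proof -
  have "emat a b ** emat a' b' *v x = emat (a * a') (a * b' + b * a' + real CARD('n) * (b * b')) *v x" for x :: "real ^ 'n"
    by (simp add: matrix_vector_mul_assoc[symmetric] emat_mult_vec vec_eq_iff sum.distrib sum_distrib_left[symmetric] algebra_simps)
  then show ?thesis by (simp add: matrix_eq)
qed

lemma emat_mat: "emat a 0 = mat a"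
  by (simp add: emat_def mat_def vec_eq_iff)

lemma matrix_inv_eqI:
  fixes A B :: "real ^ 'n::finite ^ 'n"
  assumes "A ** B = mat 1" "B ** A = mat 1"
  shows "matrix_inv A = B"
proof -
  have "A ** matrix_inv A = mat 1 \<and> matrix_inv A ** A = mat 1"
    unfolding matrix_inv_def by (rule someI[of _ B]) (use assms in simp)
  then have "B ** (A ** matrix_inv A) = B" by simp
  then show ?thesis using assms by (simp add: matrix_mul_assoc)
qed

text \<open>The Sherman-Morrison formula for a multiple of the identity plus a multiple of
  \<open>J\<close>.\<close>

lemma matrix_inv_emat:
  assumes a: "a \<noteq> 0" and b: "a + real CARD('n) * b \<noteq> 0"
  shows "matrix_inv (emat a b :: real ^ 'n::finite ^ 'n) = emat (1 / a) (- b / (a * (a + real CARD('n) * b)))"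
proof (rule matrix_inv_eqI)
  have e: "a * (- b / (a * (a + real CARD('n) * b))) + b * (1 / a) + real CARD('n) * (b * (- b / (a * (a + real CARD('n) * b)))) = 0"
  proof -
    define K where "K = a + real CARD('n) * b"
    have "a * (- b / (a * K)) + real CARD('n) * (b * (- b / (a * K))) = (- b * K) / (a * K)"
      by (simp only: times_divide_eq_right add_divide_distrib[symmetric]) (simp add: K_def algebra_simps)
    also have "\<dots> = - b / a" using b by (simp add: K_def)
    finally show ?thesis unfolding K_def[symmetric] by simp
  qed
  then show "emat a b ** emat (1 / a) (- b / (a * (a + real CARD('n) * b))) = (mat 1 :: real ^ 'n ^ 'n)"
    using a by (simp add: emat_mult emat_mat)
  have "1 / a * b + - b / (a * (a + real CARD('n) * b)) * a + real CARD('n) * (- b / (a * (a + real CARD('n) * b)) * b) = 0"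
    using e by (simp add: mult_ac add_ac)
  then show "emat (1 / a) (- b / (a * (a + real CARD('n) * b))) ** emat a b = (mat 1 :: real ^ 'n ^ 'n)"
    using a by (simp add: emat_mult emat_mat)
qed

text \<open>The coordinate \<open>k\<close> stands for the direction of the all-ones vector, with
  eigenvalue \<open>a + n * b\<close>; its orthogonal complement has eigenvalue
  \<open>a\<close>.\<close>

definition eig :: "'n::finite \<Rightarrow> real \<Rightarrow> real \<Rightarrow> real ^ 'n \<Rightarrow> real" where
  "eig k a b e = (if e = axis k 1 then a + real CARD('n) * b else a)"

text \<open>\<open>f\<close> is any orthogonal map sending \<open>axis k 1\<close> to the normalised
  all-ones vector. Neither \<open>f\<close> nor \<open>k\<close> depends on \<open>a\<close> and
  \<open>b\<close>, so one rotation diagonalises all these matrices at once.\<close>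

lemma emat_diagonalize:
  obtains f :: "real ^ 'n::finite \<Rightarrow> real ^ 'n" and k
  where "orthogonal_transformation f"
    "\<And>a b x. emat a b *v f x = f (\<Sum>e\<in>Basis. (eig k a b e * (x \<bullet> e)) *\<^sub>R e)"
proof -
  define k :: 'n where "k = undefined"
  let ?n = "real CARD('n)"
  have n: "?n > 0" by simp
  define w :: "real ^ 'n" where "w = (1 / sqrt ?n) *\<^sub>R 1"
  have one: "norm (1 :: real ^ 'n) = sqrt ?n" by (simp add: norm_eq_sqrt_inner inner_vec_def)
  have "norm (axis k 1 :: real ^ 'n) = norm w" unfolding w_def by (simp add: norm_axis_1 one)
  then obtain f where f: "orthogonal_transformation f" "f (axis k (1::real)) = w"
    by (rule orthogonal_transformation_exists)
  have lin: "linear f" using f(1) by (rule orthogonal_transformation_linear)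
  have "emat a b *v f x = f (\<Sum>e\<in>Basis. (eig k a b e * (x \<bullet> e)) *\<^sub>R e)" for a b x
  proof -
    have "(\<Sum>i\<in>UNIV. f x $ i) = sqrt ?n * (w \<bullet> f x)"
      by (simp add: w_def inner_vec_def sum_divide_distrib[symmetric])
    also have "w \<bullet> f x = axis k 1 \<bullet> x" using f unfolding orthogonal_transformation_def by metis
    finally have s: "(\<Sum>i\<in>UNIV. f x $ i) = sqrt ?n * (x \<bullet> axis k 1)" by (simp add: inner_commute)
    have one': "(1::real ^ 'n) = sqrt ?n *\<^sub>R w" by (simp add: w_def)
    have "(b * (\<Sum>i\<in>UNIV. f x $ i)) *\<^sub>R 1 = (b * (sqrt ?n * (x \<bullet> axis k 1)) * sqrt ?n) *\<^sub>R w"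
      unfolding s by (subst one') (simp only: scaleR_scaleR)
    also have "b * (sqrt ?n * (x \<bullet> axis k 1)) * sqrt ?n = ?n * b * (x \<bullet> axis k 1)"
      using real_sqrt_mult_self[of ?n] by (simp add: mult_ac)
    finally have "emat a b *v f x = f (a *\<^sub>R x + (?n * b * (x \<bullet> axis k 1)) *\<^sub>R axis k 1)"
      by (simp add: emat_mult_vec linear_add[OF lin] linear_scale[OF lin] f(2))
    also have "a *\<^sub>R x + (?n * b * (x \<bullet> axis k 1)) *\<^sub>R axis k 1 = (\<Sum>e\<in>Basis. (eig k a b e * (x \<bullet> e)) *\<^sub>R e)"
    proof (rule euclidean_eqI)
      fix e :: "real ^ 'n" assume e: "e \<in> Basis"
      have "axis k (1::real) \<in> Basis" by (simp add: axis_in_Basis_iff)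
      then have "axis k 1 \<bullet> e = (if e = axis k (1::real) then 1 else 0)" using e by (auto simp: inner_Basis)
      then show "(a *\<^sub>R x + (?n * b * (x \<bullet> axis k 1)) *\<^sub>R axis k 1) \<bullet> e = (\<Sum>e\<in>Basis. (eig k a b e * (x \<bullet> e)) *\<^sub>R e) \<bullet> e"
        using e by (auto simp: inner_add_left eig_def algebra_simps)
    qed
    finally show ?thesis .
  qed
  then show ?thesis using that f(1) by blast
qed

lemma det_emat:
  fixes k :: "'n::finite"
  shows "det (emat a b :: real ^ 'n ^ 'n) = (\<Prod>e\<in>Basis. eig k a b e)"
proof -
  obtain f :: "real ^ 'n \<Rightarrow> real ^ 'n" and k' where f: "orthogonal_transformation f"
    and diag: "\<And>a b x. emat a b *v f x = f (\<Sum>e\<in>Basis. (eig k' a b e * (x \<bullet> e)) *\<^sub>R e)"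
    using emat_diagonalize by blast
  let ?D = "(\<chi> i j. if i = j then eig k' a b (axis i 1) else 0) :: real ^ 'n ^ 'n"
  let ?U = "matrix f"
  have lin: "linear f" using f by (rule orthogonal_transformation_linear)
  have B: "Basis = (\<lambda>i. axis i (1::real)) ` (UNIV :: 'n set)" by (auto simp: Basis_vec_def)
  have inj: "inj_on (\<lambda>i. axis i (1::real)) (UNIV :: 'n set)" by (auto simp: inj_on_def axis_eq_axis)
  have ax: "axis i (1::real) $ j = (if j = i then 1 else 0)" for i j :: 'n by (simp add: axis_def)
  have D: "?D *v x = (\<Sum>e\<in>Basis. (eig k' a b e * (x \<bullet> e)) *\<^sub>R e)" for x
    unfolding B sum.reindex[OF inj]
    by (simp add: vec_eq_iff matrix_vector_mult_def ax inner_axis if_distrib[where f = "\<lambda>a. a * _"] if_distrib[where f = "\<lambda>a. _ * a"] cong: if_cong)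
  have "emat a b ** ?U *v x = ?U ** ?D *v x" for x
    by (simp add: matrix_vector_mul_assoc[symmetric] fun_cong[OF matrix_vector_mul(2)[OF lin]] diag D)
  then have "emat a b ** ?U = ?U ** ?D" by (simp add: matrix_eq)
  then have "det (emat a b ** ?U) = det (?U ** ?D)" by (rule arg_cong)
  then have "det (emat a b :: real ^ 'n ^ 'n) * det ?U = det ?U * det ?D" unfolding det_mul .
  moreover have "det ?U \<noteq> 0"
    using orthogonal_transformation_det[OF f] by auto
  ultimately have "det (emat a b :: real ^ 'n ^ 'n) = det ?D" by simp
  also have "\<dots> = (\<Prod>i\<in>UNIV. eig k' a b (axis i 1))" by (subst det_diagonal) auto
  \<comment> \<open>The diagonalisation brings its own index \<open>k'\<close>. The product is
    \<open>(a + n * b) * a^(n - 1)\<close> for every index, so \<open>k'\<close> can be exchanged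
    for the given \<open>k\<close>.\<close>
  also have "\<dots> = (\<Prod>i\<in>UNIV. if i = k' then a + real CARD('n) * b else a)" by (simp add: eig_def axis_eq_axis)
  also have "\<dots> = (a + real CARD('n) * b) * a ^ (CARD('n) - 1)" by (simp add: prod.If_cases Compl_eq_Diff_UNIV card_Diff_subset)
  also have "\<dots> = (\<Prod>i\<in>UNIV. if i = k then a + real CARD('n) * b else a)" by (simp add: prod.If_cases Compl_eq_Diff_UNIV card_Diff_subset)
  also have "\<dots> = (\<Prod>i\<in>UNIV. eig k a b (axis i 1))" by (simp add: eig_def axis_eq_axis)
  also have "\<dots> = (\<Prod>e\<in>Basis. eig k a b e)" unfolding B prod.reindex[OF inj] by simp
  finally show ?thesis .
qed

lemma inner_emat:
  fixes f :: "real ^ 'n::finite \<Rightarrow> real ^ 'n"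
  assumes f: "orthogonal_transformation f"
    and diag: "\<And>a b x. emat a b *v f x = f (\<Sum>e\<in>Basis. (eig k a b e * (x \<bullet> e)) *\<^sub>R e)"
  shows "f y \<bullet> (emat a b *v f x) = (\<Sum>e\<in>Basis. eig k a b e * (x \<bullet> e) * (y \<bullet> e))"
proof -
  have "f y \<bullet> (emat a b *v f x) = y \<bullet> (\<Sum>e\<in>Basis. (eig k a b e * (x \<bullet> e)) *\<^sub>R e)"
    unfolding diag using f by (simp add: orthogonal_transformation_def)
  then show ?thesis by (simp add: inner_sum_right mult_ac)
qed

lemma eig_pos: "0 < a \<Longrightarrow> 0 < a + real CARD('n) * b \<Longrightarrow> 0 < eig k a b (e :: real ^ 'n::finite)"
  by (simp add: eig_def)

section \<open>Normal laws with exchangeable covariance\<close>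

lemma sqrt_prod: "sqrt (prod f A) = (\<Prod>x\<in>A. sqrt (f x))"
  by (induction A rule: infinite_finite_induct) (auto simp: real_sqrt_mult)

text \<open>In the eigenbasis the quadratic form is a sum and the determinant a product over
  coordinates, so the density factors.\<close>

lemma mvn_density_emat:
  fixes f :: "real ^ 'n::finite \<Rightarrow> real ^ 'n"
  assumes f: "orthogonal_transformation f"
    and diag: "\<And>a b x. emat a b *v f x = f (\<Sum>e\<in>Basis. (eig k a b e * (x \<bullet> e)) *\<^sub>R e)"
    and a: "0 < a" and b: "0 < a + real CARD('n) * b"
  shows "mvn_density m (emat a b) (m + f y) = gauss_prod (\<lambda>_. 0) (\<lambda>e. sqrt (eig k a b e)) y"
proof -
  have inv: "eig k (1 / a) (- b / (a * (a + real CARD('n) * b))) e = 1 / eig k a b e" for e :: "real ^ 'n"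
  proof -
    define K where "K = a + real CARD('n) * b"
    have K: "K \<noteq> 0" using b by (simp add: K_def)
    have "1 / a + real CARD('n) * (- b / (a * K)) = (K - real CARD('n) * b) / (a * K)"
      using a K by (simp add: diff_divide_distrib)
    also have "\<dots> = 1 / K" using a by (simp add: K_def)
    finally show ?thesis by (simp add: eig_def K_def[symmetric])
  qed
  have pos: "eig k a b e > 0" for e :: "real ^ 'n" using a b by (rule eig_pos)
  have q: "f y \<bullet> (matrix_inv (emat a b) *v f y) = (\<Sum>e\<in>Basis. (y \<bullet> e)\<^sup>2 / eig k a b e)"
  proof -
    have mi: "matrix_inv (emat a b :: real ^ 'n ^ 'n) = emat (1 / a) (- b / (a * (a + real CARD('n) * b)))"
      using a b by (intro matrix_inv_emat) auto
    show ?thesis unfolding mi inner_emat[OF f diag] inv by (simp add: power2_eq_square)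
  qed
  have d: "sqrt ((2 * pi) ^ CARD('n) * det (emat a b :: real ^ 'n ^ 'n)) = (\<Prod>e\<in>(Basis :: (real ^ 'n) set). sqrt (2 * pi * eig k a b e))"
  proof -
    have "(2 * pi) ^ CARD('n) * det (emat a b :: real ^ 'n ^ 'n) = (\<Prod>e\<in>(Basis :: (real ^ 'n) set). 2 * pi * eig k a b e)"
      by (simp add: det_emat[of a b k] prod.distrib)
    then show ?thesis by (simp only: sqrt_prod)
  qed
  have "mvn_density m (emat a b) (m + f y) = exp (- (\<Sum>e\<in>Basis. (y \<bullet> e)\<^sup>2 / eig k a b e) / 2) / (\<Prod>e\<in>(Basis :: (real ^ 'n) set). sqrt (2 * pi * eig k a b e))"
    unfolding mvn_density_def d by (simp add: q)
  also have "exp (- (\<Sum>e\<in>Basis. (y \<bullet> e)\<^sup>2 / eig k a b e) / 2) = (\<Prod>e\<in>Basis. exp (- (y \<bullet> e)\<^sup>2 / (2 * eig k a b e)))"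
    by (simp add: exp_sum[symmetric] sum_divide_distrib sum_negf mult.commute)
  finally show ?thesis
    unfolding gauss_prod_def normal_density_def prod_dividef[symmetric] using pos by (simp add: less_imp_le)
qed

lemma nn_integral_orthogonal_shift:
  fixes f :: "'a::euclidean_space \<Rightarrow> 'a"
  assumes f: "orthogonal_transformation f" and [measurable]: "F \<in> borel_measurable borel"
  shows "(\<integral>\<^sup>+x. F (m + f x) \<partial>lborel) = (\<integral>\<^sup>+x. F x \<partial>lborel)"
  using nn_integral_orthogonal[OF f, of "\<lambda>x. F (m + x)"] nn_integral_lborel_shift[of F m] by simp

lemma mvn_density_nonneg_emat:
  assumes "0 < a" "0 < a + real CARD('n) * b"
  shows "0 < mvn_density m (emat a b :: real ^ 'n::finite ^ 'n) x"
proof -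
  obtain f :: "real ^ 'n \<Rightarrow> real ^ 'n" and k where f: "orthogonal_transformation f"
    and diag: "\<And>a b x. emat a b *v f x = f (\<Sum>e\<in>Basis. (eig k a b e * (x \<bullet> e)) *\<^sub>R e)"
    using emat_diagonalize by blast
  obtain y where "x - m = f y" using orthogonal_transformation_surj[OF f] by (metis surjD)
  then have "x = m + f y" by (simp add: algebra_simps)
  then show ?thesis
    using mvn_density_emat[OF f diag assms, of m y] gauss_prod_pos[of "\<lambda>e. sqrt (eig k a b e)" "\<lambda>_. 0" y] eig_pos[OF assms]
    by simp
qed

lemma mvn_density_measurable[measurable]: "mvn_density m S \<in> borel_measurable borel"
proof -
  have "(\<lambda>x. matrix_inv S *v (x - m)) \<in> borel_measurable borel"
    by (intro borel_measurable_continuous_onI continuous_intros linear_continuous_on_compose[OF _ matrix_vector_mul_linear]) 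
  then show ?thesis unfolding mvn_density_def by measurable
qed

lemma prob_space_mvn_emat:
  assumes "0 < a" "0 < a + real CARD('n) * b"
  shows "prob_space (mvn m (emat a b :: real ^ 'n::finite ^ 'n))"
    and "(\<integral>\<^sup>+x. ennreal (norm x) \<partial>mvn 0 (emat a b :: real ^ 'n::finite ^ 'n)) < \<infinity>"
proof -
  obtain f :: "real ^ 'n \<Rightarrow> real ^ 'n" and k where f: "orthogonal_transformation f"
    and diag: "\<And>a b x. emat a b *v f x = f (\<Sum>e\<in>Basis. (eig k a b e * (x \<bullet> e)) *\<^sub>R e)"
    using emat_diagonalize by blast
  note pos = eig_pos[OF assms, of k]
  have "(\<integral>\<^sup>+x. ennreal (mvn_density m (emat a b) x) \<partial>lborel) = (\<integral>\<^sup>+x. ennreal (mvn_density m (emat a b) (m + f x)) \<partial>lborel)"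
    by (rule nn_integral_orthogonal_shift[OF f, symmetric]) measurable
  also have "\<dots> = 1"
    unfolding mvn_density_emat[OF f diag assms] using pos by (intro nn_integral_gauss_prod) simp
  finally show "prob_space (mvn m (emat a b :: real ^ 'n::finite ^ 'n))"
    by (intro prob_spaceI) (simp add: mvn_def emeasure_density)
  have "(\<integral>\<^sup>+x. ennreal (norm x) \<partial>mvn 0 (emat a b :: real ^ 'n::finite ^ 'n)) = (\<integral>\<^sup>+x. ennreal (mvn_density 0 (emat a b :: real ^ 'n ^ 'n) x) * ennreal (norm x) \<partial>lborel)"
    unfolding mvn_def by (subst nn_integral_density) auto
  also have "\<dots> = (\<integral>\<^sup>+x. ennreal (mvn_density 0 (emat a b :: real ^ 'n ^ 'n) (0 + f x)) * ennreal (norm (0 + f x)) \<partial>lborel)"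
    by (rule nn_integral_orthogonal_shift[OF f, symmetric]) measurable
  also have "\<dots> = (\<integral>\<^sup>+x. ennreal (norm x * gauss_prod (\<lambda>_. 0) (\<lambda>e. sqrt (eig k a b e)) x) \<partial>lborel)"
    unfolding mvn_density_emat[OF f diag assms]
    by (simp add: orthogonal_transformation_norm[OF f] ennreal_mult'[symmetric] mult.commute)
  also have "\<dots> < \<infinity>" using pos by (intro gauss_prod_norm_moment) simp
  finally show "(\<integral>\<^sup>+x. ennreal (norm x) \<partial>mvn 0 (emat a b :: real ^ 'n::finite ^ 'n)) < \<infinity>" .
qed

section \<open>The exchangeable Gaussian and its block conditionals\<close>

lemma sum_vec_eq_inner: "(\<Sum>i\<in>UNIV. x $ i) = x \<bullet> 1" for x :: "real ^ 'n::finite"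
  by (simp add: inner_vec_def)

lemma emat_symmetric: "x \<bullet> (emat a b *v y) = y \<bullet> (emat a b *v x)"
  by (simp add: emat_mult_vec sum_vec_eq_inner inner_add_right inner_commute)

lemma block_one: "block 1 j = 1"
  by (simp add: vec_eq_iff block_def)

lemma block_emat_emb: "block (emat a b *v emb j w) j = emat a b *v w"
  by (simp add: emat_mult_vec sum_vec_eq_inner block_add block_scaleR block_emb inner_emb block_one)

lemma gradient_eqI:
  fixes f :: "'a::real_inner \<Rightarrow> real"
  assumes "GDERIV f x :> D"
  shows "gradient f x = D"
  unfolding gradient_def
proof (rule the_equality)
  fix D' assume "GDERIV f x :> D'"
  then have "(\<lambda>h. h \<bullet> D') = (\<lambda>h. h \<bullet> D)"
    using assms unfolding gderiv_def by (rule has_derivative_unique)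
  then show "D' = D" by (metis inner_commute vector_eq_rdot)
qed fact

locale exch =
  fixes \<mu> :: "real ^ ('d::{finite, linorder} \<times> 's::finite)" and \<zeta> h :: real
  assumes \<zeta>: "0 \<le> \<zeta>" "\<zeta> < 1" and d2: "2 \<le> CARD('d)"
    and h_eq: "h = (1 - \<zeta>) / sqrt (10 * CARD('s))"
begin

definition "N = real CARD('d \<times> 's)"
definition "s = real CARD('s)"
definition "d = real CARD('d)"
text \<open>With these constants the precision matrix is \<open>\<alpha> (I - \<beta> J)\<close>,
  and \<open>1 - N * \<beta>\<close> and \<open>1 - s * \<beta>\<close> are the smallest
  eigenvalues, relative to \<open>\<alpha>\<close>, of the full precision and of its diagonal
  blocks.\<close>

definition "\<alpha> = 1 / (1 - \<zeta>)"
definition "\<beta> = \<zeta> / (1 + (N - 1) * \<zeta>)"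

lemma sizes: "N = d * s" "d \<ge> 2" "s \<ge> 1" "N \<ge> 2 * s" "N \<ge> 2"
proof -
  show 1: "N = d * s" by (simp add: N_def d_def s_def)
  show 2: "d \<ge> 2" using d2 by (simp add: d_def)
  show 3: "s \<ge> 1" by (simp add: s_def Suc_le_eq)
  show 4: "N \<ge> 2 * s" unfolding 1 using 2 3 by (intro mult_right_mono) auto
  show "N \<ge> 2" using 3 4 by linarith
qed

lemma \<alpha>_pos: "\<alpha> > 0" using \<zeta> by (simp add: \<alpha>_def)

lemma denom_pos: "1 + (N - 1) * \<zeta> > 0" "1 + (N - s - 1) * \<zeta> > 0"
proof -
  have "0 \<le> (N - 1) * \<zeta>" using sizes \<zeta> by (intro mult_nonneg_nonneg) auto
  then show "1 + (N - 1) * \<zeta> > 0" by linarith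
  have "0 \<le> (N - s - 1) * \<zeta>" using sizes(3,4) \<zeta> by (intro mult_nonneg_nonneg) auto
  then show "1 + (N - s - 1) * \<zeta> > 0" by linarith
qed

lemma \<beta>_nonneg: "\<beta> \<ge> 0" using \<zeta> denom_pos by (simp add: \<beta>_def)

lemma one_minus_N\<beta>: "1 - N * \<beta> = (1 - \<zeta>) / (1 + (N - 1) * \<zeta>)"
  using denom_pos by (simp add: \<beta>_def field_simps)

lemma one_minus_s\<beta>: "1 - s * \<beta> = (1 + (N - s - 1) * \<zeta>) / (1 + (N - 1) * \<zeta>)"
  using denom_pos by (simp add: \<beta>_def field_simps)

lemma N\<beta>_less: "N * \<beta> < 1"
  using one_minus_N\<beta> \<zeta> denom_pos by (smt (verit) divide_pos_pos)

text \<open>At least two blocks fit into \<open>N\<close>, and \<open>N * \<beta> < 1\<close>.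
  Consequently the eigenvalues of a diagonal block of the precision lie between
  \<open>\<alpha> / 2\<close> and \<open>\<alpha>\<close>.\<close>

lemma s\<beta>_half: "s * \<beta> \<le> 1 / 2"
proof -
  have "2 * s * \<beta> \<le> N * \<beta>" using sizes \<beta>_nonneg by (intro mult_right_mono) auto
  then show ?thesis using N\<beta>_less by linarith
qed

definition Sg :: "real ^ ('d \<times> 's) ^ ('d \<times> 's)" where "Sg = emat (1 - \<zeta>) \<zeta>"
definition Qg :: "real ^ ('d \<times> 's) ^ ('d \<times> 's)" where "Qg = emat \<alpha> (- \<alpha> * \<beta>)"
definition Qs :: "real ^ 's ^ 's" where "Qs = emat \<alpha> (- \<alpha> * \<beta>)"
text \<open>The inverse of a diagonal block of the precision, which is the covariance of one block
  given the others.\<close>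

definition Qi :: "real ^ 's ^ 's" where "Qi = emat (1 / \<alpha>) (\<beta> / (\<alpha> * (1 - s * \<beta>)))"

lemma inv_Sg: "matrix_inv Sg = Qg"
proof -
  have n: "1 - \<zeta> \<noteq> 0" "1 - \<zeta> + N * \<zeta> > 0" using \<zeta> denom_pos by (auto simp: algebra_simps)
  have "matrix_inv Sg = emat (1 / (1 - \<zeta>)) (- \<zeta> / ((1 - \<zeta>) * (1 - \<zeta> + N * \<zeta>)))"
    unfolding Sg_def N_def by (rule matrix_inv_emat) (use n in \<open>auto simp: N_def\<close>)
  also have "- \<zeta> / ((1 - \<zeta>) * (1 - \<zeta> + N * \<zeta>)) = - \<alpha> * \<beta>"
    by (simp add: \<alpha>_def \<beta>_def algebra_simps)
  finally show ?thesis by (simp add: Qg_def \<alpha>_def)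
qed

lemma Qs_pos: "\<alpha> + s * (- \<alpha> * \<beta>) > 0"
proof -
  have "\<alpha> + s * (- \<alpha> * \<beta>) = \<alpha> * (1 - s * \<beta>)" by (simp add: algebra_simps)
  then show ?thesis using \<alpha>_pos s\<beta>_half by simp
qed

lemma Qs_Qi: "Qs ** Qi = mat 1" and Qi_Qs: "Qi ** Qs = mat 1"
proof -
  have nz: "1 - s * \<beta> \<noteq> 0" "\<alpha> \<noteq> 0" using s\<beta>_half \<alpha>_pos by auto
  have e: "\<alpha> * (\<beta> / (\<alpha> * (1 - s * \<beta>))) + - \<alpha> * \<beta> * (1 / \<alpha>) + s * (- \<alpha> * \<beta> * (\<beta> / (\<alpha> * (1 - s * \<beta>)))) = 0"
  proof -
    have "\<alpha> * (\<beta> / (\<alpha> * (1 - s * \<beta>))) + - \<alpha> * \<beta> * (1 / \<alpha>) + s * (- \<alpha> * \<beta> * (\<beta> / (\<alpha> * (1 - s * \<beta>))))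
      = \<beta> / (1 - s * \<beta>) - \<beta> - s * \<beta> * (\<beta> / (1 - s * \<beta>))" using nz by simp
    also have "\<dots> = \<beta> / (1 - s * \<beta>) * (1 - s * \<beta>) - \<beta>"
      by (simp only: right_diff_distrib mult_1_right) (simp only: mult.commute)
    finally show ?thesis using nz by simp
  qed
  show "Qs ** Qi = mat 1"
    unfolding Qs_def Qi_def emat_mult s_def[symmetric] e using nz by (simp add: emat_mat)
  have e': "1 / \<alpha> * (- \<alpha> * \<beta>) + \<beta> / (\<alpha> * (1 - s * \<beta>)) * \<alpha> + s * (\<beta> / (\<alpha> * (1 - s * \<beta>)) * (- \<alpha> * \<beta>)) = 0"
    using e by (simp add: mult_ac add_ac)
  show "Qi ** Qs = mat 1"
    unfolding Qs_def Qi_def emat_mult s_def[symmetric] e' using nz by (simp add: emat_mat)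
qed

lemma Qs_Qi_vec: "Qs *v (Qi *v x) = x" "Qi *v (Qs *v x) = x"
  by (simp_all add: matrix_vector_mul_assoc Qs_Qi Qi_Qs)

lemma inv_Qi: "matrix_inv Qi = Qs"
  using Qi_Qs Qs_Qi by (rule matrix_inv_eqI)

lemma Qi_pos: "0 < 1 / \<alpha>" "0 < 1 / \<alpha> + s * (\<beta> / (\<alpha> * (1 - s * \<beta>)))"
proof -
  show "0 < 1 / \<alpha>" using \<alpha>_pos by simp
  moreover have "0 \<le> s * (\<beta> / (\<alpha> * (1 - s * \<beta>)))"
    using \<alpha>_pos \<beta>_nonneg s\<beta>_half sizes by (intro mult_nonneg_nonneg divide_nonneg_nonneg) auto
  ultimately show "0 < 1 / \<alpha> + s * (\<beta> / (\<alpha> * (1 - s * \<beta>)))" by linarith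
qed

lemma Sg_pos: "0 < 1 - \<zeta>" "0 < 1 - \<zeta> + real CARD('d \<times> 's) * \<zeta>"
  using \<zeta> by (auto intro: add_pos_nonneg)

abbreviation p :: "real ^ ('d \<times> 's) \<Rightarrow> real" where "p \<equiv> mvn_density \<mu> Sg"

lemma p_pos: "0 < p x"
  unfolding Sg_def by (rule mvn_density_nonneg_emat[OF Sg_pos])

text \<open>\<open>score x j\<close> is minus the \<open>j\<close>-th block of the gradient of the log density, and \<open>center x j\<close> is the
  mean of block \<open>j\<close> conditionally on the other blocks.\<close>

definition score :: "real ^ ('d \<times> 's) \<Rightarrow> 'd \<Rightarrow> real ^ 's" where
  "score x j = block (Qg *v (x - \<mu>)) j"

definition center :: "real ^ ('d \<times> 's) \<Rightarrow> 'd \<Rightarrow> real ^ 's" where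
  "center x j = block x j - Qi *v score x j"

lemma linear_continuous_mat: "continuous_on UNIV (\<lambda>x. A *v x)" for A :: "real ^ 'n::finite ^ 'm::finite"
  by (intro linear_continuous_on matrix_vector_mul_bounded_linear)

lemma matvec_meas[measurable (raw)]:
  fixes A :: "real ^ 'n::finite ^ 'm::finite"
  shows "f \<in> borel_measurable M \<Longrightarrow> (\<lambda>x. A *v f x) \<in> borel_measurable M"
  by (rule measurable_compose[OF _ borel_measurable_continuous_onI[OF linear_continuous_mat]])

lemma score_meas[measurable (raw)]:
  assumes [measurable]: "f \<in> borel_measurable M"
  shows "(\<lambda>x. score (f x) j) \<in> borel_measurable M"
  unfolding score_def by measurable

lemma center_meas[measurable (raw)]:
  assumes [measurable]: "f \<in> borel_measurable M"
  shows "(\<lambda>x. center (f x) j) \<in> borel_measurable M"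
  unfolding center_def by measurable

lemma score_block_upd: "score (block_upd x j z) j = score x j + Qs *v (z - block x j)"
proof -
  have e: "block_upd x j z - \<mu> = (x - \<mu>) + emb j (z - block x j)" by (simp add: block_upd_eq)
  show ?thesis
    unfolding score_def e matrix_vector_right_distrib block_add Qg_def Qs_def block_emat_emb ..
qed

text \<open>Although computed from all of \<open>x\<close>, the centre depends on the other blocks
  only: the shift of the block and the induced change of the score cancel.\<close>

lemma center_block_upd: "center (block_upd x j z) j = center x j"
  unfolding center_def score_block_upd block_block_upd
  by (simp add: matrix_vector_right_distrib Qs_Qi_vec algebra_simps)

lemma score_center: "score x j = Qs *v (block x j - center x j)"
  unfolding center_def by (simp add: Qs_Qi_vec)

lemma quad_emb:
  "(x + emb j w - \<mu>) \<bullet> (Qg *v (x + emb j w - \<mu>)) = (x - \<mu>) \<bullet> (Qg *v (x - \<mu>)) + 2 * (w \<bullet> score x j) + w \<bullet> (Qs *v w)"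
proof -
  have e: "x + emb j w - \<mu> = (x - \<mu>) + emb j w" by simp
  have 1: "emb j w \<bullet> (Qg *v (x - \<mu>)) = w \<bullet> score x j" by (simp add: inner_emb score_def)
  have 2: "(x - \<mu>) \<bullet> (Qg *v emb j w) = w \<bullet> score x j" using emat_symmetric 1 unfolding Qg_def by metis
  have 3: "emb j w \<bullet> (Qg *v emb j w) = w \<bullet> (Qs *v w)" by (simp add: inner_emb Qg_def Qs_def block_emat_emb)
  show ?thesis unfolding e by (simp add: matrix_vector_right_distrib inner_add_left inner_add_right 1 2 3)
qed

lemma p_eq: "p x = exp (- ((x - \<mu>) \<bullet> (Qg *v (x - \<mu>))) / 2) / sqrt ((2 * pi) ^ CARD('d \<times> 's) * det Sg)"
  unfolding mvn_density_def inv_Sg ..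

lemma p_block_upd: "p (block_upd x j z) = p x * exp (- (2 * ((z - block x j) \<bullet> score x j) + (z - block x j) \<bullet> (Qs *v (z - block x j))) / 2)"
  unfolding p_eq block_upd_eq quad_emb by (simp add: exp_add[symmetric] add_divide_distrib diff_divide_distrib)

text \<open>The score vanishes at the centre, so the linear term disappears and the density along
  the fibre is a Gaussian with precision \<open>Qs\<close>.\<close>

lemma p_fibre: "p (block_upd x j (center x j + v)) = p (block_upd x j (center x j)) * exp (- (v \<bullet> (Qs *v v)) / 2)"
proof -
  let ?y = "block_upd x j (center x j)"
  have "score ?y j = 0" unfolding score_center[of ?y] center_block_upd block_block_upd by simp
  then show ?thesis
    using p_block_upd[of ?y j "center x j + v"] by (simp add: block_block_upd block_upd_block_upd)
qed

lemma mala_mean_eq: "mala_mean p j h x = block x j - h *\<^sub>R score x j"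
proof -
  let ?a = "block x j"
  have ln: "(\<lambda>z. ln (p (block_upd x j z))) = (\<lambda>z. ln (p x) - (z - ?a) \<bullet> score x j - (z - ?a) \<bullet> (Qs *v (z - ?a)) / 2)"
    unfolding p_block_upd by (rule ext, simp add: ln_mult_pos p_pos add_divide_distrib diff_divide_distrib)
  have "GDERIV (\<lambda>z. ln (p (block_upd x j z))) ?a :> - score x j"
    unfolding ln gderiv_def
    by (auto intro!: derivative_eq_intros bounded_linear.has_derivative[OF matrix_vector_mul_bounded_linear])
  then show ?thesis unfolding mala_mean_def by (simp add: gradient_eqI)
qed

lemma h_pos: "h > 0" unfolding h_eq using \<zeta> by simp

section \<open>Proposal, acceptance and conditional target as functions of the new block\<close>

definition cond_prop :: "'d \<Rightarrow> real ^ ('d \<times> 's) \<Rightarrow> real ^ 's \<Rightarrow> real" where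
  "cond_prop j x z = mvn_density (mala_mean p j h x) (mat (2 * h)) z"

definition cond_acc :: "'d \<Rightarrow> real ^ ('d \<times> 's) \<Rightarrow> real ^ 's \<Rightarrow> real" where
  "cond_acc j x z = mala_accept p j h x (block_upd x j z)"

definition cond_move :: "'d \<Rightarrow> real ^ ('d \<times> 's) \<Rightarrow> real ^ 's \<Rightarrow> real" where
  "cond_move j x z = cond_prop j x z * cond_acc j x z"

definition cond_target :: "'d \<Rightarrow> real ^ ('d \<times> 's) \<Rightarrow> real ^ 's \<Rightarrow> real" where
  "cond_target j x z = mvn_density (center x j) Qi z"

lemma mvn_density_meas2:
  fixes S :: "real ^ 'n::finite ^ 'n"
  assumes [measurable]: "f \<in> borel_measurable M" "g \<in> borel_measurable M"
  shows "(\<lambda>x. mvn_density (f x) S (g x)) \<in> borel_measurable M"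
  unfolding mvn_density_def by measurable

lemma mala_mean_meas[measurable (raw)]:
  assumes [measurable]: "f \<in> borel_measurable M"
  shows "(\<lambda>x. mala_mean p j h (f x)) \<in> borel_measurable M"
  unfolding mala_mean_eq by measurable

lemma prop_density_meas[measurable (raw)]:
  assumes [measurable]: "f \<in> borel_measurable M" "g \<in> borel_measurable M"
  shows "(\<lambda>x. mala_prop_density p j h (f x) (g x)) \<in> borel_measurable M"
  unfolding mala_prop_density_def by (intro mvn_density_meas2) measurable

lemma accept_meas[measurable (raw)]:
  assumes [measurable]: "f \<in> borel_measurable M" "g \<in> borel_measurable M"
  shows "(\<lambda>x. mala_accept p j h (f x) (g x)) \<in> borel_measurable M"
  unfolding mala_accept_def by measurable

lemma cond_prop_meas[measurable (raw)]:
  assumes [measurable]: "f \<in> borel_measurable M" "g \<in> borel_measurable M"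
  shows "(\<lambda>x. cond_prop j (f x) (g x)) \<in> borel_measurable M"
  unfolding cond_prop_def by (intro mvn_density_meas2) measurable

lemma cond_acc_meas[measurable (raw)]:
  assumes [measurable]: "f \<in> borel_measurable M" "g \<in> borel_measurable M"
  shows "(\<lambda>x. cond_acc j (f x) (g x)) \<in> borel_measurable M"
  unfolding cond_acc_def by measurable

lemma cond_move_meas[measurable (raw)]:
  assumes [measurable]: "f \<in> borel_measurable M" "g \<in> borel_measurable M"
  shows "(\<lambda>x. cond_move j (f x) (g x)) \<in> borel_measurable M"
  unfolding cond_move_def by measurable

lemma cond_target_meas[measurable (raw)]:
  assumes [measurable]: "f \<in> borel_measurable M" "g \<in> borel_measurable M"
  shows "(\<lambda>x. cond_target j (f x) (g x)) \<in> borel_measurable M"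
  unfolding cond_target_def by (intro mvn_density_meas2) measurable

lemma mvn_density_pos_2h: "0 < mvn_density m (mat (2 * h)) z" for m z :: "real ^ 's"
  unfolding emat_mat[symmetric] using h_pos by (intro mvn_density_nonneg_emat) auto

lemma cond_prop_pos: "0 < cond_prop j x z" unfolding cond_prop_def by (rule mvn_density_pos_2h)

lemma cond_acc_bounds: "0 \<le> cond_acc j x z" "cond_acc j x z \<le> 1"
  unfolding cond_acc_def mala_accept_def mala_prop_density_def
  using p_pos mvn_density_pos_2h by (auto simp: less_imp_le)

lemma cond_move_nonneg: "0 \<le> cond_move j x z" unfolding cond_move_def using cond_prop_pos cond_acc_bounds by (simp add: less_imp_le)

lemma cond_move_le: "cond_move j x z \<le> cond_prop j x z"
  unfolding cond_move_def using cond_prop_pos[of j x z] cond_acc_bounds[of j x z] by (simp add: mult_left_le)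

lemma cond_prop_int: "(\<integral>\<^sup>+z. ennreal (cond_prop j x z) \<partial>lborel) = 1"
proof -
  have "prob_space (mvn (mala_mean p j h x) (emat (2 * h) 0))" using h_pos by (intro prob_space_mvn_emat) auto
  then show ?thesis
    using prob_space.emeasure_space_1 by (fastforce simp: mvn_def emat_mat cond_prop_def emeasure_density)
qed

end

text \<open>\<open>f\<close> maps the standard basis to a common eigenbasis of the exchangeable matrices on a block.\<close>

locale exch_fibre = exch \<mu> \<zeta> h for \<mu> :: "real ^ ('d::{finite, linorder} \<times> 's::finite)" and \<zeta> h +
  fixes f :: "real ^ 's::finite \<Rightarrow> real ^ 's" and k :: 's
  assumes f: "orthogonal_transformation f"
    and diag: "\<And>a b x. emat a b *v f x = f (\<Sum>e\<in>Basis. (eig k a b e * (x \<bullet> e)) *\<^sub>R e)"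
begin

lemma lin_f: "linear f" using f by (rule orthogonal_transformation_linear)

definition l :: "real ^ 's \<Rightarrow> real" where "l = eig k \<alpha> (- \<alpha> * \<beta>)"

text \<open>Centred and rotated, the update on a fibre is MALA for a diagonal precision whose
  entries are the eigenvalues \<open>\<alpha>\<close> and \<open>\<alpha> (1 - s \<beta>)\<close>.
  Since \<open>h * \<alpha> = 1 / sqrt (10 * s)\<close> and both eigenvalues lie between
  \<open>\<alpha> / 2\<close> and \<open>\<alpha>\<close>, the two step-size conditions
  hold.\<close>

sublocale diag_mala l h
proof
  show "h > 0" by (rule h_pos)
  show "0 < l e" for e unfolding l_def using \<alpha>_pos Qs_pos by (intro eig_pos) (auto simp: s_def)
  have ha: "h * \<alpha> = 1 / sqrt (10 * s)" using \<zeta> by (simp add: h_eq \<alpha>_def s_def)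
  have D: "real (10 * DIM(real ^ 's)) = 10 * s" by (simp add: s_def)
  have le: "l e \<le> \<alpha>" "\<alpha> / 2 \<le> l e" for e
  proof -
    have "\<alpha> + s * (- \<alpha> * \<beta>) = \<alpha> * (1 - s * \<beta>)" by (simp add: algebra_simps)
    moreover have "\<alpha> * (1 - s * \<beta>) \<le> \<alpha> * 1" "\<alpha> * (1 / 2) \<le> \<alpha> * (1 - s * \<beta>)"
      using \<alpha>_pos s\<beta>_half \<beta>_nonneg sizes by (auto intro!: mult_left_mono)
    ultimately show "l e \<le> \<alpha>" "\<alpha> / 2 \<le> l e" using \<alpha>_pos by (auto simp: l_def eig_def s_def)
  qed
  show "h * l e \<le> 1 / sqrt (10 * DIM(real ^ 's))" for e
    unfolding D ha[symmetric] using le h_pos by (intro mult_left_mono) auto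
  show "1 / (2 * sqrt (10 * DIM(real ^ 's))) \<le> h * l e" for e
  proof -
    have "1 / (2 * sqrt (10 * s)) = h * (\<alpha> / 2)" using ha by simp
    also have "\<dots> \<le> h * l e" using le h_pos by (intro mult_left_mono) auto
    finally show ?thesis unfolding D .
  qed
qed

lemma eig_Qi: "eig k (1 / \<alpha>) (\<beta> / (\<alpha> * (1 - s * \<beta>))) e = 1 / l e" for e :: "real ^ 's"
proof -
  have nz: "1 - s * \<beta> \<noteq> 0" "\<alpha> \<noteq> 0" using s\<beta>_half \<alpha>_pos by auto
  have "1 / \<alpha> + s * (\<beta> / (\<alpha> * (1 - s * \<beta>))) = ((1 - s * \<beta>) + s * \<beta>) / (\<alpha> * (1 - s * \<beta>))"
    using nz by (simp only: add_divide_distrib) simp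
  also have "\<dots> = 1 / (\<alpha> + s * (- \<alpha> * \<beta>))" by (simp add: algebra_simps)
  finally show ?thesis by (simp add: eig_def l_def s_def)
qed

lemma target_dens_eq: "mvn_density y Qi (y + f v) = target_dens v"
  unfolding Qi_def using Qi_pos mvn_density_emat[OF f diag, of "1 / \<alpha>" "\<beta> / (\<alpha> * (1 - s * \<beta>))" y v]
  by (simp add: s_def[symmetric] eig_Qi target_dens_def real_sqrt_divide)

lemma target_dens_exp: "target_dens v = target_dens 0 * exp (- (f v \<bullet> (Qs *v f v)) / 2)"
proof -
  have gv: "target_dens v = exp (- (f v \<bullet> (Qs *v f v)) / 2) / sqrt ((2 * pi) ^ CARD('s) * det Qi)" for v
    using target_dens_eq[of 0 v] by (simp add: mvn_density_def inv_Qi)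
  show ?thesis unfolding gv[of v] gv[of 0] using linear_0[OF lin_f] by simp
qed

lemma p_fibre_target_dens: "p (block_upd x j (center x j + f v)) = p (block_upd x j (center x j)) / target_dens 0 * target_dens v"
  unfolding p_fibre target_dens_exp[of v] using target_dens_pos[of 0] by simp

lemma cond_target_fibre: "center x j = y \<Longrightarrow> cond_target j x (y + f v) = target_dens v"
  unfolding cond_target_def by (simp add: target_dens_eq)

lemma f_drift: "f (drift u) = f u - h *\<^sub>R (Qs *v f u)"
proof -
  have "drift u = u - h *\<^sub>R (\<Sum>e\<in>Basis. (l e * (u \<bullet> e)) *\<^sub>R e)"
    by (rule euclidean_eqI) (simp add: drift_inner inner_diff_left algebra_simps)
  then show ?thesis
    by (simp add: linear_diff[OF lin_f] linear_scale[OF lin_f] Qs_def diag l_def)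
qed

lemma mala_mean_fibre:
  assumes "block x j = center x j + f u"
  shows "mala_mean p j h x = center x j + f (drift u)"
  unfolding mala_mean_eq score_center f_drift using assms by simp

lemma prop_dens_eq: "mvn_density (y + f (drift u)) (mat (2 * h)) (y + f v) = prop_dens u v"
proof -
  have A: "y + f v = (y + f (drift u)) + f (v - drift u)" by (simp add: linear_diff[OF lin_f])
  have "mvn_density (y + f (drift u)) (mat (2 * h)) (y + f v) = gauss_prod (\<lambda>_. 0) (\<lambda>e. sqrt (eig k (2 * h) 0 e)) (v - drift u)"
    using mvn_density_emat[OF f diag, of "2 * h" 0 "y + f (drift u)" "v - drift u"] h_pos
    unfolding A[symmetric] by (simp add: emat_mat)
  also have "\<dots> = prop_dens u v"
    unfolding prop_dens_def gauss_prod_def normal_density_def eig_def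
    by (intro prod.cong) (auto simp: inner_diff_left drift_inner)
  finally show ?thesis .
qed

lemma prop_density_fibre:
  assumes "block x j = center x j + f u" "block y j = center x j + f v"
  shows "mala_prop_density p j h x y = prop_dens u v"
  unfolding mala_prop_density_def mala_mean_fibre[OF assms(1)] assms(2) by (rule prop_dens_eq)

text \<open>The part \<open>X\<close> of \<open>target_dens_prop_dens\<close> that is symmetric in
  \<open>u\<close> and \<open>v\<close> cancels; only the two gradient weights remain.\<close>

lemma target_dens_prop_dens_ratio: "target_dens v * prop_dens v u / (target_dens u * prop_dens u v) = exp (h / 4 * (grad_sq u - grad_sq v))"
proof -
  let ?R = "\<lambda>u v. \<Prod>b\<in>Basis. exp (- (u \<bullet> b - v \<bullet> b)\<^sup>2 / (4 * (tau b)\<^sup>2)) / sqrt (4 * pi * (tau b)\<^sup>2)"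
  have R: "?R u v = ?R v u" by (intro prod.cong refl) (simp add: power2_commute)
  define X where "X = mix_const * (E u * E v * ?R u v)"
  have 1: "target_dens u * prop_dens u v = X * exp (- h / 4 * grad_sq u)" unfolding target_dens_prop_dens X_def by (simp add: mult_ac)
  have 2: "target_dens v * prop_dens v u = X * exp (- h / 4 * grad_sq v)" unfolding target_dens_prop_dens X_def R by (simp add: mult_ac)
  have "target_dens u * prop_dens u v > 0" using target_dens_pos prop_dens_pos by simp
  then have nz: "X \<noteq> 0" unfolding 1 by auto
  have "target_dens v * prop_dens v u / (target_dens u * prop_dens u v) = exp (- h / 4 * grad_sq v) / exp (- h / 4 * grad_sq u)"
    unfolding 1 2 using nz by simp
  also have "\<dots> = exp (h / 4 * (grad_sq u - grad_sq v))" by (simp add: exp_diff[symmetric] algebra_simps)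
  finally show ?thesis .
qed

text \<open>The bridge to the diagonal model. The constant relating \<open>p\<close> on the fibre to
  \<open>target_dens\<close> cancels in the acceptance ratio, so the same move density appears on
  every fibre.\<close>

lemma cond_move_fibre:
  "cond_move j (block_upd x j (center x j + f u)) (center x j + f v) = move_dens u v"
proof -
  let ?m = "center x j"
  let ?x = "block_upd x j (?m + f u)" and ?y = "block_upd x j (?m + f v)"
  let ?P = "p (block_upd x j ?m) / target_dens 0"
  have P: "?P \<noteq> 0" using p_pos[of "block_upd x j ?m"] target_dens_pos[of 0] by simp
  have px: "p ?x = ?P * target_dens u" "p ?y = ?P * target_dens v" by (rule p_fibre_target_dens)+
  have c: "center ?x j = ?m" "center ?y j = ?m" "block ?x j = ?m + f u" "block ?y j = ?m + f v"
    by (simp_all add: center_block_upd block_block_upd)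
  have d1: "mala_prop_density p j h ?x ?y = prop_dens u v" and d2: "mala_prop_density p j h ?y ?x = prop_dens v u"
    using prop_density_fibre[of ?x j u ?y v] prop_density_fibre[of ?y j v ?x u] by (simp_all add: c)
  have "mala_accept p j h ?x ?y = min 1 (target_dens v * prop_dens v u / (target_dens u * prop_dens u v))"
    unfolding mala_accept_def d1 d2 px using P by simp
  then have "cond_acc j ?x (?m + f v) = min 1 (exp (h / 4 * (grad_sq u - grad_sq v)))"
    unfolding cond_acc_def block_upd_block_upd target_dens_prop_dens_ratio .
  moreover have "cond_prop j ?x (?m + f v) = prop_dens u v"
    unfolding cond_prop_def using mala_mean_fibre[of ?x j u] prop_dens_eq[of ?m u v] by (simp add: c)
  ultimately show ?thesis unfolding cond_move_def move_dens_def by simp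
qed

lemma cond_target_fibre':
  "cond_target j (block_upd x j (center x j + f u)) (center x j + f v) = target_dens v"
  by (rule cond_target_fibre) (simp add: center_block_upd)

lemma fibre_coords:
  obtains u v where "x = block_upd x j (center x j + f u)" "z = center x j + f v"
proof -
  obtain u where "block x j - center x j = f u" using orthogonal_transformation_surj[OF f] by (metis surjD)
  moreover obtain v where "z - center x j = f v" using orthogonal_transformation_surj[OF f] by (metis surjD)
  ultimately show thesis using that[of u v] by (metis block_upd_block diff_add_cancel add.commute)
qed

text \<open>Detailed balance in the shape required by \<open>nn_integral_block_swap\<close>. In
  fibre coordinates it is \<open>target_dens_move_dens_sym\<close> times a constant.\<close>

lemma p_cond_move_sym: "p x * cond_move j x z = p (block_upd x j z) * cond_move j (block_upd x j z) (block x j)"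
proof -
  obtain u v where x: "x = block_upd x j (center x j + f u)" and z: "z = center x j + f v" by (rule fibre_coords)
  have b: "block x j = center x j + f u" by (subst x) (rule block_block_upd)
  have "p x * cond_move j x z = (p (block_upd x j (center x j)) / target_dens 0) * (target_dens u * move_dens u v)"
    by (subst (1 2) x, subst z) (simp only: p_fibre_target_dens cond_move_fibre mult.assoc)
  also have "target_dens u * move_dens u v = target_dens v * move_dens v u" by (rule target_dens_move_dens_sym)
  also have "(p (block_upd x j (center x j)) / target_dens 0) * (target_dens v * move_dens v u) = p (block_upd x j z) * cond_move j (block_upd x j z) (block x j)"
    unfolding z b by (simp only: p_fibre_target_dens cond_move_fibre mult.assoc)
  finally show ?thesis .
qed

lemma p_cond_target_sym: "p x * cond_target j x z = p (block_upd x j z) * cond_target j (block_upd x j z) (block x j)"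
proof -
  obtain u v where x: "x = block_upd x j (center x j + f u)" and z: "z = center x j + f v" by (rule fibre_coords)
  have b: "block x j = center x j + f u" by (subst x) (rule block_block_upd)
  have "p x * cond_target j x z = (p (block_upd x j (center x j)) / target_dens 0) * (target_dens u * target_dens v)"
    by (subst (1 2) x, subst z) (simp only: p_fibre_target_dens cond_target_fibre' mult.assoc)
  also have "\<dots> = (p (block_upd x j (center x j)) / target_dens 0) * (target_dens v * target_dens u)" by (simp add: mult_ac)
  also have "\<dots> = p (block_upd x j z) * cond_target j (block_upd x j z) (block x j)"
    unfolding z b by (simp only: p_fibre_target_dens cond_target_fibre' mult.assoc)
  finally show ?thesis .
qed

lemma fibre_int:
  fixes F :: "real ^ ('d \<times> 's) \<Rightarrow> real ^ 's \<Rightarrow> ennreal"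
  assumes [measurable]: "case_prod F \<in> borel_measurable (borel \<Otimes>\<^sub>M borel)"
  shows "(\<integral>\<^sup>+u. \<integral>\<^sup>+v. F (block_upd x j u) v \<partial>lborel \<partial>lborel)
    = (\<integral>\<^sup>+u. \<integral>\<^sup>+v. F (block_upd x j (center x j + f u)) (center x j + f v) \<partial>lborel \<partial>lborel)"
proof -
  have "(\<integral>\<^sup>+u. \<integral>\<^sup>+v. F (block_upd x j u) v \<partial>lborel \<partial>lborel)
     = (\<integral>\<^sup>+u. \<integral>\<^sup>+v. F (block_upd x j (center x j + f u)) v \<partial>lborel \<partial>lborel)"
    by (rule nn_integral_orthogonal_shift[OF f, symmetric]) measurable
  also have "\<dots> = (\<integral>\<^sup>+u. \<integral>\<^sup>+v. F (block_upd x j (center x j + f u)) (center x j + f v) \<partial>lborel \<partial>lborel)"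
    by (intro nn_integral_cong nn_integral_orthogonal_shift[OF f, symmetric]) measurable
  finally show ?thesis .
qed

section \<open>Block MALA and Gibbs updates\<close>

abbreviation PI :: "(real ^ ('d \<times> 's)) measure" where "PI \<equiv> mvn \<mu> Sg"

lemma prob_PI: "prob_space PI"
  unfolding Sg_def by (rule prob_space_mvn_emat[OF Sg_pos])

lemma sets_PI[measurable_cong]: "sets PI = sets borel" by (simp add: mvn_def)

lemma PI_int: "F \<in> borel_measurable borel \<Longrightarrow> (\<integral>\<^sup>+x. F x \<partial>PI) = (\<integral>\<^sup>+x. ennreal (p x) * F x \<partial>lborel)"
  unfolding mvn_def by (rule nn_integral_density) auto

text \<open>The accept-reject stage for a given proposal, separated so that the nested binds of
  \<open>mala_kernel\<close> can be integrated one at a time.\<close>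

definition acc_step :: "'d \<Rightarrow> real ^ ('d \<times> 's) \<Rightarrow> real ^ ('d \<times> 's) \<Rightarrow> (real ^ ('d \<times> 's)) measure" where
  "acc_step j x y = measure_pmf (bernoulli_pmf (mala_accept p j h x y)) \<bind> (\<lambda>acc. return borel (if acc then y else x))"

lemma accept_bounds: "0 \<le> mala_accept p j h x y" "mala_accept p j h x y \<le> 1"
  unfolding mala_accept_def mala_prop_density_def
  using p_pos mvn_density_pos_2h by (auto simp: less_imp_le)

lemma acc_step_int:
  assumes [measurable]: "F \<in> borel_measurable borel"
  shows "(\<integral>\<^sup>+w. F w \<partial>acc_step j x y) = ennreal (mala_accept p j h x y) * F y + ennreal (1 - mala_accept p j h x y) * F x"
proof -
  have "(\<integral>\<^sup>+w. F w \<partial>acc_step j x y) = (\<integral>\<^sup>+acc. \<integral>\<^sup>+w. F w \<partial>return borel (if acc then y else x) \<partial>measure_pmf (bernoulli_pmf (mala_accept p j h x y)))"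
    unfolding acc_step_def by (rule nn_integral_bind[where B = borel]) (auto simp: space_subprob_algebra prob_space_return prob_space_imp_subprob_space)
  also have "\<dots> = (\<integral>\<^sup>+acc. F (if acc then y else x) \<partial>measure_pmf (bernoulli_pmf (mala_accept p j h x y)))"
    by (intro nn_integral_cong nn_integral_return) auto
  also have "\<dots> = ennreal (mala_accept p j h x y) * F y + ennreal (1 - mala_accept p j h x y) * F x"
    using accept_bounds by (subst nn_integral_bernoulli_pmf) (auto simp: mult.commute)
  finally show ?thesis .
qed

lemma prob_acc_step: "prob_space (acc_step j x y)" and sets_acc_step: "sets (acc_step j x y) = sets borel"
proof -
  show s: "sets (acc_step j x y) = sets borel" unfolding acc_step_def by (subst sets_bind[where N = borel]) auto
  have "emeasure (acc_step j x y) (space (acc_step j x y)) = (\<integral>\<^sup>+w. 1 \<partial>acc_step j x y)" by simp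
  also have "\<dots> = ennreal (mala_accept p j h x y) + ennreal (1 - mala_accept p j h x y)"
    by (subst acc_step_int) auto
  also have "\<dots> = 1" using accept_bounds[of j x y] by (subst ennreal_plus[symmetric]) auto
  finally show "prob_space (acc_step j x y)" by (rule prob_spaceI)
qed

lemma acc_step_meas[measurable]: "acc_step j x \<in> borel \<rightarrow>\<^sub>M subprob_algebra borel"
proof (rule measurable_subprob_algebra)
  show "subprob_space (acc_step j x y)" for y by (rule prob_space_imp_subprob_space[OF prob_acc_step])
  show "sets (acc_step j x y) = sets borel" for y by (rule sets_acc_step)
  fix A :: "(real ^ ('d \<times> 's)) set" assume [measurable]: "A \<in> sets borel"
  have "emeasure (acc_step j x y) A = ennreal (mala_accept p j h x y) * indicator A y + ennreal (1 - mala_accept p j h x y) * indicator A x" for y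
    by (subst acc_step_int[symmetric]) (auto simp: sets_acc_step)
  then show "(\<lambda>y. emeasure (acc_step j x y) A) \<in> borel_measurable borel" by simp
qed

abbreviation block_kernel :: "'d \<Rightarrow> real ^ ('d \<times> 's) \<Rightarrow> (real ^ ('d \<times> 's)) measure" where
  "block_kernel j \<equiv> mala_kernel p j h"

lemma sets_proposal[measurable_cong]: "sets (mala_proposal p j h x) = sets borel"
  by (simp add: mala_proposal_def)

lemma proposal_int:
  assumes [measurable]: "F \<in> borel_measurable borel"
  shows "(\<integral>\<^sup>+y. F y \<partial>mala_proposal p j h x) = (\<integral>\<^sup>+z. ennreal (cond_prop j x z) * F (block_upd x j z) \<partial>lborel)"
  unfolding mala_proposal_def mvn_def cond_prop_def[symmetric]
  by (subst nn_integral_distr, measurable, subst nn_integral_density) measurable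

text \<open>The first term collects the accepted moves; the factor in the second is the rejection
  probability, an atom at \<open>x\<close>.\<close>

lemma block_kernel_int:
  assumes [measurable]: "F \<in> borel_measurable borel"
  shows "(\<integral>\<^sup>+y. F y \<partial>block_kernel j x) = (\<integral>\<^sup>+z. ennreal (cond_move j x z) * F (block_upd x j z) \<partial>lborel)
     + (\<integral>\<^sup>+z. ennreal (cond_prop j x z - cond_move j x z) \<partial>lborel) * F x"
proof -
  have "(\<integral>\<^sup>+y. F y \<partial>block_kernel j x) = (\<integral>\<^sup>+y. \<integral>\<^sup>+w. F w \<partial>acc_step j x y \<partial>mala_proposal p j h x)"
    unfolding mala_kernel_def acc_step_def[symmetric] by (rule nn_integral_bind[where B = borel]) measurable
  also have "\<dots> = (\<integral>\<^sup>+z. ennreal (cond_prop j x z) * (ennreal (cond_acc j x z) * F (block_upd x j z) + ennreal (1 - cond_acc j x z) * F x) \<partial>lborel)"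
    by (simp add: acc_step_int proposal_int cond_acc_def)
  also have "\<dots> = (\<integral>\<^sup>+z. ennreal (cond_move j x z) * F (block_upd x j z) + ennreal (cond_prop j x z - cond_move j x z) * F x \<partial>lborel)"
  proof (rule nn_integral_cong)
    fix z
    have "ennreal (cond_prop j x z) * ennreal (cond_acc j x z) = ennreal (cond_move j x z)"
      using cond_prop_pos[of j x z] by (simp add: cond_move_def ennreal_mult')
    moreover have "ennreal (cond_prop j x z) * ennreal (1 - cond_acc j x z) = ennreal (cond_prop j x z - cond_move j x z)"
      using cond_prop_pos[of j x z] by (simp add: cond_move_def ennreal_mult'[symmetric] right_diff_distrib)
    ultimately show "ennreal (cond_prop j x z) * (ennreal (cond_acc j x z) * F (block_upd x j z) + ennreal (1 - cond_acc j x z) * F x)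
      = ennreal (cond_move j x z) * F (block_upd x j z) + ennreal (cond_prop j x z - cond_move j x z) * F x"
      by (simp add: distrib_left mult.assoc[symmetric])
  qed
  also have "\<dots> = (\<integral>\<^sup>+z. ennreal (cond_move j x z) * F (block_upd x j z) \<partial>lborel) + (\<integral>\<^sup>+z. ennreal (cond_prop j x z - cond_move j x z) * F x \<partial>lborel)"
    by (rule nn_integral_add) measurable
  also have "(\<integral>\<^sup>+z. ennreal (cond_prop j x z - cond_move j x z) * F x \<partial>lborel) = (\<integral>\<^sup>+z. ennreal (cond_prop j x z - cond_move j x z) \<partial>lborel) * F x"
    by (rule nn_integral_multc) measurable
  finally show ?thesis .
qed

lemma sets_block_kernel: "sets (block_kernel j x) = sets borel"
  unfolding mala_kernel_def acc_step_def[symmetric]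
  by (subst sets_bind[where N = borel]) (auto simp: sets_acc_step mala_proposal_def)

lemma prob_block_kernel: "prob_space (block_kernel j x)"
proof (rule prob_spaceI)
  have "emeasure (block_kernel j x) (space (block_kernel j x)) = (\<integral>\<^sup>+w. 1 \<partial>block_kernel j x)" by simp
  also have "\<dots> = (\<integral>\<^sup>+z. ennreal (cond_move j x z) \<partial>lborel) + (\<integral>\<^sup>+z. ennreal (cond_prop j x z - cond_move j x z) \<partial>lborel)"
    by (subst block_kernel_int) auto
  also have "\<dots> = (\<integral>\<^sup>+z. ennreal (cond_move j x z) + ennreal (cond_prop j x z - cond_move j x z) \<partial>lborel)"
    by (rule nn_integral_add[symmetric]) measurable
  also have "\<dots> = (\<integral>\<^sup>+z. ennreal (cond_prop j x z) \<partial>lborel)"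
    using cond_move_nonneg cond_move_le by (intro nn_integral_cong) (simp add: ennreal_plus[symmetric] del: ennreal_plus)
  finally show "emeasure (block_kernel j x) (space (block_kernel j x)) = 1" by (simp add: cond_prop_int)
qed

lemma block_kernel_meas: "block_kernel j \<in> borel \<rightarrow>\<^sub>M prob_algebra borel"
proof (rule measurable_prob_algebraI)
  show "prob_space (block_kernel j x)" for x by (rule prob_block_kernel)
  show "block_kernel j \<in> borel \<rightarrow>\<^sub>M subprob_algebra borel"
  proof (rule measurable_subprob_algebra)
    show "subprob_space (block_kernel j x)" for x by (rule prob_space_imp_subprob_space[OF prob_block_kernel])
    show "sets (block_kernel j x) = sets borel" for x by (rule sets_block_kernel)
    fix A :: "(real ^ ('d \<times> 's)) set" assume [measurable]: "A \<in> sets borel"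
    have "emeasure (block_kernel j x) A = (\<integral>\<^sup>+z. ennreal (cond_move j x z) * indicator A (block_upd x j z) \<partial>lborel)
       + (\<integral>\<^sup>+z. ennreal (cond_prop j x z - cond_move j x z) \<partial>lborel) * indicator A x" for x
      by (subst block_kernel_int[symmetric]) (auto simp: sets_block_kernel)
    then show "(\<lambda>x. emeasure (block_kernel j x) A) \<in> borel_measurable borel" by simp
  qed
qed

text \<open>Exchanging current and proposed block preserves Lebesgue measure and, by
  \<open>sym\<close>, the weight, while it interchanges the two arguments of
  \<open>F\<close>.\<close>

lemma joint_swap:
  assumes [measurable]: "case_prod w \<in> borel_measurable (borel \<Otimes>\<^sub>M borel)" "F \<in> borel_measurable (borel \<Otimes>\<^sub>M borel)"
    and sym: "\<And>x z. p x * w x z = p (block_upd x j z) * w (block_upd x j z) (block x j)"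
  shows "(\<integral>\<^sup>+x. \<integral>\<^sup>+z. ennreal (p x * w x z) * F (x, block_upd x j z) \<partial>lborel \<partial>lborel)
     = (\<integral>\<^sup>+x. \<integral>\<^sup>+z. ennreal (p x * w x z) * F (block_upd x j z, x) \<partial>lborel \<partial>lborel)"
proof -
  have "(\<integral>\<^sup>+x. \<integral>\<^sup>+z. ennreal (p x * w x z) * F (x, block_upd x j z) \<partial>lborel \<partial>lborel)
     = (\<integral>\<^sup>+x. \<integral>\<^sup>+z. ennreal (p (block_upd x j z) * w (block_upd x j z) (block x j)) *
          F (block_upd x j z, block_upd (block_upd x j z) j (block x j)) \<partial>lborel \<partial>lborel)"
    by (rule nn_integral_block_swap) measurable
  then show ?thesis by (simp add: sym[symmetric] block_upd_block_upd block_upd_block)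
qed

text \<open>Rejections sit on the diagonal. Their term is therefore symmetric in the arguments of
  \<open>F\<close> and vanishes for squared differences.\<close>

lemma PI_block_kernel_int:
  assumes [measurable]: "F \<in> borel_measurable (borel \<Otimes>\<^sub>M borel)"
  shows "(\<integral>\<^sup>+x. \<integral>\<^sup>+y. F (x, y) \<partial>block_kernel j x \<partial>PI)
    = (\<integral>\<^sup>+x. \<integral>\<^sup>+z. ennreal (p x * cond_move j x z) * F (x, block_upd x j z) \<partial>lborel \<partial>lborel)
    + (\<integral>\<^sup>+x. (\<integral>\<^sup>+z. ennreal (cond_prop j x z - cond_move j x z) \<partial>lborel) * F (x, x) \<partial>PI)"
proof -
  have "(\<integral>\<^sup>+x. \<integral>\<^sup>+y. F (x, y) \<partial>block_kernel j x \<partial>PI)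
     = (\<integral>\<^sup>+x. (\<integral>\<^sup>+z. ennreal (cond_move j x z) * F (x, block_upd x j z) \<partial>lborel)
     + (\<integral>\<^sup>+z. ennreal (cond_prop j x z - cond_move j x z) \<partial>lborel) * F (x, x) \<partial>PI)"
    by (intro nn_integral_cong block_kernel_int) measurable
  also have "\<dots> = (\<integral>\<^sup>+x. (\<integral>\<^sup>+z. ennreal (cond_move j x z) * F (x, block_upd x j z) \<partial>lborel) \<partial>PI)
     + (\<integral>\<^sup>+x. (\<integral>\<^sup>+z. ennreal (cond_prop j x z - cond_move j x z) \<partial>lborel) * F (x, x) \<partial>PI)"
    by (rule nn_integral_add) measurable
  also have "(\<integral>\<^sup>+x. (\<integral>\<^sup>+z. ennreal (cond_move j x z) * F (x, block_upd x j z) \<partial>lborel) \<partial>PI)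
     = (\<integral>\<^sup>+x. \<integral>\<^sup>+z. ennreal (p x * cond_move j x z) * F (x, block_upd x j z) \<partial>lborel \<partial>lborel)"
    using p_pos by (subst PI_int) (auto simp: nn_integral_cmult[symmetric] ennreal_mult' less_imp_le mult.assoc)
  finally show ?thesis .
qed

text \<open>Transports an inequality of the diagonal model to the whole space. The integrands
  \<open>H1\<close> and \<open>H2\<close> are parameters so that positivity and the comparison with
  the Gibbs update can share it.\<close>

lemma fibre_form_le:
  fixes g :: "real ^ ('d \<times> 's) \<Rightarrow> real" and k1 k2 :: "real ^ ('d \<times> 's) \<Rightarrow> real ^ 's \<Rightarrow> real" and H1 H2 :: "real \<Rightarrow> real \<Rightarrow> real"
  assumes [measurable]: "case_prod k1 \<in> borel_measurable (borel \<Otimes>\<^sub>M borel)" "case_prod k2 \<in> borel_measurable (borel \<Otimes>\<^sub>M borel)"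
    "case_prod H1 \<in> borel_measurable (borel \<Otimes>\<^sub>M borel)" "case_prod H2 \<in> borel_measurable (borel \<Otimes>\<^sub>M borel)" "g \<in> borel_measurable borel"
    and k1: "\<And>x u v. k1 (block_upd x j (center x j + f u)) (center x j + f v) = q1 u v"
    and k2: "\<And>x u v. k2 (block_upd x j (center x j + f u)) (center x j + f v) = q2 u v"
    and q [measurable]: "case_prod q1 \<in> borel_measurable (borel \<Otimes>\<^sub>M borel)" "case_prod q2 \<in> borel_measurable (borel \<Otimes>\<^sub>M borel)"
    and le: "\<And>x. (\<integral>\<^sup>+u. \<integral>\<^sup>+v. ennreal (target_dens u * q1 u v * H1 (g (block_upd x j (center x j + f u))) (g (block_upd x j (center x j + f v)))) \<partial>lborel \<partial>lborel)
       \<le> c * (\<integral>\<^sup>+u. \<integral>\<^sup>+v. ennreal (target_dens u * q2 u v * H2 (g (block_upd x j (center x j + f u))) (g (block_upd x j (center x j + f v)))) \<partial>lborel \<partial>lborel)"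
  shows "(\<integral>\<^sup>+x. \<integral>\<^sup>+z. ennreal (p x * k1 x z * H1 (g x) (g (block_upd x j z))) \<partial>lborel \<partial>lborel)
     \<le> c * (\<integral>\<^sup>+x. \<integral>\<^sup>+z. ennreal (p x * k2 x z * H2 (g x) (g (block_upd x j z))) \<partial>lborel \<partial>lborel)"
proof (rule nn_integral_fibre_mono)
  fix x
  let ?c = "center x j"
  \<comment> \<open>On this fibre \<open>p\<close> is \<open>P\<close> times
    \<open>target_dens\<close>; the constant scales both sides alike.\<close>
  define P where "P = p (block_upd x j ?c) / target_dens 0"
  have P0: "P \<ge> 0" using p_pos[of "block_upd x j ?c"] by (simp add: P_def less_imp_le)
  have [measurable]: "f \<in> borel_measurable borel" by (rule linear_borel_measurable[OF lin_f])
  have rep: "(\<integral>\<^sup>+u. \<integral>\<^sup>+v. ennreal (p (block_upd x j u) * kk (block_upd x j u) v * H (g (block_upd x j u)) (g (block_upd (block_upd x j u) j v))) \<partial>lborel \<partial>lborel)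
     = ennreal P * (\<integral>\<^sup>+u. \<integral>\<^sup>+v. ennreal (target_dens u * qq u v * H (g (block_upd x j (?c + f u))) (g (block_upd x j (?c + f v)))) \<partial>lborel \<partial>lborel)"
    if [measurable]: "case_prod kk \<in> borel_measurable (borel \<Otimes>\<^sub>M borel)" "case_prod H \<in> borel_measurable (borel \<Otimes>\<^sub>M borel)" "case_prod qq \<in> borel_measurable (borel \<Otimes>\<^sub>M borel)"
    and kk: "\<And>x u v. kk (block_upd x j (center x j + f u)) (center x j + f v) = qq u v"
    for kk :: "real ^ ('d \<times> 's) \<Rightarrow> real ^ 's \<Rightarrow> real" and H :: "real \<Rightarrow> real \<Rightarrow> real" and qq
  proof -
    have "(\<integral>\<^sup>+u. \<integral>\<^sup>+v. ennreal (p (block_upd x j u) * kk (block_upd x j u) v * H (g (block_upd x j u)) (g (block_upd (block_upd x j u) j v))) \<partial>lborel \<partial>lborel)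
      = (\<integral>\<^sup>+u. \<integral>\<^sup>+v. ennreal (p (block_upd x j (?c + f u)) * kk (block_upd x j (?c + f u)) (?c + f v) *
          H (g (block_upd x j (?c + f u))) (g (block_upd (block_upd x j (?c + f u)) j (?c + f v)))) \<partial>lborel \<partial>lborel)"
      by (rule fibre_int[of "\<lambda>y v. ennreal (p y * kk y v * H (g y) (g (block_upd y j v)))"]) measurable
    also have "\<dots> = (\<integral>\<^sup>+u. \<integral>\<^sup>+v. ennreal P * ennreal (target_dens u * qq u v * H (g (block_upd x j (?c + f u))) (g (block_upd x j (?c + f v)))) \<partial>lborel \<partial>lborel)"
      unfolding kk p_fibre_target_dens P_def[symmetric] block_upd_block_upd
      using P0 by (simp add: ennreal_mult'[symmetric] mult.assoc)
    also have "\<dots> = ennreal P * (\<integral>\<^sup>+u. \<integral>\<^sup>+v. ennreal (target_dens u * qq u v * H (g (block_upd x j (?c + f u))) (g (block_upd x j (?c + f v)))) \<partial>lborel \<partial>lborel)"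
      by (simp add: nn_integral_cmult)
    finally show ?thesis .
  qed
  show "(\<integral>\<^sup>+u. \<integral>\<^sup>+v. ennreal (p (block_upd x j u) * k1 (block_upd x j u) v * H1 (g (block_upd x j u)) (g (block_upd (block_upd x j u) j v))) \<partial>lborel \<partial>lborel)
     \<le> c * (\<integral>\<^sup>+u. \<integral>\<^sup>+v. ennreal (p (block_upd x j u) * k2 (block_upd x j u) v * H2 (g (block_upd x j u)) (g (block_upd (block_upd x j u) j v))) \<partial>lborel \<partial>lborel)"
    unfolding rep[of k1 H1 q1, OF _ _ _ k1, simplified] rep[of k2 H2 q2, OF _ _ _ k2, simplified]
    using mult_left_mono[OF le[of x], of "ennreal P"] by (simp add: mult_ac)
qed measurable

text \<open>Rejections do not contribute to the Dirichlet form. For the moves,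
  \<open>fibre_psd\<close> replaces the squared difference by a sum of squares, whose halves agree
  by detailed balance; each is at most the squared norm of \<open>g\<close> since the probability of
  a move is at most 1.\<close>

lemma psd_block_kernel: "psd_kernel PI (block_kernel j)"
proof -
  interpret PI: prob_space PI by (rule prob_PI)
  have R: "rev_kernel PI (block_kernel j)"
  proof
    fix F :: "(real ^ ('d \<times> 's)) \<times> (real ^ ('d \<times> 's)) \<Rightarrow> ennreal" assume [measurable]: "F \<in> borel_measurable (borel \<Otimes>\<^sub>M borel)"
    have "(\<integral>\<^sup>+x. \<integral>\<^sup>+z. ennreal (p x * cond_move j x z) * F (x, block_upd x j z) \<partial>lborel \<partial>lborel)
      = (\<integral>\<^sup>+x. \<integral>\<^sup>+z. ennreal (p x * cond_move j x z) * F (block_upd x j z, x) \<partial>lborel \<partial>lborel)"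
      by (rule joint_swap[OF _ _ p_cond_move_sym]) measurable
    then show "(\<integral>\<^sup>+x. \<integral>\<^sup>+y. F (x, y) \<partial>block_kernel j x \<partial>PI) = (\<integral>\<^sup>+x. \<integral>\<^sup>+y. F (y, x) \<partial>block_kernel j x \<partial>PI)"
      using PI_block_kernel_int[of F j] PI_block_kernel_int[of "\<lambda>q. F (snd q, fst q)" j] by simp
  qed (simp_all add: sets_PI block_kernel_meas)
  interpret R: rev_kernel PI "block_kernel j" by (rule R)
  show ?thesis
  proof
    fix g :: "real ^ ('d \<times> 's) \<Rightarrow> real" assume g: "bdd_meas g"
    note [measurable] = bdd_meas_meas[OF g]
    obtain C where C: "\<And>x. \<bar>g x\<bar> \<le> C" using g by (auto simp: bdd_meas_def)
    have fm: "f \<in> borel_measurable borel" by (rule linear_borel_measurable[OF lin_f])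
    have "(\<integral>\<^sup>+x. \<integral>\<^sup>+z. ennreal (p x * cond_move j x z) * ennreal ((g x)\<^sup>2) \<partial>lborel \<partial>lborel) \<le> (\<integral>\<^sup>+x. ennreal ((g x)\<^sup>2) \<partial>PI)"
    proof -
      have "(\<integral>\<^sup>+z. ennreal (p x * cond_move j x z) * ennreal ((g x)\<^sup>2) \<partial>lborel) \<le> ennreal (p x) * ennreal ((g x)\<^sup>2)" for x
      proof -
        have "(\<integral>\<^sup>+z. ennreal (p x * cond_move j x z) * ennreal ((g x)\<^sup>2) \<partial>lborel) \<le> (\<integral>\<^sup>+z. ennreal (p x) * ennreal ((g x)\<^sup>2) * ennreal (cond_prop j x z) \<partial>lborel)"
        proof (rule nn_integral_mono)
          fix z
          have "p x * cond_move j x z * (g x)\<^sup>2 \<le> p x * (g x)\<^sup>2 * cond_prop j x z"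
            using mult_left_mono[OF cond_move_le[of j x z], of "p x * (g x)\<^sup>2"] p_pos[of x] by (simp add: mult_ac)
          then show "ennreal (p x * cond_move j x z) * ennreal ((g x)\<^sup>2) \<le> ennreal (p x) * ennreal ((g x)\<^sup>2) * ennreal (cond_prop j x z)"
            by (simp add: ennreal_mult''[symmetric] less_imp_le[OF cond_prop_pos] ennreal_leI)
        qed
        also have "\<dots> = ennreal (p x) * ennreal ((g x)\<^sup>2)" by (subst nn_integral_cmult) (auto simp: cond_prop_int)
        finally show ?thesis .
      qed
      then show ?thesis by (subst PI_int) (auto intro: nn_integral_mono)
    qed
    also have "\<dots> = ennreal (\<integral>x. (g x)\<^sup>2 \<partial>PI)"
      using R.bdd_meas_sq_int[OF g] by (intro nn_integral_eq_integral) auto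
    finally have le: "(\<integral>\<^sup>+x. \<integral>\<^sup>+z. ennreal (p x * cond_move j x z) * ennreal ((g x)\<^sup>2) \<partial>lborel \<partial>lborel) \<le> ennreal (\<integral>x. (g x)\<^sup>2 \<partial>PI)" .
    have "(\<integral>\<^sup>+x. \<integral>\<^sup>+y. ennreal ((g x - g y)\<^sup>2) \<partial>block_kernel j x \<partial>PI)
       = (\<integral>\<^sup>+x. \<integral>\<^sup>+z. ennreal (p x * cond_move j x z) * ennreal ((g x - g (block_upd x j z))\<^sup>2) \<partial>lborel \<partial>lborel)"
      using PI_block_kernel_int[of "\<lambda>q. ennreal ((g (fst q) - g (snd q))\<^sup>2)" j] by simp
    also have "\<dots> = (\<integral>\<^sup>+x. \<integral>\<^sup>+z. ennreal (p x * cond_move j x z * (g x - g (block_upd x j z))\<^sup>2) \<partial>lborel \<partial>lborel)"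
      by (simp add: ennreal_mult'')
    also have "\<dots> \<le> 1 * (\<integral>\<^sup>+x. \<integral>\<^sup>+z. ennreal (p x * cond_move j x z * ((g x)\<^sup>2 + (g (block_upd x j z))\<^sup>2)) \<partial>lborel \<partial>lborel)"
    proof (rule fibre_form_le[where ?k1.0 = "cond_move j" and ?k2.0 = "cond_move j" and ?q1.0 = move_dens and ?q2.0 = move_dens
        and ?H1.0 = "\<lambda>a b. (a - b)\<^sup>2" and ?H2.0 = "\<lambda>a b. a\<^sup>2 + b\<^sup>2"])
      fix x
      let ?g = "\<lambda>u. g (block_upd x j (center x j + f u))"
      have "?g \<in> borel_measurable borel" using fm by measurable
      then show "(\<integral>\<^sup>+u. \<integral>\<^sup>+v. ennreal (target_dens u * move_dens u v * (?g u - ?g v)\<^sup>2) \<partial>lborel \<partial>lborel)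
         \<le> 1 * (\<integral>\<^sup>+u. \<integral>\<^sup>+v. ennreal (target_dens u * move_dens u v * ((?g u)\<^sup>2 + (?g v)\<^sup>2)) \<partial>lborel \<partial>lborel)"
        using fibre_psd[of ?g C] C by simp
    qed (auto simp: cond_move_fibre)
    also have "1 * (\<integral>\<^sup>+x. \<integral>\<^sup>+z. ennreal (p x * cond_move j x z * ((g x)\<^sup>2 + (g (block_upd x j z))\<^sup>2)) \<partial>lborel \<partial>lborel)
       = (\<integral>\<^sup>+x. \<integral>\<^sup>+z. ennreal (p x * cond_move j x z) * ennreal ((g x)\<^sup>2) + ennreal (p x * cond_move j x z) * ennreal ((g (block_upd x j z))\<^sup>2) \<partial>lborel \<partial>lborel)"
      using p_pos cond_move_nonneg by (simp add: distrib_left ennreal_mult'' less_imp_le)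
    also have "\<dots> = (\<integral>\<^sup>+x. \<integral>\<^sup>+z. ennreal (p x * cond_move j x z) * ennreal ((g x)\<^sup>2) \<partial>lborel \<partial>lborel)
       + (\<integral>\<^sup>+x. \<integral>\<^sup>+z. ennreal (p x * cond_move j x z) * ennreal ((g (block_upd x j z))\<^sup>2) \<partial>lborel \<partial>lborel)"
      by (simp add: nn_integral_add)
    also have "(\<integral>\<^sup>+x. \<integral>\<^sup>+z. ennreal (p x * cond_move j x z) * ennreal ((g (block_upd x j z))\<^sup>2) \<partial>lborel \<partial>lborel)
       = (\<integral>\<^sup>+x. \<integral>\<^sup>+z. ennreal (p x * cond_move j x z) * ennreal ((g x)\<^sup>2) \<partial>lborel \<partial>lborel)"
      using joint_swap[where F = "\<lambda>q. ennreal ((g (snd q))\<^sup>2)" and w = "cond_move j" and j = j, OF _ _ p_cond_move_sym] by simp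
    also have "(\<integral>\<^sup>+x. \<integral>\<^sup>+z. ennreal (p x * cond_move j x z) * ennreal ((g x)\<^sup>2) \<partial>lborel \<partial>lborel)
       + (\<integral>\<^sup>+x. \<integral>\<^sup>+z. ennreal (p x * cond_move j x z) * ennreal ((g x)\<^sup>2) \<partial>lborel \<partial>lborel)
       \<le> ennreal (\<integral>x. (g x)\<^sup>2 \<partial>PI) + ennreal (\<integral>x. (g x)\<^sup>2 \<partial>PI)"
      by (intro add_mono le)
    also have "\<dots> = ennreal (2 * (\<integral>x. (g x)\<^sup>2 \<partial>PI))" by (subst ennreal_plus[symmetric]) auto
    finally show "(\<integral>\<^sup>+x. \<integral>\<^sup>+y. ennreal ((g x - g y)\<^sup>2) \<partial>block_kernel j x \<partial>PI) \<le> ennreal (2 * (\<integral>x. (g x)\<^sup>2 \<partial>PI))" .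
  qed
qed

text \<open>The parametrisation of a fibre is an isometric embedding.\<close>

lemma bdd_lipschitz_fibre:
  assumes "bdd_lipschitz g"
  shows "bdd_lipschitz (\<lambda>u. g (block_upd x j (c + f u)))"
proof -
  obtain C L where *: "\<And>x. \<bar>g x\<bar> \<le> C" "\<And>x y. \<bar>g x - g y\<bar> \<le> L * dist x y"
    using assms unfolding bdd_lipschitz_def by metis
  have "dist (block_upd x j (c + f u)) (block_upd x j (c + f v)) = dist u v" for u v
    unfolding dist_block_upd
    using orthogonal_transformation_norm[OF f, of "u - v"] by (simp add: dist_norm linear_diff[OF lin_f])
  then show ?thesis using * by (intro bdd_lipschitzI[of _ C L]) metis+
qed

text \<open>The exact update draws the new block from the conditional law independently of the old
  one, so its Dirichlet form averages conditional variances over fibres, and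
  \<open>fibre_gap\<close> applies on each of them.\<close>

lemma gibbs_le_mala:
  assumes g: "bdd_lipschitz g"
  shows "(\<integral>\<^sup>+x. \<integral>\<^sup>+z. ennreal (p x * cond_target j x z * (g x - g (block_upd x j z))\<^sup>2) \<partial>lborel \<partial>lborel)
    \<le> ennreal (960 * s) * (\<integral>\<^sup>+x. \<integral>\<^sup>+y. ennreal ((g x - g y)\<^sup>2) \<partial>block_kernel j x \<partial>PI)"
proof -
  note [measurable] = bdd_lipschitz_measurable[OF g]
  have "(\<integral>\<^sup>+x. \<integral>\<^sup>+z. ennreal (p x * cond_target j x z * (g x - g (block_upd x j z))\<^sup>2) \<partial>lborel \<partial>lborel)
    \<le> ennreal (960 * s) * (\<integral>\<^sup>+x. \<integral>\<^sup>+z. ennreal (p x * cond_move j x z * (g x - g (block_upd x j z))\<^sup>2) \<partial>lborel \<partial>lborel)"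
  proof (rule fibre_form_le[where ?k1.0 = "cond_target j" and ?k2.0 = "cond_move j" and ?q1.0 = "\<lambda>u v. target_dens v" and ?q2.0 = move_dens
        and ?H1.0 = "\<lambda>a b. (a - b)\<^sup>2" and ?H2.0 = "\<lambda>a b. (a - b)\<^sup>2"])
    fix x
    show "(\<integral>\<^sup>+u. \<integral>\<^sup>+v. ennreal (target_dens u * target_dens v * (g (block_upd x j (center x j + f u)) - g (block_upd x j (center x j + f v)))\<^sup>2) \<partial>lborel \<partial>lborel)
      \<le> ennreal (960 * s) * (\<integral>\<^sup>+u. \<integral>\<^sup>+v. ennreal (target_dens u * move_dens u v * (g (block_upd x j (center x j + f u)) - g (block_upd x j (center x j + f v)))\<^sup>2) \<partial>lborel \<partial>lborel)"
      using fibre_gap[OF bdd_lipschitz_fibre[OF g, of x j "center x j"]] by (simp add: s_def)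
  qed (auto simp: cond_move_fibre cond_target_fibre')
  also have "(\<integral>\<^sup>+x. \<integral>\<^sup>+z. ennreal (p x * cond_move j x z * (g x - g (block_upd x j z))\<^sup>2) \<partial>lborel \<partial>lborel)
     = (\<integral>\<^sup>+x. \<integral>\<^sup>+y. ennreal ((g x - g y)\<^sup>2) \<partial>block_kernel j x \<partial>PI)"
    using PI_block_kernel_int[of "\<lambda>q. ennreal ((g (fst q) - g (snd q))\<^sup>2)" j] by (simp add: ennreal_mult'')
  finally show ?thesis .
qed

section \<open>The random-scan Gibbs sampler and its gap\<close>

definition gibbs :: "real ^ ('d \<times> 's) \<Rightarrow> 'd \<times> (real ^ 's) \<Rightarrow> real ^ ('d \<times> 's)" where
  "gibbs x w = block_upd x (fst w) (center x (fst w) + snd w)"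

definition noise :: "('d \<times> (real ^ 's)) measure" where
  "noise = measure_pmf (pmf_of_set UNIV) \<Otimes>\<^sub>M mvn 0 Qi"

text \<open>The energy norm of the precision. For two coupled copies an exact block update projects
  their difference orthogonally in this norm, while in the Euclidean norm the projection is in
  general oblique.\<close>

definition Q_norm :: "real ^ ('d \<times> 's) \<Rightarrow> real" where
  "Q_norm x = sqrt (x \<bullet> (Qg *v x))"

text \<open>The smallest eigenvalue of \<open>Qg\<close> divided by its largest, that is,
  \<open>(1 - \<zeta>) / (1 + (N - 1) * \<zeta>)\<close>.\<close>

definition \<kappa> :: real where "\<kappa> = 1 - N * \<beta>"

lemma \<kappa>: "0 < \<kappa>" "\<kappa> \<le> 1"
  using N\<beta>_less \<beta>_nonneg sizes(5) by (auto simp: \<kappa>_def)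

lemma Qg_vec: "Qg *v x = \<alpha> *\<^sub>R (x - (\<beta> * (x \<bullet> 1)) *\<^sub>R 1)"
  by (simp add: Qg_def emat_mult_vec sum_vec_eq_inner scaleR_diff_right)

lemma one_one: "(1 :: real ^ ('d \<times> 's)) \<bullet> 1 = N"
  by (simp add: inner_vec_def N_def)

lemma sum_sq_le: "(x \<bullet> 1)\<^sup>2 \<le> N * (x \<bullet> x)" for x :: "real ^ ('d \<times> 's)"
  using Cauchy_Schwarz_ineq[of x 1] by (simp add: one_one mult.commute)

lemma quad_Qg: "x \<bullet> (Qg *v x) = \<alpha> * (x \<bullet> x - \<beta> * (x \<bullet> 1)\<^sup>2)"
  by (simp add: Qg_vec inner_diff_right power2_eq_square)

lemma quad_Qg_ge: "\<alpha> * \<kappa> * (x \<bullet> x) \<le> x \<bullet> (Qg *v x)"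
proof -
  have "\<beta> * (x \<bullet> 1)\<^sup>2 \<le> \<beta> * (N * (x \<bullet> x))" using sum_sq_le \<beta>_nonneg by (rule mult_left_mono)
  then have "\<alpha> * (\<kappa> * (x \<bullet> x)) \<le> \<alpha> * (x \<bullet> x - \<beta> * (x \<bullet> 1)\<^sup>2)"
    using \<alpha>_pos by (intro mult_left_mono) (auto simp: \<kappa>_def algebra_simps)
  then show ?thesis by (simp add: quad_Qg)
qed

lemma quad_Qg_le: "x \<bullet> (Qg *v x) \<le> \<alpha> * (x \<bullet> x)"
  unfolding quad_Qg using \<alpha>_pos \<beta>_nonneg by (intro mult_left_mono) auto

lemma quad_Qg_nonneg: "0 \<le> x \<bullet> (Qg *v x)"
proof -
  have "0 \<le> \<alpha> * \<kappa> * (x \<bullet> x)" using \<alpha>_pos \<kappa> by simp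
  then show ?thesis using quad_Qg_ge order_trans by blast
qed

text \<open>The spectrum of \<open>Qg\<close> is bounded below by
  \<open>\<alpha> * \<kappa>\<close>. Both sides depend on \<open>x \<bullet> x\<close> and
  \<open>x \<bullet> 1\<close> only, so Cauchy-Schwarz against the all-ones vector proves
  it.\<close>

lemma norm_Qg: "\<kappa> * (x \<bullet> (Qg *v x)) \<le> ((Qg *v x) \<bullet> (Qg *v x)) / \<alpha>"
proof -
  let ?T = "x \<bullet> 1"
  have "(Qg *v x) \<bullet> (Qg *v x) = \<alpha>\<^sup>2 * (x \<bullet> x - 2 * \<beta> * ?T\<^sup>2 + \<beta>\<^sup>2 * ?T\<^sup>2 * N)"
    using inner_commute[of 1 x]
    by (simp add: Qg_vec inner_diff_left inner_diff_right one_one power2_eq_square) (simp add: algebra_simps)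
  then have e: "((Qg *v x) \<bullet> (Qg *v x)) / \<alpha> = \<alpha> * (x \<bullet> x - 2 * \<beta> * ?T\<^sup>2 + \<beta>\<^sup>2 * ?T\<^sup>2 * N)"
    using \<alpha>_pos by (simp add: power2_eq_square)
  have "\<beta> * ?T\<^sup>2 \<le> \<beta> * (N * (x \<bullet> x))" using sum_sq_le \<beta>_nonneg by (rule mult_left_mono)
  then have "\<kappa> * (x \<bullet> x - \<beta> * ?T\<^sup>2) \<le> x \<bullet> x - 2 * \<beta> * ?T\<^sup>2 + \<beta>\<^sup>2 * ?T\<^sup>2 * N"
    by (simp add: \<kappa>_def power2_eq_square algebra_simps)
  then have "\<alpha> * (\<kappa> * (x \<bullet> x - \<beta> * ?T\<^sup>2)) \<le> \<alpha> * (x \<bullet> x - 2 * \<beta> * ?T\<^sup>2 + \<beta>\<^sup>2 * ?T\<^sup>2 * N)"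
    using \<alpha>_pos by (intro mult_left_mono) auto
  then show ?thesis unfolding e quad_Qg by (simp add: mult_ac)
qed

text \<open>Both copies use the same noise, which cancels. What remains is the projection that makes
  block \<open>j\<close> of \<open>Qg\<close> applied to the difference vanish.\<close>

lemma gibbs_diff:
  "gibbs x (j, w) - gibbs y (j, w) = (x - y) - emb j (Qi *v block (Qg *v (x - y)) j)"
proof -
  have b: "block (Qg *v (x - y)) j = score x j - score y j"
    by (simp add: score_def block_diff[symmetric] matrix_vector_mult_diff_distrib[symmetric])
  have G: "gibbs x (j, w) = x + emb j (w - Qi *v score x j)" for x
    by (simp add: gibbs_def block_upd_eq center_def)
  show ?thesis
    unfolding b G by (simp add: matrix_vector_mult_diff_distrib emb_diff)
qed

text \<open>The projection lowers the energy by exactly \<open>?c \<bullet> (Qi *v ?c)\<close>, and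
  \<open>Qi\<close> dominates the identity divided by \<open>\<alpha>\<close>.\<close>

lemma quad_gibbs_diff:
  "(x - emb j (Qi *v block (Qg *v x) j)) \<bullet> (Qg *v (x - emb j (Qi *v block (Qg *v x) j)))
     \<le> x \<bullet> (Qg *v x) - (block (Qg *v x) j \<bullet> block (Qg *v x) j) / \<alpha>"
proof -
  let ?c = "block (Qg *v x) j"
  have e: "x - emb j (Qi *v ?c) = (x + \<mu>) + emb j (- (Qi *v ?c)) - \<mu>" by (simp add: emb_minus)
  have "(x - emb j (Qi *v ?c)) \<bullet> (Qg *v (x - emb j (Qi *v ?c)))
     = x \<bullet> (Qg *v x) + 2 * (- (Qi *v ?c) \<bullet> ?c) + - (Qi *v ?c) \<bullet> (Qs *v - (Qi *v ?c))"
    unfolding e quad_emb by (simp add: score_def)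
  also have "\<dots> = x \<bullet> (Qg *v x) - ?c \<bullet> (Qi *v ?c)"
  proof -
    have "Qs *v - (Qi *v ?c) = - ?c"
      using Qs_Qi_vec(1)[of ?c] linear_neg[OF matrix_vector_mul_linear, of Qs "Qi *v ?c"] by simp
    then show ?thesis by (simp add: inner_commute)
  qed
  also have "?c \<bullet> (Qi *v ?c) = (?c \<bullet> ?c) / \<alpha> + \<beta> / (\<alpha> * (1 - s * \<beta>)) * (?c \<bullet> 1)\<^sup>2"
    by (simp add: Qi_def emat_mult_vec sum_vec_eq_inner inner_add_right power2_eq_square)
  finally have "(x - emb j (Qi *v ?c)) \<bullet> (Qg *v (x - emb j (Qi *v ?c)))
     = x \<bullet> (Qg *v x) - ((?c \<bullet> ?c) / \<alpha> + \<beta> / (\<alpha> * (1 - s * \<beta>)) * (?c \<bullet> 1)\<^sup>2)" .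
  moreover have "0 \<le> \<beta> / (\<alpha> * (1 - s * \<beta>)) * (?c \<bullet> 1)\<^sup>2"
    using \<beta>_nonneg \<alpha>_pos s\<beta>_half by (intro mult_nonneg_nonneg divide_nonneg_nonneg) auto
  ultimately show ?thesis by linarith
qed

text \<open>Over all blocks the energy losses add up to the squared norm of
  \<open>Qg *v (x - y)\<close> over \<open>\<alpha>\<close>, hence to at least
  \<open>\<kappa>\<close> times the energy. Cauchy-Schwarz over the \<open>d\<close> blocks passes
  from squares to norms.\<close>

lemma gibbs_contraction_sum:
  "(\<Sum>j\<in>UNIV. Q_norm (gibbs x (j, w j) - gibbs y (j, w j))) \<le> (d - \<kappa> / 2) * Q_norm (x - y)"
proof (rule power2_le_imp_le)
  let ?\<delta> = "x - y"
  let ?q = "\<lambda>x. x \<bullet> (Qg *v x)"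
  have d: "real (card (UNIV :: 'd set)) = d" by (simp add: d_def)
  have "(\<Sum>j\<in>UNIV. (Q_norm (gibbs x (j, w j) - gibbs y (j, w j)))\<^sup>2)
     \<le> (\<Sum>j\<in>UNIV. ?q ?\<delta> - (block (Qg *v ?\<delta>) j \<bullet> block (Qg *v ?\<delta>) j) / \<alpha>)"
    unfolding gibbs_diff Q_norm_def
    by (intro sum_mono) (simp only: real_sqrt_pow2[OF quad_Qg_nonneg] quad_gibbs_diff)
  also have "\<dots> = d * ?q ?\<delta> - ((Qg *v ?\<delta>) \<bullet> (Qg *v ?\<delta>)) / \<alpha>"
    by (simp only: sum_subtractf sum_divide_distrib[symmetric] inner_eq_sum_block[of "Qg *v ?\<delta>", symmetric] sum_constant d)
  also have "\<dots> \<le> (d - \<kappa>) * ?q ?\<delta>" using norm_Qg[of ?\<delta>] by (simp only: left_diff_distrib)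
  finally have S: "(\<Sum>j\<in>UNIV. (Q_norm (gibbs x (j, w j) - gibbs y (j, w j)))\<^sup>2) \<le> (d - \<kappa>) * ?q ?\<delta>" .
  have "(\<Sum>j\<in>UNIV. Q_norm (gibbs x (j, w j) - gibbs y (j, w j)))\<^sup>2
     \<le> (\<Sum>j\<in>UNIV. (Q_norm (gibbs x (j, w j) - gibbs y (j, w j)))\<^sup>2) * d"
    unfolding d[symmetric] by (rule sum_squared_le_sum_of_squares)
  also have "\<dots> \<le> (d - \<kappa>) * ?q ?\<delta> * d" using S sizes(2) by (intro mult_right_mono) auto
  also have "\<dots> = (d * (d - \<kappa>)) * ?q ?\<delta>" by (simp only: mult_ac)
  \<comment> \<open>The two coefficients differ by \<open>\<kappa>^2 / 4\<close>; taking the square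
    root is what halves \<open>\<kappa>\<close>.\<close>
  also have "\<dots> \<le> (d - \<kappa> / 2)\<^sup>2 * ?q ?\<delta>"
    by (rule mult_right_mono[OF _ quad_Qg_nonneg]) (simp add: power2_eq_square algebra_simps)
  also have "\<dots> = ((d - \<kappa> / 2) * Q_norm ?\<delta>)\<^sup>2"
    by (simp only: Q_norm_def power_mult_distrib real_sqrt_pow2[OF quad_Qg_nonneg])
  finally show "(\<Sum>j\<in>UNIV. Q_norm (gibbs x (j, w j) - gibbs y (j, w j)))\<^sup>2 \<le> ((d - \<kappa> / 2) * Q_norm ?\<delta>)\<^sup>2" .
  show "0 \<le> (d - \<kappa> / 2) * Q_norm ?\<delta>"
    using sizes(2) \<kappa> quad_Qg_nonneg by (simp add: Q_norm_def)
qed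

lemma prob_Qi: "prob_space (mvn (0 :: real ^ 's) Qi)"
  unfolding Qi_def using Qi_pos by (intro prob_space_mvn_emat) (auto simp: s_def)

lemma noise_int:
  assumes [measurable]: "\<And>j. (\<lambda>w. G (j, w)) \<in> borel_measurable borel" and "G \<in> borel_measurable noise"
  shows "(\<integral>\<^sup>+w. G w \<partial>noise) = (\<Sum>j\<in>UNIV. \<integral>\<^sup>+w. G (j, w) \<partial>mvn 0 Qi) / ennreal d"
proof -
  interpret Q: prob_space "mvn 0 Qi" by (rule prob_Qi)
  have "(\<integral>\<^sup>+w. G w \<partial>noise) = (\<integral>\<^sup>+j. \<integral>\<^sup>+w. G (j, w) \<partial>mvn 0 Qi \<partial>measure_pmf (pmf_of_set UNIV))"
    unfolding noise_def using assms(2) by (intro Q.nn_integral_fst[symmetric]) (simp add: noise_def)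
  also have "\<dots> = (\<Sum>j\<in>UNIV. \<integral>\<^sup>+w. G (j, w) \<partial>mvn 0 Qi) / ennreal d"
    by (subst nn_integral_pmf_of_set) (auto simp: d_def ennreal_of_nat_eq_real_of_nat)
  finally show ?thesis .
qed

lemma gibbs_meas: "case_prod gibbs \<in> borel \<Otimes>\<^sub>M noise \<rightarrow>\<^sub>M borel"
proof -
  have sets: "sets (borel \<Otimes>\<^sub>M noise) = sets (borel \<Otimes>\<^sub>M (count_space UNIV \<Otimes>\<^sub>M borel))"
    unfolding noise_def by (intro sets_pair_measure_cong) (auto simp: mvn_def)
  have "(\<lambda>q. block_upd (fst q) j (center (fst q) j + snd (snd q))) \<in> borel \<Otimes>\<^sub>M (count_space UNIV \<Otimes>\<^sub>M borel) \<rightarrow>\<^sub>M borel" for j :: 'd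
    by measurable
  then have "(\<lambda>q. block_upd (fst q) (fst (snd q)) (center (fst q) (fst (snd q)) + snd (snd q))) \<in> borel \<Otimes>\<^sub>M (count_space UNIV \<Otimes>\<^sub>M borel) \<rightarrow>\<^sub>M borel"
    by (rule measurable_compose_countable) measurable
  then show ?thesis
    unfolding gibbs_def split_beta' using measurable_cong_sets[OF sets refl] by blast
qed

lemma gibbs_int:
  assumes [measurable]: "F \<in> borel_measurable borel"
  shows "(\<integral>\<^sup>+w. F (gibbs x (j, w)) \<partial>mvn 0 Qi) = (\<integral>\<^sup>+z. ennreal (cond_target j x z) * F (block_upd x j z) \<partial>lborel)"
proof -
  have e: "mvn_density 0 Qi w = cond_target j x (center x j + w)" for w by (simp add: cond_target_def mvn_density_def)
  have "(\<integral>\<^sup>+w. F (gibbs x (j, w)) \<partial>mvn 0 Qi) = (\<integral>\<^sup>+w. ennreal (cond_target j x (center x j + w)) * F (block_upd x j (center x j + w)) \<partial>lborel)"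
    unfolding mvn_def e gibbs_def by (subst nn_integral_density) auto
  also have "\<dots> = (\<integral>\<^sup>+z. ennreal (cond_target j x z) * F (block_upd x j z) \<partial>lborel)"
    by (rule nn_integral_lborel_shift) measurable
  finally show ?thesis .
qed

lemma PI_gibbs_int:
  assumes [measurable]: "F \<in> borel_measurable (borel \<Otimes>\<^sub>M borel)"
  shows "(\<integral>\<^sup>+x. \<integral>\<^sup>+w. F (x, gibbs x w) \<partial>noise \<partial>PI)
    = (\<Sum>j\<in>UNIV. \<integral>\<^sup>+x. \<integral>\<^sup>+z. ennreal (p x * cond_target j x z) * F (x, block_upd x j z) \<partial>lborel \<partial>lborel) / ennreal d"
proof -
  note [measurable] = gibbs_meas
  have [measurable]: "(\<lambda>w. gibbs x (j, w)) \<in> borel_measurable borel" for x j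
    unfolding gibbs_def by simp
  have [measurable]: "gibbs x \<in> noise \<rightarrow>\<^sub>M borel" for x
    using measurable_Pair2[OF gibbs_meas, of x] by simp
  have "(\<integral>\<^sup>+x. \<integral>\<^sup>+w. F (x, gibbs x w) \<partial>noise \<partial>PI) = (\<integral>\<^sup>+x. (\<Sum>j\<in>UNIV. \<integral>\<^sup>+z. ennreal (cond_target j x z) * F (x, block_upd x j z) \<partial>lborel) / ennreal d \<partial>PI)"
  proof (rule nn_integral_cong)
    fix x
    have "(\<integral>\<^sup>+w. F (x, gibbs x w) \<partial>noise) = (\<Sum>j\<in>UNIV. \<integral>\<^sup>+w. F (x, gibbs x (j, w)) \<partial>mvn 0 Qi) / ennreal d"
      by (rule noise_int) measurable
    also have "\<dots> = (\<Sum>j\<in>UNIV. \<integral>\<^sup>+z. ennreal (cond_target j x z) * F (x, block_upd x j z) \<partial>lborel) / ennreal d"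
      by (intro arg_cong2[where f = "(/)"] sum.cong refl gibbs_int[of "\<lambda>y. F (x, y)"]) measurable
    finally show "(\<integral>\<^sup>+w. F (x, gibbs x w) \<partial>noise) = (\<Sum>j\<in>UNIV. \<integral>\<^sup>+z. ennreal (cond_target j x z) * F (x, block_upd x j z) \<partial>lborel) / ennreal d" .
  qed
  also have "\<dots> = (\<Sum>j\<in>UNIV. \<integral>\<^sup>+x. \<integral>\<^sup>+z. ennreal (cond_target j x z) * F (x, block_upd x j z) \<partial>lborel \<partial>PI) / ennreal d"
    by (subst nn_integral_divide, measurable, subst nn_integral_sum) auto
  also have "\<dots> = (\<Sum>j\<in>UNIV. \<integral>\<^sup>+x. \<integral>\<^sup>+z. ennreal (p x * cond_target j x z) * F (x, block_upd x j z) \<partial>lborel \<partial>lborel) / ennreal d"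
  proof (intro arg_cong2[where f = "(/)"] sum.cong refl)
    fix j
    show "(\<integral>\<^sup>+x. \<integral>\<^sup>+z. ennreal (cond_target j x z) * F (x, block_upd x j z) \<partial>lborel \<partial>PI)
       = (\<integral>\<^sup>+x. \<integral>\<^sup>+z. ennreal (p x * cond_target j x z) * F (x, block_upd x j z) \<partial>lborel \<partial>lborel)"
      using p_pos by (subst PI_int) (auto simp: nn_integral_cmult[symmetric] ennreal_mult' less_imp_le mult.assoc)
  qed
  finally show ?thesis .
qed

lemma random_map_gibbs: "random_map PI noise gibbs"
proof -
  interpret PI: prob_space PI by (rule prob_PI)
  interpret Q: prob_space "mvn 0 Qi" by (rule prob_Qi)
  interpret pp: pair_prob_space "measure_pmf (pmf_of_set (UNIV :: 'd set))" "mvn 0 Qi" ..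
  interpret n: prob_space noise unfolding noise_def by (rule pp.prob_space_axioms)
  show ?thesis
  proof
    show "sets PI = sets borel" by (rule sets_PI)
    show "case_prod gibbs \<in> borel \<Otimes>\<^sub>M noise \<rightarrow>\<^sub>M borel" by (rule gibbs_meas)
    fix F :: "(real ^ ('d \<times> 's)) \<times> (real ^ ('d \<times> 's)) \<Rightarrow> ennreal" assume [measurable]: "F \<in> borel_measurable (borel \<Otimes>\<^sub>M borel)"
    have "(\<integral>\<^sup>+x. \<integral>\<^sup>+z. ennreal (p x * cond_target j x z) * F (x, block_upd x j z) \<partial>lborel \<partial>lborel)
      = (\<integral>\<^sup>+x. \<integral>\<^sup>+z. ennreal (p x * cond_target j x z) * F (block_upd x j z, x) \<partial>lborel \<partial>lborel)" for j
      by (rule joint_swap[OF _ _ p_cond_target_sym]) measurable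
    then show "(\<integral>\<^sup>+x. \<integral>\<^sup>+w. F (x, gibbs x w) \<partial>noise \<partial>PI) = (\<integral>\<^sup>+x. \<integral>\<^sup>+w. F (gibbs x w, x) \<partial>noise \<partial>PI)"
      using PI_gibbs_int[of F] PI_gibbs_int[of "\<lambda>q. F (snd q, fst q)"] by simp
  qed
qed

lemma Q_norm_meas[measurable]: "Q_norm \<in> borel_measurable borel"
  unfolding Q_norm_def by measurable

lemma Q_norm_le: "Q_norm x \<le> sqrt \<alpha> * norm x"
proof -
  have "Q_norm x \<le> sqrt (\<alpha> * (x \<bullet> x))" unfolding Q_norm_def by (intro real_sqrt_le_mono quad_Qg_le)
  then show ?thesis by (simp add: real_sqrt_mult norm_eq_sqrt_inner)
qed

lemma norm_le_Q_norm: "norm x \<le> 1 / sqrt (\<alpha> * \<kappa>) * Q_norm x"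
proof -
  have "sqrt (\<alpha> * \<kappa> * (x \<bullet> x)) \<le> Q_norm x" unfolding Q_norm_def by (intro real_sqrt_le_mono quad_Qg_ge)
  then have "sqrt (\<alpha> * \<kappa>) * norm x \<le> Q_norm x" by (simp add: real_sqrt_mult norm_eq_sqrt_inner)
  moreover have "sqrt (\<alpha> * \<kappa>) > 0" using \<alpha>_pos \<kappa> by simp
  ultimately show ?thesis by (simp add: field_simps)
qed

lemma PI_moment: "(\<integral>\<^sup>+x. ennreal (norm (x - \<mu>)) \<partial>PI) < \<infinity>"
proof -
  have "(\<integral>\<^sup>+x. ennreal (norm (x - \<mu>)) \<partial>PI) = (\<integral>\<^sup>+x. ennreal (p (\<mu> + x)) * ennreal (norm (\<mu> + x - \<mu>)) \<partial>lborel)"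
    by (subst PI_int, measurable, rule nn_integral_lborel_shift[symmetric]) measurable
  also have "\<dots> = (\<integral>\<^sup>+x. ennreal (mvn_density 0 Sg x) * ennreal (norm x) \<partial>lborel)" by (simp add: mvn_density_def)
  also have "\<dots> = (\<integral>\<^sup>+x. ennreal (norm x) \<partial>mvn 0 Sg)" unfolding mvn_def by (subst nn_integral_density) auto
  also have "\<dots> < \<infinity>" unfolding Sg_def by (rule prob_space_mvn_emat(2)[OF Sg_pos])
  finally show ?thesis .
qed

text \<open>Averaging \<open>gibbs_contraction_sum\<close> over a uniform block gives the rate
  \<open>1 - \<kappa> / (2 * d)\<close> in \<open>Q_norm\<close>, which is comparable to the
  Euclidean norm because \<open>\<kappa>\<close> is positive.\<close>

theorem gibbs_gap:
  assumes g: "bdd_lipschitz g"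
  shows "ennreal (\<kappa> / (2 * d)) * (\<integral>\<^sup>+x. \<integral>\<^sup>+y. ennreal ((g x - g y)\<^sup>2) \<partial>PI \<partial>PI)
    \<le> (\<Sum>j\<in>UNIV. \<integral>\<^sup>+x. \<integral>\<^sup>+z. ennreal (p x * cond_target j x z * (g x - g (block_upd x j z))\<^sup>2) \<partial>lborel \<partial>lborel) / ennreal d"
proof -
  interpret R: random_map PI noise gibbs by (rule random_map_gibbs)
  note [measurable] = bdd_lipschitz_measurable[OF g] gibbs_meas
  have [measurable]: "(\<lambda>w. gibbs x (j, w)) \<in> borel_measurable borel" for x j
    unfolding gibbs_def by simp
  have [measurable]: "gibbs x \<in> noise \<rightarrow>\<^sub>M borel" for x
    using measurable_Pair2[OF gibbs_meas, of x] by simp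
  have d: "d > 0" using sizes(2) by simp
  have kd: "\<kappa> / (2 * d) \<le> 1 / 4" "0 < \<kappa> / (2 * d)" using \<kappa> sizes(2) by (auto simp: field_simps)
  have "ennreal (1 - (1 - \<kappa> / (2 * d))) * (\<integral>\<^sup>+x. \<integral>\<^sup>+y. ennreal ((g x - g y)\<^sup>2) \<partial>PI \<partial>PI)
    \<le> (\<integral>\<^sup>+x. \<integral>\<^sup>+w. ennreal ((g x - g (gibbs x w))\<^sup>2) \<partial>noise \<partial>PI)"
  proof (rule R.contraction_gap[where nn = Q_norm and c = "1 / sqrt (\<alpha> * \<kappa>)"])
    show "0 < 1 - \<kappa> / (2 * d)" "1 - \<kappa> / (2 * d) \<le> 1" using kd by auto
    show "0 \<le> Q_norm x" for x using quad_Qg_nonneg by (simp add: Q_norm_def)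
    show "norm x \<le> 1 / sqrt (\<alpha> * \<kappa>) * Q_norm x" for x by (rule norm_le_Q_norm)
    show "0 \<le> 1 / sqrt (\<alpha> * \<kappa>)" using \<alpha>_pos \<kappa> by simp
    show "(\<integral>\<^sup>+w. ennreal (Q_norm (gibbs x w - gibbs y w)) \<partial>noise) \<le> ennreal ((1 - \<kappa> / (2 * d)) * Q_norm (x - y))" for x y
    proof -
      interpret Q: prob_space "mvn 0 Qi" by (rule prob_Qi)
      have "(\<integral>\<^sup>+w. ennreal (Q_norm (gibbs x w - gibbs y w)) \<partial>noise) = (\<Sum>j\<in>UNIV. \<integral>\<^sup>+w. ennreal (Q_norm (gibbs x (j, w) - gibbs y (j, w))) \<partial>mvn 0 Qi) / ennreal d"
        by (rule noise_int) measurable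
      also have "\<dots> = (\<Sum>j\<in>UNIV. ennreal (Q_norm (gibbs x (j, 0) - gibbs y (j, 0)))) / ennreal d"
        using Q.emeasure_space_1 by (simp add: gibbs_diff)
      also have "\<dots> = ennreal ((\<Sum>j\<in>UNIV. Q_norm (gibbs x (j, 0) - gibbs y (j, 0))) / d)"
        using d quad_Qg_nonneg by (simp add: sum_ennreal divide_ennreal Q_norm_def sum_nonneg)
      also have "\<dots> \<le> ennreal ((1 - \<kappa> / (2 * d)) * Q_norm (x - y))"
      proof (rule ennreal_leI)
        have "(\<Sum>j\<in>UNIV. Q_norm (gibbs x (j, 0) - gibbs y (j, 0))) / d \<le> (d - \<kappa> / 2) * Q_norm (x - y) / d"
          using d by (intro divide_right_mono gibbs_contraction_sum) auto
        also have "\<dots> = (1 - \<kappa> / (2 * d)) * Q_norm (x - y)" using d by (simp add: field_simps)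
        finally show "(\<Sum>j\<in>UNIV. Q_norm (gibbs x (j, 0) - gibbs y (j, 0))) / d \<le> (1 - \<kappa> / (2 * d)) * Q_norm (x - y)" .
      qed
      finally show ?thesis .
    qed
    show "(\<integral>\<^sup>+x. \<integral>\<^sup>+y. ennreal (Q_norm (x - y)) \<partial>PI \<partial>PI) < \<infinity>"
    proof -
      have "(\<integral>\<^sup>+x. \<integral>\<^sup>+y. ennreal (Q_norm (x - y)) \<partial>PI \<partial>PI)
         \<le> (\<integral>\<^sup>+x. \<integral>\<^sup>+y. ennreal (sqrt \<alpha>) * (ennreal (norm (x - \<mu>)) + ennreal (norm (y - \<mu>))) \<partial>PI \<partial>PI)"
      proof (intro nn_integral_mono)
        fix x y
        have "norm (x - y) \<le> norm (x - \<mu>) + norm (y - \<mu>)" using norm_triangle_ineq4[of "x - \<mu>" "y - \<mu>"] by simp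
        then have "sqrt \<alpha> * norm (x - y) \<le> sqrt \<alpha> * (norm (x - \<mu>) + norm (y - \<mu>))"
          using \<alpha>_pos by (intro mult_left_mono) auto
        then have "Q_norm (x - y) \<le> sqrt \<alpha> * (norm (x - \<mu>) + norm (y - \<mu>))" using Q_norm_le[of "x - y"] by linarith
        then show "ennreal (Q_norm (x - y)) \<le> ennreal (sqrt \<alpha>) * (ennreal (norm (x - \<mu>)) + ennreal (norm (y - \<mu>)))"
          using \<alpha>_pos by (simp add: ennreal_plus[symmetric] ennreal_mult'[symmetric] ennreal_leI del: ennreal_plus)
      qed
      also have "\<dots> = ennreal (sqrt \<alpha>) * ((\<integral>\<^sup>+x. ennreal (norm (x - \<mu>)) \<partial>PI) + (\<integral>\<^sup>+x. ennreal (norm (x - \<mu>)) \<partial>PI))"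
        by (simp add: nn_integral_add nn_integral_cmult R.m.emeasure_space_1)
      also have "\<dots> < \<infinity>" using PI_moment by (simp add: ennreal_mult_less_top)
      finally show ?thesis .
    qed
  qed (use g in auto)
  also have "\<dots> = (\<Sum>j\<in>UNIV. \<integral>\<^sup>+x. \<integral>\<^sup>+z. ennreal (p x * cond_target j x z * (g x - g (block_upd x j z))\<^sup>2) \<partial>lborel \<partial>lborel) / ennreal d"
    using PI_gibbs_int[of "\<lambda>q. ennreal ((g (fst q) - g (snd q))\<^sup>2)"] by (simp add: ennreal_mult'')
  finally show ?thesis by simp
qed

section \<open>Operator norm of the deterministic scan\<close>

text \<open>Random-scan gap and blockwise comparison are chained. The factor \<open>1 / d\<close>
  occurs on both sides and cancels, and 1920 is 960 times the 2 of the Dirichlet form.\<close>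

lemma gap_sum:
  assumes \<phi>: "bdd_lipschitz \<phi>"
  defines "g \<equiv> \<lambda>x. \<phi> x - (\<integral>y. \<phi> y \<partial>PI)"
  shows "\<kappa> * (\<integral>x. (g x)\<^sup>2 \<partial>PI) \<le> 1920 * s * (\<Sum>j\<in>UNIV. gap_form PI (block_kernel j) g)"
proof -
  interpret PI: prob_space PI by (rule prob_PI)
  obtain C where C: "\<And>x. \<bar>\<phi> x\<bar> \<le> C" using \<phi> by (auto simp: bdd_lipschitz_def)
  have bdd_meas: "bdd_meas g" unfolding g_def using C bdd_lipschitz_measurable[OF \<phi>] by (intro bdd_meas_diff bdd_meas_const) (auto simp: bdd_meas_def)
  note [measurable] = bdd_lipschitz_measurable[OF \<phi>]
  let ?V = "\<integral>x. (g x)\<^sup>2 \<partial>PI"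
  have d: "d > 0" and s: "s > 0" using sizes by auto
  have gap: "(\<integral>\<^sup>+x. \<integral>\<^sup>+y. ennreal ((\<phi> x - \<phi> y)\<^sup>2) \<partial>block_kernel j x \<partial>PI) = ennreal (2 * gap_form PI (block_kernel j) g)" "0 \<le> gap_form PI (block_kernel j) g" for j
  proof -
    interpret j: psd_kernel PI "block_kernel j" by (rule psd_block_kernel)
    show "(\<integral>\<^sup>+x. \<integral>\<^sup>+y. ennreal ((\<phi> x - \<phi> y)\<^sup>2) \<partial>block_kernel j x \<partial>PI) = ennreal (2 * gap_form PI (block_kernel j) g)" "0 \<le> gap_form PI (block_kernel j) g"
      using j.dirichlet_form[OF bdd_meas] by (auto simp: g_def)
  qed
  have "ennreal (\<kappa> / (2 * d)) * ennreal (2 * ?V)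
     \<le> (\<Sum>j\<in>UNIV. \<integral>\<^sup>+x. \<integral>\<^sup>+z. ennreal (p x * cond_target j x z * (\<phi> x - \<phi> (block_upd x j z))\<^sup>2) \<partial>lborel \<partial>lborel) / ennreal d"
    using gibbs_gap[OF \<phi>] PI.nn_integral_pair_diff_sq[of \<phi> C] C by (simp add: g_def)
  also have "\<dots> \<le> (\<Sum>j\<in>UNIV. ennreal (960 * s) * ennreal (2 * gap_form PI (block_kernel j) g)) / ennreal d"
    using gibbs_le_mala[OF \<phi>] by (intro divide_right_mono_ennreal sum_mono) (simp add: gap(1))
  also have "\<dots> = ennreal ((\<Sum>j\<in>UNIV. 960 * s * (2 * gap_form PI (block_kernel j) g)) / d)"
    using d s gap(2) by (simp add: ennreal_mult[symmetric] sum_ennreal divide_ennreal sum_nonneg)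
  finally have "ennreal (\<kappa> / (2 * d) * (2 * ?V)) \<le> ennreal ((\<Sum>j\<in>UNIV. 960 * s * (2 * gap_form PI (block_kernel j) g)) / d)"
    using \<kappa> d by (simp add: ennreal_mult'[symmetric])
  then have "\<kappa> / (2 * d) * (2 * ?V) \<le> (\<Sum>j\<in>UNIV. 960 * s * (2 * gap_form PI (block_kernel j) g)) / d"
    using d s gap(2) by (subst (asm) ennreal_le_iff) (auto intro!: divide_nonneg_nonneg sum_nonneg)
  then have "\<kappa> * ?V / d \<le> (\<Sum>j\<in>UNIV. 960 * s * (2 * gap_form PI (block_kernel j) g)) / d" by simp
  then have "\<kappa> * ?V \<le> (\<Sum>j\<in>UNIV. 960 * s * (2 * gap_form PI (block_kernel j) g))" using d by (simp add: divide_le_cancel)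
  also have "\<dots> = 1920 * s * (\<Sum>j\<in>UNIV. gap_form PI (block_kernel j) g)" by (simp add: sum_distrib_left mult_ac)
  finally show ?thesis .
qed

abbreviation scan_kernel :: "real ^ ('d \<times> 's) \<Rightarrow> (real ^ ('d \<times> 's)) measure" where
  "scan_kernel \<equiv> dcw_mala_kernel p (\<lambda>_. h)"

text \<open>\<open>gap_sum\<close> bounds the variance by the total gap and \<open>scan_gap\<close>
  bounds the total gap by the loss of norm along the scan; together \<open>\<kappa> * ?V\<close> is
  at most \<open>1920 * s * d^2\<close> times that loss.\<close>

lemma scan_kernel_contraction:
  assumes \<phi>: "bdd_lipschitz \<phi>" and q: "0 \<le> q" "1 - \<kappa> / (1920 * s * d\<^sup>2) \<le> q\<^sup>2"
  shows "(\<integral>\<^sup>+x. ennreal ((kernel_op scan_kernel \<phi> x - (\<integral>y. \<phi> y \<partial>PI))\<^sup>2) \<partial>PI) \<le> ennreal (q\<^sup>2) * (\<integral>\<^sup>+x. ennreal ((\<phi> x)\<^sup>2) \<partial>PI)"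
proof -
  interpret PI: prob_space PI by (rule prob_PI)
  let ?js = "sorted_list_of_set (UNIV :: 'd set)"
  define g where "g x = \<phi> x - (\<integral>y. \<phi> y \<partial>PI)" for x
  obtain C where C: "\<And>x. \<bar>\<phi> x\<bar> \<le> C" using \<phi> by (auto simp: bdd_lipschitz_def)
  note [measurable] = bdd_lipschitz_measurable[OF \<phi>]
  have bdd_meas\<phi>: "bdd_meas \<phi>" using C by (auto simp: bdd_meas_def)
  then have bdd_meas: "bdd_meas g" unfolding g_def[abs_def] by (intro bdd_meas_diff bdd_meas_const)
  \<comment> \<open>An arbitrary block: the interpretation is used for integrability facts under
    \<open>PI\<close>.\<close>
  interpret j0: psd_kernel PI "block_kernel undefined" by (rule psd_block_kernel)
  let ?Tg = "fold (\<lambda>j. kernel_op (block_kernel j)) ?js g"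
  let ?V = "\<integral>x. (g x)\<^sup>2 \<partial>PI"
  have d: "d > 0" and s: "s > 0" using sizes by auto
  have scan_kernel: "scan_kernel = kernel_scan block_kernel ?js" by (simp add: dcw_mala_kernel_def)
  have meas: "scan_kernel \<in> borel \<rightarrow>\<^sub>M prob_algebra borel" unfolding scan_kernel by (intro kernel_scan_measurable block_kernel_meas)
  have scan: "bdd_meas ?Tg" "(\<Sum>j\<in>UNIV. gap_form PI (block_kernel j) g) \<le> d\<^sup>2 * (?V - (\<integral>x. (?Tg x)\<^sup>2 \<partial>PI))"
    using scan_gap[of ?js PI block_kernel g] psd_block_kernel bdd_meas
    by (auto simp: sum_list_distinct_conv_sum_set d_def)
  have V0: "?V \<ge> 0" by simp
  have "\<kappa> * ?V \<le> 1920 * s * (d\<^sup>2 * (?V - (\<integral>x. (?Tg x)\<^sup>2 \<partial>PI)))"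
    using gap_sum[OF \<phi>] scan(2) s unfolding g_def[symmetric]
    by (smt (verit) mult_left_mono zero_less_mult_iff)
  then have "\<kappa> * ?V / (1920 * s * d\<^sup>2) \<le> ?V - (\<integral>x. (?Tg x)\<^sup>2 \<partial>PI)"
    using s d by (simp add: pos_divide_le_eq mult_ac)
  then have "(\<integral>x. (?Tg x)\<^sup>2 \<partial>PI) \<le> (1 - \<kappa> / (1920 * s * d\<^sup>2)) * ?V" by (simp add: left_diff_distrib)
  also have "\<dots> \<le> q\<^sup>2 * ?V" using q(2) V0 by (rule mult_right_mono)
  also have "\<dots> \<le> q\<^sup>2 * (\<integral>x. (\<phi> x)\<^sup>2 \<partial>PI)"
  proof (rule mult_left_mono)
    \<comment> \<open>The variance is at most the second moment, so replacing \<open>\<phi>\<close>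
      by its centred version can only lower the norm.\<close>
    show "?V \<le> (\<integral>x. (\<phi> x)\<^sup>2 \<partial>PI)"
      using PI.variance_eq[OF j0.bdd_meas_integrable[OF bdd_meas\<phi>] j0.bdd_meas_sq_int[OF bdd_meas\<phi>]] by (simp add: g_def)
  qed simp
  finally have main: "(\<integral>x. (?Tg x)\<^sup>2 \<partial>PI) \<le> q\<^sup>2 * (\<integral>x. (\<phi> x)\<^sup>2 \<partial>PI)" .
  have op: "kernel_op scan_kernel \<phi> x - (\<integral>y. \<phi> y \<partial>PI) = ?Tg x" for x
  proof -
    have S: "prob_space (scan_kernel x)" and sets[measurable_cong]: "sets (scan_kernel x) = sets borel"
      using measurable_space[OF meas, of x] by (auto simp: space_prob_algebra)
    interpret S: prob_space "scan_kernel x" by (rule S)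
    have "integrable (scan_kernel x) \<phi>" using C by (intro S.integrable_const_bound[where B = C]) auto
    then have "kernel_op scan_kernel \<phi> x - (\<integral>y. \<phi> y \<partial>PI) = kernel_op scan_kernel g x"
      by (simp add: kernel_op_def g_def[abs_def] S.prob_space)
    also have "\<dots> = ?Tg x"
      unfolding scan_kernel by (rule fun_cong, rule kernel_scan_op[OF _ bdd_meas]) (use psd_block_kernel in \<open>auto simp: psd_kernel_def\<close>)
    finally show ?thesis .
  qed
  have "(\<integral>\<^sup>+x. ennreal ((kernel_op scan_kernel \<phi> x - (\<integral>y. \<phi> y \<partial>PI))\<^sup>2) \<partial>PI) = ennreal (\<integral>x. (?Tg x)\<^sup>2 \<partial>PI)"
    unfolding op using j0.bdd_meas_sq_int[OF scan(1)] by (intro nn_integral_eq_integral) auto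
  also have "\<dots> \<le> ennreal (q\<^sup>2 * (\<integral>x. (\<phi> x)\<^sup>2 \<partial>PI))" using main by (rule ennreal_leI)
  also have "\<dots> = ennreal (q\<^sup>2) * (\<integral>\<^sup>+x. ennreal ((\<phi> x)\<^sup>2) \<partial>PI)"
    using j0.bdd_meas_sq_int[OF bdd_meas\<phi>] by (subst nn_integral_eq_integral) (auto simp: ennreal_mult')
  finally show ?thesis .
qed

theorem scan_kernel_opnorm:
  assumes q: "0 \<le> q" "1 - \<kappa> / (1920 * s * d\<^sup>2) \<le> q\<^sup>2"
  shows "L2_opnorm PI (\<lambda>f x. kernel_op scan_kernel f x - (\<integral>y. f y \<partial>PI)) \<le> ereal q"
proof (rule L2_opnorm_le_dense[OF prob_PI sets_PI _ _ q(1) scan_kernel_contraction[OF _ q]])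
  have scan_kernel: "scan_kernel = kernel_scan block_kernel (sorted_list_of_set UNIV)" by (simp add: dcw_mala_kernel_def)
  show "scan_kernel \<in> borel \<rightarrow>\<^sub>M prob_algebra borel" unfolding scan_kernel by (intro kernel_scan_measurable block_kernel_meas)
  show "(\<integral>\<^sup>+x. \<integral>\<^sup>+y. F y \<partial>scan_kernel x \<partial>PI) = (\<integral>\<^sup>+x. F x \<partial>PI)" if "F \<in> borel_measurable borel" for F
    unfolding scan_kernel by (rule kernel_scan_invariant[OF _ that sets_PI]) (use psd_block_kernel in \<open>auto simp: psd_kernel_def\<close>)
qed

end

section \<open>Largest eigenvalue and conclusion\<close>

context exch begin

lemma submat_Qg: "submat Qg j j = Qs"
  by (simp add: submat_def Qg_def Qs_def emat_def vec_eq_iff)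

lemma block_block_diag: "block (block_diag (\<lambda>_. B) *v x) j = B *v block x j"
proof -
  have "(block_diag (\<lambda>_. B) *v x) $ (j, a) = (B *v block x j) $ a" for a
  proof -
    have "(block_diag (\<lambda>_. B) *v x) $ (j, a) = (\<Sum>i\<in>UNIV \<times> UNIV. (if j = fst i then B $ a $ snd i else 0) * x $ i)"
      by (simp only: matrix_vector_mult_def block_diag_def vec_lambda_beta fst_conv snd_conv UNIV_Times_UNIV)
    also have "\<dots> = (\<Sum>k\<in>UNIV. \<Sum>b\<in>UNIV. (if j = k then B $ a $ b else 0) * x $ (k, b))"
      by (simp add: sum.cartesian_product split_beta)
    also have "\<dots> = (\<Sum>k\<in>UNIV. if j = k then \<Sum>b\<in>UNIV. B $ a $ b * x $ (k, b) else 0)"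
      by (intro sum.cong) auto
    finally show ?thesis by (simp add: matrix_vector_mult_def block_def)
  qed
  then show ?thesis by (simp add: vec_eq_iff block_def)
qed

text \<open>\<open>I - D Q\<close> replaces each entry of a block by this multiple of the sum of all
  entries outside the block.\<close>

definition off_coeff :: real where "off_coeff = \<beta> / (1 - s * \<beta>)"

lemma off_coeff_eq: "off_coeff = \<zeta> / (1 + (N - s - 1) * \<zeta>)"
  unfolding off_coeff_def one_minus_s\<beta> unfolding \<beta>_def using denom_pos by simp

lemma off_coeff_nonneg: "0 \<le> off_coeff" unfolding off_coeff_eq using \<zeta> denom_pos by simp

lemma block_I_minus_DQ:
  "block ((mat 1 - block_diag (\<lambda>j. matrix_inv (submat Qg j j)) ** Qg) *v x) j = (off_coeff * (x \<bullet> 1 - block x j \<bullet> 1)) *\<^sub>R 1"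
proof -
  let ?T = "x \<bullet> 1"
  have nz: "1 - s * \<beta> \<noteq> 0" "\<alpha> \<noteq> 0" using s\<beta>_half \<alpha>_pos by auto
  have iQs: "matrix_inv Qs = Qi" using Qs_Qi Qi_Qs by (rule matrix_inv_eqI)
  have one: "(1 :: real ^ 's) \<bullet> 1 = s" by (simp add: inner_vec_def s_def)
  have b: "block (Qg *v x) j = \<alpha> *\<^sub>R (block x j - (\<beta> * ?T) *\<^sub>R 1)"
    by (simp add: Qg_def emat_mult_vec sum_vec_eq_inner block_add block_diff block_scaleR block_one scaleR_diff_right mult.assoc)
  have Qi: "Qi *v w = (1 / \<alpha>) *\<^sub>R (w + (off_coeff * (w \<bullet> 1)) *\<^sub>R 1)" for w
    by (simp add: Qi_def emat_mult_vec sum_vec_eq_inner off_coeff_def scaleR_add_right)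
  have c: "\<beta> + off_coeff * (\<beta> * s) = off_coeff" using nz by (simp add: off_coeff_def field_simps)
  have "Qi *v block (Qg *v x) j = block x j - (\<beta> * ?T) *\<^sub>R 1 + (off_coeff * (block x j \<bullet> 1 - \<beta> * ?T * s)) *\<^sub>R 1"
    unfolding b Qi using nz by (simp add: inner_diff_left one scaleR_add_right scaleR_diff_right right_diff_distrib diff_divide_distrib mult_ac)
  then have "block x j - Qi *v block (Qg *v x) j = (\<beta> * ?T - off_coeff * (block x j \<bullet> 1 - \<beta> * ?T * s)) *\<^sub>R 1"
    by (simp only: scaleR_diff_left) simp
  also have "\<beta> * ?T - off_coeff * (block x j \<bullet> 1 - \<beta> * ?T * s) = (\<beta> + off_coeff * (\<beta> * s)) * ?T - off_coeff * (block x j \<bullet> 1)"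
    by (simp add: algebra_simps)
  also have "(\<beta> + off_coeff * (\<beta> * s)) * ?T - off_coeff * (block x j \<bullet> 1) = off_coeff * (?T - block x j \<bullet> 1)"
    unfolding c by (simp add: right_diff_distrib)
  finally show ?thesis
    by (simp add: submat_Qg iQs matrix_vector_mult_diff_rdistrib block_diff matrix_vector_mul_assoc[symmetric] block_block_diag)
qed

text \<open>An eigenvector with nonzero total sum has eigenvalue \<open>(N - s) * off_coeff\<close>.
  If the total sum is zero but some block sum is not, the eigenvalue is
  \<open>- s * off_coeff\<close>, and if all block sums vanish it is 0. The largest candidate is
  attained at the all-ones vector.\<close>

lemma max_eigenvalue_I_minus_DQ:
  "max_eigenvalue (mat 1 - block_diag (\<lambda>j. matrix_inv (submat Qg j j)) ** Qg) = (N - s) * off_coeff"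
proof -
  let ?M = "mat 1 - block_diag (\<lambda>j. matrix_inv (submat Qg j j)) ** Qg"
  have one: "(1 :: real ^ 's) \<bullet> 1 = s" "(1 :: real ^ ('d \<times> 's)) \<bullet> 1 = N" by (simp_all add: inner_vec_def s_def N_def)
  have block_eqI: "x = y" if "\<And>j. block x j = block y j" for x y :: "real ^ ('d \<times> 's)"
  proof -
    have "x $ (j, a) = y $ (j, a)" for j a using that[of j] by (simp add: block_def vec_eq_iff)
    then show ?thesis by (simp add: vec_eq_iff)
  qed
  have sub: "eigenvalues ?M \<subseteq> {(N - s) * off_coeff, - s * off_coeff, 0}"
  proof
    fix k assume "k \<in> eigenvalues ?M"
    then obtain v where v: "v \<noteq> 0" "?M *v v = k *\<^sub>R v" by (auto simp: eigenvalues_def)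
    define T where "T = v \<bullet> 1"
    have blk: "k *\<^sub>R block v j = (off_coeff * (T - block v j \<bullet> 1)) *\<^sub>R 1" for j
      using block_I_minus_DQ[of v j] v(2) by (simp add: block_scaleR T_def)
    have Tj: "k * (block v j \<bullet> 1) = off_coeff * (T - block v j \<bullet> 1) * s" for j
      using arg_cong[OF blk[of j], of "\<lambda>w. w \<bullet> 1"] by (simp add: one)
    have sumT: "(\<Sum>j\<in>UNIV. block v j \<bullet> 1) = T" unfolding T_def by (subst inner_eq_sum_block) (simp add: block_one)
    have "k * T = (\<Sum>j\<in>UNIV. k * (block v j \<bullet> 1))" by (simp add: sumT[symmetric] sum_distrib_left)
    also have "\<dots> = off_coeff * s * (d * T - T)"
      unfolding Tj by (simp add: sum_distrib_left[symmetric] sum_distrib_right[symmetric] sum_subtractf sumT d_def mult_ac)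
    also have "\<dots> = (N - s) * off_coeff * T" using sizes(1) by (simp add: algebra_simps)
    finally have kT: "k * T = (N - s) * off_coeff * T" .
    show "k \<in> {(N - s) * off_coeff, - s * off_coeff, 0}"
    proof (cases "T = 0")
      case False
      then show ?thesis using kT by simp
    next
      case T: True
      show ?thesis
      proof (cases "\<forall>j. block v j \<bullet> 1 = 0")
        case True
        then have "k *\<^sub>R v = 0" using blk T by (intro block_eqI) (simp add: block_scaleR block_def[of 0] vec_eq_iff)
        then show ?thesis using v(1) by simp
      next
        case False
        then obtain j where j: "block v j \<bullet> 1 \<noteq> 0" by blast
        have "k * (block v j \<bullet> 1) = (- s * off_coeff) * (block v j \<bullet> 1)" using Tj[of j] T by (simp add: mult_ac)
        then have "k = - s * off_coeff" using j by (simp only: mult_cancel_right) simp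
        then show ?thesis by simp
      qed
    qed
  qed
  have mem: "(N - s) * off_coeff \<in> eigenvalues ?M"
    unfolding eigenvalues_def
  proof (intro CollectI exI[of _ 1] conjI)
    show "(1 :: real ^ ('d \<times> 's)) \<noteq> 0" by (simp add: vec_eq_iff)
    show "?M *v 1 = ((N - s) * off_coeff) *\<^sub>R 1"
      by (rule block_eqI) (simp add: block_I_minus_DQ block_scaleR block_one one mult.commute)
  qed
  have nn: "0 \<le> (N - s) * off_coeff" "0 \<le> s * off_coeff" using off_coeff_nonneg sizes(3,4) by auto
  show ?thesis
    unfolding max_eigenvalue_def
  proof (rule Max_eqI)
    show "finite (eigenvalues ?M)" using sub by (rule finite_subset) simp
    show "y \<le> (N - s) * off_coeff" if "y \<in> eigenvalues ?M" for y using that sub nn by auto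
  qed (rule mem)
qed

end

text \<open>\<open>matrix_inv\<close> is a choice, so inverting twice requires a genuine two-sided
  inverse; definiteness supplies it through a trivial kernel.\<close>

lemma sym_pos_def_inverse:
  assumes "sym_pos_def Q"
  shows "matrix_inv (matrix_inv Q) = Q"
proof -
  have "x = 0" if "Q *v x = 0" for x
    using assms that unfolding sym_pos_def_def by (metis inner_zero_right less_irrefl)
  then obtain B where B: "B ** Q = mat 1" using matrix_left_invertible_ker by blast
  then have B': "Q ** B = mat 1" by (simp add: matrix_left_right_inverse)
  then have "matrix_inv Q = B" using B by (rule matrix_inv_eqI)
  then show ?thesis using B B' by (simp add: matrix_inv_eqI)
qed

theorem proposition5p6:
  fixes \<mu> :: "real ^ ('d::{finite, linorder} \<times> 's::finite)"
    and Q :: "real ^ ('d \<times> 's) ^ ('d \<times> 's)"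
    and \<zeta> c0 :: real and h :: "'d \<Rightarrow> real" and N s d :: nat
  assumes "N = CARD('d \<times> 's)" and "s = CARD('s)" and "d = CARD('d)" and "d \<ge> 2"
    and "c0 = 1 / (102400 * pi)"
    and "sym_pos_def Q"
    and "0 \<le> \<zeta>" and "\<zeta> < 1"
    and "matrix_inv Q = (1 - \<zeta>) *\<^sub>R mat 1 + \<zeta> *\<^sub>R
           ((columnvector 1 :: real ^ 1 ^ ('d \<times> 's)) ** (rowvector 1 :: real ^ ('d \<times> 's) ^ 1))"
    and "\<And>j. h j = (1 - \<zeta>) / sqrt (10 * real s)"
  shows "max_eigenvalue (mat 1 - block_diag (\<lambda>j. matrix_inv (submat Q j j)) ** Q)
           = (real N - real s) * \<zeta> / (1 + (real N - real s - 1) * \<zeta>)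
       \<and> L2_opnorm (mvn \<mu> (matrix_inv Q))
           (\<lambda>f x. kernel_op (dcw_mala_kernel (mvn_density \<mu> (matrix_inv Q)) h) f x
                  - (\<integral>y. f y \<partial>mvn \<mu> (matrix_inv Q)))
         \<le> ereal (1 - c0 ^ 3 * (1 - \<zeta>) / (2 ^ 9 * real N * sqrt (real s) * (real d + 1))
                     * ((1 + (real N - real s - 1) * \<zeta>)\<^sup>2 / (1 + (real N - 1) * \<zeta>) ^ 3))"
proof -
  define h0 where "h0 = (1 - \<zeta>) / sqrt (10 * real CARD('s))"
  interpret E: exch \<mu> \<zeta> h0
    by unfold_locales (use assms in \<open>auto simp: h0_def\<close>)
  have N: "real N = E.N" and s: "real s = E.s" and d: "real d = E.d"
    using assms(1-3) by (simp_all add: E.N_def E.s_def E.d_def)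
  have h: "h = (\<lambda>_. h0)" using assms(2,10) by (auto simp: h0_def)
  have Sg: "matrix_inv Q = E.Sg"
    unfolding assms(9) E.Sg_def
    by (simp add: vec_eq_iff emat_def mat_def columnvector_def rowvector_def matrix_matrix_mult_def)
  then have Q: "Q = E.Qg" using sym_pos_def_inverse[OF assms(6)] E.inv_Sg by simp
  \<comment> \<open>The eigenbasis of a block is fixed here; the final statement is independent of
    it.\<close>
  obtain f :: "real ^ 's \<Rightarrow> real ^ 's" and k where f: "orthogonal_transformation f"
    and diag: "\<And>a b x. emat a b *v f x = f (\<Sum>e\<in>Basis. (eig k a b e * (x \<bullet> e)) *\<^sub>R e)"
    using emat_diagonalize by blast
  interpret F: exch_fibre \<mu> \<zeta> h0 f k by unfold_locales (rule f, rule diag)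
  define \<rho> where "\<rho> = 1 - E.s * E.\<beta>"
  \<comment> \<open>The \<open>\<zeta>\<close>-dependence of the asserted rate is
    \<open>\<kappa> * \<rho>^2\<close>, with \<open>\<kappa> = 1 - N * \<beta>\<close> and
    \<open>\<rho> = 1 - s * \<beta>\<close>.\<close>
  define \<delta> where "\<delta> = c0 ^ 3 / (2 ^ 9 * E.N * sqrt E.s * (E.d + 1)) * (F.\<kappa> * \<rho>\<^sup>2)"
  have \<delta>_eq: "c0 ^ 3 * (1 - \<zeta>) / (2 ^ 9 * real N * sqrt (real s) * (real d + 1))
       * ((1 + (real N - real s - 1) * \<zeta>)\<^sup>2 / (1 + (real N - 1) * \<zeta>) ^ 3) = \<delta>"
    unfolding \<delta>_def \<rho>_def F.\<kappa>_def E.one_minus_N\<beta> E.one_minus_s\<beta> N s d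
    by (simp add: power2_eq_square power3_eq_cube mult_ac)
  have \<rho>: "0 \<le> \<rho>" "\<rho> \<le> 1" using E.s\<beta>_half E.\<beta>_nonneg E.sizes(3) by (auto simp: \<rho>_def)
  have c0: "0 < c0" "c0 \<le> 1 / 100"
    unfolding assms(5) using pi_gt3 by (auto simp: field_simps)
  have "\<delta> \<le> F.\<kappa> / (3840 * E.s * E.d\<^sup>2)" "0 \<le> \<delta>"
  proof -
    have s1: "1 \<le> E.s" "1 \<le> sqrt E.s" and d1: "2 \<le> E.d" using E.sizes by auto
    have "c0 ^ 3 \<le> (1 / 100) ^ 3" using c0 by (intro power_mono) auto
    \<comment> \<open>The crude bound suffices: together with \<open>2^9\<close> it gives
      \<open>8 * 512 = 4096\<close>, which exceeds 3840.\<close>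
    then have c3: "c0 ^ 3 \<le> 1 / 8" "0 \<le> c0 ^ 3" using c0 by (auto simp: power3_eq_cube)
    have r2: "F.\<kappa> * \<rho>\<^sup>2 \<le> F.\<kappa> * 1" "0 \<le> F.\<kappa> * \<rho>\<^sup>2" using \<rho> F.\<kappa> by (auto intro!: mult_left_mono simp: power_le_one)
    have "E.N * 1 * E.d \<le> E.N * sqrt E.s * (E.d + 1)"
      using E.sizes(5) s1 d1 by (intro mult_mono) auto
    moreover have "E.s * E.d\<^sup>2 = E.N * 1 * E.d" using E.sizes(1) by (simp add: power2_eq_square mult_ac)
    moreover have "2 ^ 9 * E.N * sqrt E.s * (E.d + 1) = 512 * (E.N * sqrt E.s * (E.d + 1))" by simp
    ultimately have den: "512 * (E.s * E.d\<^sup>2) \<le> 2 ^ 9 * E.N * sqrt E.s * (E.d + 1)" by linarith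
    have pos: "0 < 512 * (E.s * E.d\<^sup>2)" using s1 d1 by simp
    have q: "c0 ^ 3 / (2 ^ 9 * E.N * sqrt E.s * (E.d + 1)) \<le> (1 / 8) / (512 * (E.s * E.d\<^sup>2))"
      using c3 den pos by (intro frac_le) auto
    have "\<delta> \<le> (1 / 8) / (512 * (E.s * E.d\<^sup>2)) * (F.\<kappa> * 1)"
      unfolding \<delta>_def using pos by (intro mult_mono q r2) simp
    also have "\<dots> = F.\<kappa> / (4096 * (E.s * E.d\<^sup>2))" by simp
    also have "\<dots> \<le> F.\<kappa> / (3840 * E.s * E.d\<^sup>2)"
      using pos F.\<kappa> by (intro frac_le) auto
    finally show "\<delta> \<le> F.\<kappa> / (3840 * E.s * E.d\<^sup>2)" .
    show "0 \<le> \<delta>" unfolding \<delta>_def using r2 c3 E.sizes by (intro mult_nonneg_nonneg divide_nonneg_nonneg) auto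
  qed
  moreover have "F.\<kappa> / (3840 * E.s * E.d\<^sup>2) \<le> 1"
  proof -
    have "1 \<le> E.s * E.d\<^sup>2" using E.sizes(2,3) by (intro mult_ge1_I) (auto simp: one_le_power)
    then show ?thesis using F.\<kappa> by (simp add: pos_divide_le_eq)
  qed
  \<comment> \<open>Passing from squared norms to norms:
    \<open>(1 - \<delta>)^2 \<ge> 1 - 2 * \<delta>\<close>, which is why 1920 is doubled to
    3840.\<close>
  ultimately have \<delta>: "0 \<le> 1 - \<delta>" "1 - F.\<kappa> / (1920 * E.s * E.d\<^sup>2) \<le> (1 - \<delta>)\<^sup>2"
  proof -
    assume a: "\<delta> \<le> F.\<kappa> / (3840 * E.s * E.d\<^sup>2)" "0 \<le> \<delta>" "F.\<kappa> / (3840 * E.s * E.d\<^sup>2) \<le> 1"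
    show "0 \<le> 1 - \<delta>" using a by linarith
    have "F.\<kappa> / (1920 * E.s * E.d\<^sup>2) = 2 * (F.\<kappa> / (3840 * E.s * E.d\<^sup>2))" by simp
    then have "2 * \<delta> \<le> F.\<kappa> / (1920 * E.s * E.d\<^sup>2)" using a by linarith
    moreover have "(1 - \<delta>)\<^sup>2 = 1 - 2 * \<delta> + \<delta>\<^sup>2" by (simp add: power2_diff)
    moreover have "0 \<le> \<delta>\<^sup>2" by simp
    ultimately show "1 - F.\<kappa> / (1920 * E.s * E.d\<^sup>2) \<le> (1 - \<delta>)\<^sup>2" by linarith
  qed
  have "max_eigenvalue (mat 1 - block_diag (\<lambda>j. matrix_inv (submat Q j j)) ** Q)
           = (real N - real s) * \<zeta> / (1 + (real N - real s - 1) * \<zeta>)"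
    unfolding Q E.max_eigenvalue_I_minus_DQ E.off_coeff_eq N s by simp
  moreover have "L2_opnorm (mvn \<mu> (matrix_inv Q))
           (\<lambda>f x. kernel_op (dcw_mala_kernel (mvn_density \<mu> (matrix_inv Q)) h) f x
                  - (\<integral>y. f y \<partial>mvn \<mu> (matrix_inv Q))) \<le> ereal (1 - \<delta>)"
    unfolding Sg h by (rule F.scan_kernel_opnorm[OF \<delta>])
  ultimately show ?thesis unfolding \<delta>_eq by blast
qed

end
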